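(* Let $\mathbf{k}$ be a field of characteristic $0$ and $B$ a $\mathbb{Z}$-graded affine $\mathbf{k}$-domain. (a) $\mathrm{NR}(B) = \bigcup_{d \in M(B)} \mathcal{I}_d$. (b) If $B$ is normal then each element $d$ of $M(B)$ satisfies $d \mid \bar e(B)$ and $d \oslash e(B) = d$.
   Context: Rings are commutative, associative and unital; "domain" means integral domain; normal means integrally closed in the field of fractions; an affine $\mathbf{k}$-domain is a domain that is a finitely generated $\mathbf{k}$-algebra. $\mathbb{N}$ contains $0$. Let $B=\bigoplus_{i\in\mathbb{Z}}B_i$ be a $\mathbb{Z}$-graded domain. For $d\ge1$, $B^{(d)}=\bigoplus_{i\in d\mathbb{Z}}B_i$. Define $e(B)=\gcd\{n\in\mathbb{Z}:B_n\neq0\}\in\mathbb{N}$. Let $Z$ be the set of height $1$ homogeneous prime ideals of $B$; define $\bar e(B)=\mathrm{lcm}\{e(B/\mathfrak{p}):\mathfrak{p}\in Z\}$ if $Z\neq\emptyset$, and $\bar e(B)=e(B)$ if $Z=\emptyset$. Here $\gcd(S)$ is the nonnegative generator of the ideal of $\mathbb{Z}$ generated by $S$, and for nonempty $S\subseteq\mathbb{Z}$, $\mathrm{lcm}(S)$ is the nonnegative generator of $\bigcap_{a\in S}a\mathbb{Z}$ (so $e(B)$ and $\bar e(B)$ may be $0$). For a prime $p$ and $m\in\mathbb{Z}\setminus\{0\}$, $v_p(m)$ is the largest $i\in\mathbb{N}$ with $p^i\mid m$; $v_p(0)=\infty$. For $m\in\mathbb{N}\setminus\{0\}$ and $n\in\mathbb{N}$,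 $m\oslash n=\prod_{p\in P(m,n)}p^{v_p(m)}$, where $P(m,n)$ is the set of primes $p$ with $v_p(m)>v_p(n)$. For $d\ge1$, $\mathcal{I}_d=\{d,2d,3d,\dots\}$. A derivation $D:R\to R$ is locally nilpotent if for each $b\in R$ there is $n>0$ with $D^n(b)=0$. A ring is rigid if its only locally nilpotent derivation is $0$. $\mathrm{NR}(B)=\{d\in\mathbb{N}\setminus\{0\}:B^{(d)}\text{ is non-rigid}\}$, and $M(B)$ is the set of maximal elements of the poset $(\mathrm{NR}(B),\preceq)$, where $d_1\preceq d_2\Leftrightarrow\mathcal{I}_{d_1}\subseteq\mathcal{I}_{d_2}\Leftrightarrow d_2\mid d_1$. *)

theory Defs
  imports "HOL-Library.Extended_Nat" "HOL-Computational_Algebra.Primes"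
    "HOL-Algebra.Polynomials" "HOL-Algebra.Generated_Rings" "HOL-Algebra.QuotRing"
begin

definition char_zero :: "('k, 'm) ring_scheme \<Rightarrow> bool"
  where "char_zero K \<longleftrightarrow> (\<forall>n::nat. n > 0 \<longrightarrow> [n] \<cdot>\<^bsub>K\<^esub> \<one>\<^bsub>K\<^esub> \<noteq> \<zero>\<^bsub>K\<^esub>)"

definition fin_gen_algebra :: "('k, 'm) ring_scheme \<Rightarrow> ('k, 'a, 'n) module_scheme \<Rightarrow> bool"
  where "fin_gen_algebra K B \<longleftrightarrow>
    (\<exists>S. finite S \<and> S \<subseteq> carrier B \<and>
         carrier B = generate_ring B ((\<lambda>c. c \<odot>\<^bsub>B\<^esub> \<one>\<^bsub>B\<^esub>) ` carrier K \<union> S))"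

definition affine_domain :: "('k, 'm) ring_scheme \<Rightarrow> ('k, 'a, 'n) module_scheme \<Rightarrow> bool"
  where "affine_domain K B \<longleftrightarrow> domain B \<and> algebra K B \<and> fin_gen_algebra K B"

definition frac_rel :: "('a, 'm) ring_scheme \<Rightarrow> (('a \<times> 'a) \<times> ('a \<times> 'a)) set"
  where "frac_rel R = {((a, b), (c, d)).
    a \<in> carrier R \<and> b \<in> carrier R - {\<zero>\<^bsub>R\<^esub>} \<and> c \<in> carrier R \<and> d \<in> carrier R - {\<zero>\<^bsub>R\<^esub>} \<and>
    a \<otimes>\<^bsub>R\<^esub> d = c \<otimes>\<^bsub>R\<^esub> b}"

definition fraction :: "('a, 'm) ring_scheme \<Rightarrow> 'a \<Rightarrow> 'a \<Rightarrow> ('a \<times> 'a) set"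
  where "fraction R a b = frac_rel R `` {(a, b)}"

text \<open>The field of fractions of a domain; see \<open>frac_field_field\<close> and \<open>frac_embed_hom\<close> below.\<close>

definition frac_field :: "('a, 'm) ring_scheme \<Rightarrow> (('a \<times> 'a) set) ring"
  where "frac_field R =
    \<lparr> carrier = (carrier R \<times> (carrier R - {\<zero>\<^bsub>R\<^esub>})) // frac_rel R,
      mult = (\<lambda>U V. \<Union>(a, b)\<in>U. \<Union>(c, d)\<in>V. fraction R (a \<otimes>\<^bsub>R\<^esub> c) (b \<otimes>\<^bsub>R\<^esub> d)),
      one = fraction R \<one>\<^bsub>R\<^esub> \<one>\<^bsub>R\<^esub>,
      zero = fraction R \<zero>\<^bsub>R\<^esub> \<one>\<^bsub>R\<^esub>,
      add = (\<lambda>U V. \<Union>(a, b)\<in>U. \<Union>(c, d)\<in>V.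
        fraction R (a \<otimes>\<^bsub>R\<^esub> d \<oplus>\<^bsub>R\<^esub> c \<otimes>\<^bsub>R\<^esub> b) (b \<otimes>\<^bsub>R\<^esub> d)) \<rparr>"

definition frac_embed :: "('a, 'm) ring_scheme \<Rightarrow> 'a \<Rightarrow> ('a \<times> 'a) set"
  where "frac_embed R a = fraction R a \<one>\<^bsub>R\<^esub>"

definition integral_over :: "('a, 'm) ring_scheme \<Rightarrow> 'a set \<Rightarrow> 'a \<Rightarrow> bool"
  where "integral_over F S x \<longleftrightarrow>
    (\<exists>p. polynomial\<^bsub>F\<^esub> S p \<and> p \<noteq> [] \<and> lead_coeff p = \<one>\<^bsub>F\<^esub> \<and> ring.eval F p x = \<zero>\<^bsub>F\<^esub>)"

definition normal_domain :: "('a, 'm) ring_scheme \<Rightarrow> bool"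
  where "normal_domain R \<longleftrightarrow> domain R \<and>
    (\<forall>x \<in> carrier (frac_field R).
       integral_over (frac_field R) (frac_embed R ` carrier R) x \<longrightarrow> x \<in> frac_embed R ` carrier R)"

definition decomposition ::
    "('a, 'm) ring_scheme \<Rightarrow> (int \<Rightarrow> 'a set) \<Rightarrow> 'a \<Rightarrow> (int \<Rightarrow> 'a) \<Rightarrow> bool"
  where "decomposition R A b f \<longleftrightarrow>
    (\<forall>n. f n \<in> A n) \<and> finite {n. f n \<noteq> \<zero>\<^bsub>R\<^esub>} \<and> b = finsum R f {n. f n \<noteq> \<zero>\<^bsub>R\<^esub>}"

text \<open>The inclusion of the unit and, for an algebra over a field \<open>k\<close> that is a domain, of \<open>k\<close> in
  \<open>A 0\<close> is not assumed: it follows from the remaining axioms.\<close>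

locale int_graded_ring = ring R for R (structure) +
  fixes A :: "int \<Rightarrow> 'a set"
  assumes component_subgroup: "\<And>i. additive_subgroup (A i) R"
    and component_mult: "\<And>i j x y. \<lbrakk> x \<in> A i; y \<in> A j \<rbrakk> \<Longrightarrow> x \<otimes> y \<in> A (i + j)"
    and direct_sum: "\<And>b. b \<in> carrier R \<Longrightarrow> \<exists>!f. decomposition R A b f"

definition veronese :: "('a, 'm) ring_scheme \<Rightarrow> (int \<Rightarrow> 'a set) \<Rightarrow> nat \<Rightarrow> ('a, 'm) ring_scheme"
  where "veronese R A d =
    R\<lparr> carrier := {b. \<exists>f. decomposition R A b f \<and> (\<forall>n. \<not> int d dvd n \<longrightarrow> f n = \<zero>\<^bsub>R\<^esub>)} \<rparr>"

definition homogeneous_ideal :: "('a, 'm) ring_scheme \<Rightarrow> (int \<Rightarrow> 'a set) \<Rightarrow> 'a set \<Rightarrow> bool"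
  where "homogeneous_ideal R A I \<longleftrightarrow> (\<exists>S \<subseteq> (\<Union>n. A n). I = Idl\<^bsub>R\<^esub> S)"

definition quotient_grading ::
    "('a, 'm) ring_scheme \<Rightarrow> (int \<Rightarrow> 'a set) \<Rightarrow> 'a set \<Rightarrow> int \<Rightarrow> 'a set set"
  where "quotient_grading R A I n = (\<lambda>x. I +>\<^bsub>R\<^esub> x) ` A n"

definition height :: "('a, 'm) ring_scheme \<Rightarrow> 'a set \<Rightarrow> enat"
  where "height R p = Sup {enat n | n. \<exists>P. (\<forall>i\<le>n. primeideal (P i) R) \<and>
    (\<forall>i<n. P i \<subset> P (Suc i)) \<and> P n = p}"

definition homogeneous_height_one_primes ::
    "('a, 'm) ring_scheme \<Rightarrow> (int \<Rightarrow> 'a set) \<Rightarrow> 'a set set"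
  where "homogeneous_height_one_primes R A =
    {p. primeideal p R \<and> homogeneous_ideal R A p \<and> height R p = 1}"

text \<open>The library's \<open>Gcd\<close> and \<open>Lcm\<close> of arbitrary sets are the nonnegative generators of the sum,
  respectively the intersection, of the ideals generated by the elements; both may be \<open>0\<close>.\<close>

definition grading_e :: "('a, 'm) ring_scheme \<Rightarrow> (int \<Rightarrow> 'a set) \<Rightarrow> nat"
  where "grading_e R A = nat (Gcd {n. A n \<noteq> {\<zero>\<^bsub>R\<^esub>}})"

definition grading_ebar :: "('a, 'm) ring_scheme \<Rightarrow> (int \<Rightarrow> 'a set) \<Rightarrow> nat"
  where "grading_ebar R A =
    (if homogeneous_height_one_primes R A \<noteq> {}
     then Lcm ((\<lambda>p. grading_e (R Quot p) (quotient_grading R A p)) `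
               homogeneous_height_one_primes R A)
     else grading_e R A)"

definition val :: "nat \<Rightarrow> nat \<Rightarrow> enat"
  where "val p m = (if m = 0 then \<infinity> else enat (multiplicity p m))"

text \<open>Only used for \<open>m > 0\<close>, where the index set of the product is finite.\<close>

definition oslash :: "nat \<Rightarrow> nat \<Rightarrow> nat" (infixl \<open>\<oslash>\<close> 70)
  where "m \<oslash> n =
    (\<Prod>p \<in> {p. Factorial_Ring.prime p \<and> val p m > val p n}. p ^ multiplicity p m)"

text \<open>Plain ring derivations, with no linearity over a base field required; only the values on
  the carrier matter.\<close>

definition derivation :: "('a, 'm) ring_scheme \<Rightarrow> ('a \<Rightarrow> 'a) \<Rightarrow> bool"
  where "derivation R D \<longleftrightarrow> D \<in> carrier R \<rightarrow> carrier R \<and>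
    (\<forall>x \<in> carrier R. \<forall>y \<in> carrier R.
       D (x \<oplus>\<^bsub>R\<^esub> y) = D x \<oplus>\<^bsub>R\<^esub> D y \<and>
       D (x \<otimes>\<^bsub>R\<^esub> y) = D x \<otimes>\<^bsub>R\<^esub> y \<oplus>\<^bsub>R\<^esub> x \<otimes>\<^bsub>R\<^esub> D y)"

definition locally_nilpotent :: "('a, 'm) ring_scheme \<Rightarrow> ('a \<Rightarrow> 'a) \<Rightarrow> bool"
  where "locally_nilpotent R D \<longleftrightarrow> (\<forall>b \<in> carrier R. \<exists>n>0. (D ^^ n) b = \<zero>\<^bsub>R\<^esub>)"

definition rigid :: "('a, 'm) ring_scheme \<Rightarrow> bool"
  where "rigid R \<longleftrightarrow>
    (\<forall>D. derivation R D \<and> locally_nilpotent R D \<longrightarrow> (\<forall>x \<in> carrier R. D x = \<zero>\<^bsub>R\<^esub>))"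

definition multiples :: "nat \<Rightarrow> nat set"
  where "multiples d = {k * d | k. k > 0}"

definition NR :: "('a, 'm) ring_scheme \<Rightarrow> (int \<Rightarrow> 'a set) \<Rightarrow> nat set"
  where "NR B A = {d. d > 0 \<and> \<not> rigid (veronese B A d)}"

text \<open>The maximal elements of \<open>NR B A\<close> for the order
  \<open>d\<^sub>1 \<preceq> d\<^sub>2 \<longleftrightarrow> multiples d\<^sub>1 \<subseteq> multiples d\<^sub>2\<close>, i.e. the minimal ones for divisibility.\<close>

definition maximal_NR :: "('a, 'm) ring_scheme \<Rightarrow> (int \<Rightarrow> 'a set) \<Rightarrow> nat set"
  where "maximal_NR B A =
    {d \<in> NR B A. \<forall>d' \<in> NR B A. multiples d \<subseteq> multiples d' \<longrightarrow> d' = d}"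

context domain
begin

lemma frac_rel_equiv: "equiv (carrier R \<times> (carrier R - {\<zero>})) (frac_rel R)"
proof (rule equivI)
  show "frac_rel R \<subseteq> (carrier R \<times> (carrier R - {\<zero>})) \<times> (carrier R \<times> (carrier R - {\<zero>}))"
    by (auto simp: frac_rel_def)
  show "refl_on (carrier R \<times> (carrier R - {\<zero>})) (frac_rel R)"
    by (auto simp: refl_on_def frac_rel_def)
  show "sym (frac_rel R)"
    by (auto simp: sym_def frac_rel_def)
  show "trans (frac_rel R)"
  proof (rule transI)
    fix x y z assume xy: "(x, y) \<in> frac_rel R" and yz: "(y, z) \<in> frac_rel R"
    obtain a b c d e f where [simp]: "x = (a, b)" "y = (c, d)" "z = (e, f)"
      by (metis surj_pair)
    have c: "a \<in> carrier R" "b \<in> carrier R" "c \<in> carrier R" "d \<in> carrier R" "e \<in> carrier R"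
        "f \<in> carrier R" and nz: "b \<noteq> \<zero>" "d \<noteq> \<zero>" "f \<noteq> \<zero>"
      and 1: "a \<otimes> d = c \<otimes> b" and 2: "c \<otimes> f = e \<otimes> d"
      using xy yz by (auto simp: frac_rel_def)
    have "d \<otimes> (a \<otimes> f) = (a \<otimes> d) \<otimes> f" using c by (simp add: m_ac)
    also have "\<dots> = (c \<otimes> f) \<otimes> b" using c by (simp add: 1 m_ac)
    also have "\<dots> = d \<otimes> (e \<otimes> b)" using c by (simp add: 2 m_ac)
    finally have "a \<otimes> f = e \<otimes> b" using c nz m_lcancel by simp
    then show "(x, z) \<in> frac_rel R" using c nz by (simp add: frac_rel_def)
  qed
qed

lemma frac_eq_iff:
  assumes "a \<in> carrier R" "b \<in> carrier R - {\<zero>}" "c \<in> carrier R" "d \<in> carrier R - {\<zero>}"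
  shows "fraction R a b = fraction R c d \<longleftrightarrow> a \<otimes> d = c \<otimes> b"
proof -
  have "fraction R a b = fraction R c d \<longleftrightarrow> ((a, b), (c, d)) \<in> frac_rel R"
    unfolding fraction_def by (rule eq_equiv_class_iff[OF frac_rel_equiv]) (use assms in auto)
  then show ?thesis using assms by (auto simp: frac_rel_def)
qed

lemma frac_mem_iff:
  assumes "a \<in> carrier R" "b \<in> carrier R - {\<zero>}"
  shows "(c, d) \<in> fraction R a b \<longleftrightarrow>
    c \<in> carrier R \<and> d \<in> carrier R - {\<zero>} \<and> fraction R c d = fraction R a b"
  using assms frac_eq_iff[of a b c d] by (auto simp: fraction_def frac_rel_def)

lemma frac_mult:
  assumes "a \<in> carrier R" "b \<in> carrier R - {\<zero>}" "c \<in> carrier R" "d \<in> carrier R - {\<zero>}"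
  shows "fraction R a b \<otimes>\<^bsub>frac_field R\<^esub> fraction R c d = fraction R (a \<otimes> c) (b \<otimes> d)"
proof -
  have *: "fraction R (a' \<otimes> c') (b' \<otimes> d') = fraction R (a \<otimes> c) (b \<otimes> d)"
    if "(a', b') \<in> fraction R a b" "(c', d') \<in> fraction R c d" for a' b' c' d'
  proof -
    have C: "a' \<in> carrier R" "b' \<in> carrier R" "b' \<noteq> \<zero>" "c' \<in> carrier R" "d' \<in> carrier R" "d' \<noteq> \<zero>"
      "a \<in> carrier R" "b \<in> carrier R" "b \<noteq> \<zero>" "c \<in> carrier R" "d \<in> carrier R" "d \<noteq> \<zero>"
      and 1: "a \<otimes> b' = a' \<otimes> b" and 2: "c \<otimes> d' = c' \<otimes> d"
      using that assms by (auto simp: fraction_def frac_rel_def)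
    have "(a' \<otimes> c') \<otimes> (b \<otimes> d) = (a' \<otimes> b) \<otimes> (c' \<otimes> d)" using C by (simp add: m_ac)
    also have "\<dots> = (a \<otimes> c) \<otimes> (b' \<otimes> d')" unfolding 1[symmetric] 2[symmetric] using C by (simp add: m_ac)
    finally show ?thesis using C by (subst frac_eq_iff) (auto simp: integral_iff)
  qed
  have ne: "(a, b) \<in> fraction R a b" "(c, d) \<in> fraction R c d"
    using assms by (auto simp: frac_mem_iff)
  have "(\<Union>x\<in>fraction R a b. \<Union>y\<in>fraction R c d. fraction R (fst x \<otimes> fst y) (snd x \<otimes> snd y)) =
      (\<Union>x\<in>fraction R a b. \<Union>y\<in>fraction R c d. fraction R (a \<otimes> c) (b \<otimes> d))"
    by (intro SUP_cong refl) (metis * prod.collapse)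
  also have "\<dots> = fraction R (a \<otimes> c) (b \<otimes> d)"
    using ne by auto
  finally show ?thesis
    by (simp add: frac_field_def case_prod_unfold)
qed

lemma frac_add:
  assumes "a \<in> carrier R" "b \<in> carrier R - {\<zero>}" "c \<in> carrier R" "d \<in> carrier R - {\<zero>}"
  shows "fraction R a b \<oplus>\<^bsub>frac_field R\<^esub> fraction R c d = fraction R (a \<otimes> d \<oplus> c \<otimes> b) (b \<otimes> d)"
proof -
  have *: "fraction R (a' \<otimes> d' \<oplus> c' \<otimes> b') (b' \<otimes> d') = fraction R (a \<otimes> d \<oplus> c \<otimes> b) (b \<otimes> d)"
    if "(a', b') \<in> fraction R a b" "(c', d') \<in> fraction R c d" for a' b' c' d'
  proof -
    have C: "a' \<in> carrier R" "b' \<in> carrier R" "b' \<noteq> \<zero>" "c' \<in> carrier R" "d' \<in> carrier R" "d' \<noteq> \<zero>"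
      "a \<in> carrier R" "b \<in> carrier R" "b \<noteq> \<zero>" "c \<in> carrier R" "d \<in> carrier R" "d \<noteq> \<zero>"
      and 1: "a \<otimes> b' = a' \<otimes> b" and 2: "c \<otimes> d' = c' \<otimes> d"
      using that assms by (auto simp: fraction_def frac_rel_def)
    have "(a' \<otimes> d' \<oplus> c' \<otimes> b') \<otimes> (b \<otimes> d) =
        (a' \<otimes> b) \<otimes> (d' \<otimes> d) \<oplus> (c' \<otimes> d) \<otimes> (b' \<otimes> b)"
      using C by (simp add: m_ac l_distr r_distr)
    also have "\<dots> = (a \<otimes> d \<oplus> c \<otimes> b) \<otimes> (b' \<otimes> d')"
      unfolding 1[symmetric] 2[symmetric] using C by (simp add: m_ac l_distr r_distr)
    finally show ?thesis using C by (subst frac_eq_iff) (auto simp: integral_iff)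
  qed
  have ne: "(a, b) \<in> fraction R a b" "(c, d) \<in> fraction R c d"
    using assms by (auto simp: frac_mem_iff)
  have "(\<Union>x\<in>fraction R a b. \<Union>y\<in>fraction R c d. fraction R (fst x \<otimes> snd y \<oplus> fst y \<otimes> snd x) (snd x \<otimes> snd y)) =
      (\<Union>x\<in>fraction R a b. \<Union>y\<in>fraction R c d. fraction R (a \<otimes> d \<oplus> c \<otimes> b) (b \<otimes> d))"
    by (intro SUP_cong refl) (metis * prod.collapse)
  also have "\<dots> = fraction R (a \<otimes> d \<oplus> c \<otimes> b) (b \<otimes> d)"
    using ne by auto
  finally show ?thesis
    by (simp add: frac_field_def case_prod_unfold)
qed

lemma frac_one: "\<one>\<^bsub>frac_field R\<^esub> = fraction R \<one> \<one>" and frac_zero: "\<zero>\<^bsub>frac_field R\<^esub> = fraction R \<zero> \<one>"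
  by (simp_all add: frac_field_def)

lemma frac_carrier:
  "carrier (frac_field R) = {fraction R a b | a b. a \<in> carrier R \<and> b \<in> carrier R - {\<zero>}}"
  by (auto simp: frac_field_def quotient_def fraction_def)

lemma frac_carrierE:
  assumes "x \<in> carrier (frac_field R)"
  obtains a b where "x = fraction R a b" "a \<in> carrier R" "b \<in> carrier R" "b \<noteq> \<zero>"
  using assms by (auto simp: frac_carrier)

lemma frac_in_carrier:
  assumes "a \<in> carrier R" "b \<in> carrier R" "b \<noteq> \<zero>"
  shows "fraction R a b \<in> carrier (frac_field R)"
  using assms by (auto simp: frac_carrier)

lemmas frac_simps = frac_mult frac_add frac_one frac_zero frac_eq_iff frac_in_carrier integral_iff

lemma frac_field_field: "field (frac_field R)"
proof (rule cring.cring_fieldI2)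
  show "cring (frac_field R)"
  proof (rule cringI)
    show "abelian_group (frac_field R)"
    proof (rule abelian_groupI)
      fix x y z
      assume "x \<in> carrier (frac_field R)" "y \<in> carrier (frac_field R)" "z \<in> carrier (frac_field R)"
      then show "x \<oplus>\<^bsub>frac_field R\<^esub> y \<oplus>\<^bsub>frac_field R\<^esub> z = x \<oplus>\<^bsub>frac_field R\<^esub> (y \<oplus>\<^bsub>frac_field R\<^esub> z)"
        by (elim frac_carrierE) (simp add: frac_simps l_distr r_distr m_ac a_ac)
    next
      fix x assume "x \<in> carrier (frac_field R)"
      then obtain a b where x: "x = fraction R a b" "a \<in> carrier R" "b \<in> carrier R" "b \<noteq> \<zero>"
        by (rule frac_carrierE)
      show "\<exists>y\<in>carrier (frac_field R). y \<oplus>\<^bsub>frac_field R\<^esub> x = \<zero>\<^bsub>frac_field R\<^esub>"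
        by (rule bexI[of _ "fraction R (\<ominus> a) b"])
          (use x in \<open>simp_all add: frac_simps l_distr[symmetric] l_neg\<close>)
    qed (((elim frac_carrierE)?, simp add: frac_simps l_distr r_distr m_ac a_ac)+)
    show "comm_monoid (frac_field R)"
      by (rule comm_monoidI; (elim frac_carrierE)?) (simp_all add: frac_simps m_ac)
  qed (elim frac_carrierE; simp add: frac_simps l_distr r_distr m_ac a_ac)
  show "\<zero>\<^bsub>frac_field R\<^esub> \<noteq> \<one>\<^bsub>frac_field R\<^esub>"
    by (simp add: frac_simps)
  fix x assume "x \<in> carrier (frac_field R)" and nz: "x \<noteq> \<zero>\<^bsub>frac_field R\<^esub>"
  then obtain a b where x: "x = fraction R a b" "a \<in> carrier R" "b \<in> carrier R" "b \<noteq> \<zero>"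
    by (meson frac_carrierE)
  with nz have "a \<noteq> \<zero>" by (simp add: frac_simps)
  then show "\<exists>y\<in>carrier (frac_field R). x \<otimes>\<^bsub>frac_field R\<^esub> y = \<one>\<^bsub>frac_field R\<^esub>"
    by (intro bexI[of _ "fraction R b a"]) (use x in \<open>simp_all add: frac_simps m_ac\<close>)
qed

lemma frac_embed_hom: "frac_embed R \<in> ring_hom R (frac_field R)"
  by (rule ring_hom_memI) (simp_all add: frac_embed_def frac_simps)

lemma frac_embed_inj: "inj_on (frac_embed R) (carrier R)"
  by (auto simp: inj_on_def frac_embed_def frac_simps)

end

end

theory Submission
  imports Defs
begin

text \<open>By finite generation, a Veronese subring is non-rigid iff it has a nonzero homogeneous locally
  nilpotent derivation \<open>D\<close>, of degree \<open>\<delta>\<close> say. For (a) it suffices to pass from \<open>d\<close> to \<open>d p\<close> with \<open>p\<close> prime: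
  either some homogeneous \<open>a\<close> in the kernel of \<open>D\<close> makes \<open>a D\<close> restrict to the smaller ring, or \<open>D\<close> divided
  by the power \<open>p - 1\<close> of a homogeneous slice does, up to a factor from the kernel. For (b) let \<open>d = m p\<close> be
  maximal. If \<open>v\<^sub>p d \<le> v\<^sub>p e\<close>, the Veronese subrings of index \<open>d\<close> and \<open>m\<close> coincide. If \<open>v\<^sub>p d\<close> exceeds the
  \<open>p\<close>-valuation of the degree lcm of the homogeneous primes of height one, then \<open>D\<close> extends to the Veronese
  subring of index \<open>m\<close>: in a normal Noetherian domain only primes of height one can obstruct this, and
  each of them avoids an element of suitable degree. Both contradict the maximality of \<open>d\<close>.\<close>

section \<open>Graded domains\<close>

text \<open>The measure of local nilpotency is the degree of \<open>x\<close> with respect to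
  \<open>D\<close>, the last \<open>n\<close> with \<open>(D ^^ n) x\<close> nonzero. In
  characteristic 0 it is additive on products; hence units lie in the kernel, exact division cannot
  raise it, and derivations obtained by division stay nilpotent. In (a) the obstacle is that
  \<open>D\<close> need not preserve \<open>V (d * p)\<close>. If no homogeneous kernel element
  corrects its degree, then all homogeneous elements of the kernel have degrees divisible by
  \<open>d * p\<close> while \<open>D\<close> has not, so over the kernel only powers of
  \<open>s [^] p\<close> occur; the rule d/d(s^p) = (1 / (p s^(p-1))) d/ds explains the exponent
  \<open>p - 1\<close>. In (b) the Leibniz rule fixes the extension in the field of fractions, and
  the obstacle is to show that its values lie in the ring. Instead of writing a normal ring as an
  intersection of localizations, one takes a maximal conductor of a single offending fraction and
  shows that it is a homogeneous prime of height one. The Noetherian property is phrased with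
  sequences, because the powers of a fraction then yield an integral equation at once.\<close>

locale graded_domain = domain R + int_graded_ring R A for R (structure) and A
begin

lemma A_carrier: "x \<in> A i \<Longrightarrow> x \<in> carrier R"
  using additive_subgroup.a_subset[OF component_subgroup] by blast

lemma A_zero [simp]: "\<zero> \<in> A i"
  using additive_subgroup.zero_closed[OF component_subgroup] .

lemma A_add: "x \<in> A i \<Longrightarrow> y \<in> A i \<Longrightarrow> x \<oplus> y \<in> A i"
  using additive_subgroup.a_closed[OF component_subgroup] .

lemma A_neg: "x \<in> A i \<Longrightarrow> \<ominus> x \<in> A i"
  using additive_subgroup.a_inv_closed[OF component_subgroup] .

lemma A_minus: "x \<in> A i \<Longrightarrow> y \<in> A i \<Longrightarrow> x \<ominus> y \<in> A i"
  by (simp add: A_add A_neg a_minus_def)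

section \<open>Homogeneous components of sums and products\<close>

definition hcomp :: "'a \<Rightarrow> int \<Rightarrow> 'a"
  where "hcomp b = (THE f. decomposition R A b f)"

lemma hcomp_decomposition: "b \<in> carrier R \<Longrightarrow> decomposition R A b (hcomp b)"
  unfolding hcomp_def by (rule theI'[OF direct_sum])

lemma decomposition_carrier: "decomposition R A b f \<Longrightarrow> b \<in> carrier R"
  unfolding decomposition_def using A_carrier by (auto intro!: finsum_closed)

lemma hcomp_unique: "decomposition R A b f \<Longrightarrow> hcomp b = f"
  using hcomp_decomposition[OF decomposition_carrier] direct_sum[OF decomposition_carrier] by blast

lemma hcomp_A [simp]: "b \<in> carrier R \<Longrightarrow> hcomp b n \<in> A n"
  using hcomp_decomposition by (auto simp: decomposition_def)

lemma hcomp_closed [simp]: "b \<in> carrier R \<Longrightarrow> hcomp b n \<in> carrier R"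
  using hcomp_A A_carrier by blast

lemma hcomp_finite: "b \<in> carrier R \<Longrightarrow> finite {n. hcomp b n \<noteq> \<zero>}"
  using hcomp_decomposition by (auto simp: decomposition_def)

lemma finsum_neutral:
  assumes "finite T" "T' \<subseteq> T" "\<And>n. n \<in> T - T' \<Longrightarrow> f n = \<zero>" "\<And>n. n \<in> T \<Longrightarrow> f n \<in> carrier R"
  shows "finsum R f T' = finsum R f T"
  by (rule add.finprod_mono_neutral_cong_left) (use assms in auto)

lemma hcomp_eqI:
  assumes "\<And>n. f n \<in> A n" "finite T" "\<And>n. n \<notin> T \<Longrightarrow> f n = \<zero>" "b = finsum R f T"
  shows "hcomp b = f"
proof (rule hcomp_unique, unfold decomposition_def, intro conjI allI)
  have s: "{n. f n \<noteq> \<zero>} \<subseteq> T" using assms by auto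
  show "finite {n. f n \<noteq> \<zero>}" using s assms finite_subset by blast
  show "b = finsum R f {n. f n \<noteq> \<zero>}"
    unfolding assms(4) by (rule finsum_neutral[symmetric]) (use s assms A_carrier[OF assms(1)] in auto)
qed (use assms in auto)

lemma hcomp_sum:
  assumes "b \<in> carrier R" "finite T" "\<And>n. n \<notin> T \<Longrightarrow> hcomp b n = \<zero>"
  shows "b = finsum R (hcomp b) T"
proof -
  have "b = finsum R (hcomp b) {n. hcomp b n \<noteq> \<zero>}"
    using hcomp_decomposition[OF assms(1)] by (auto simp: decomposition_def)
  also have "\<dots> = finsum R (hcomp b) T"
    by (rule finsum_neutral) (use assms in auto)
  finally show ?thesis .
qed

lemma hcomp_hom: "a \<in> A i \<Longrightarrow> hcomp a n = (if n = i then a else \<zero>)"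
proof -
  assume a: "a \<in> A i"
  have "hcomp a = (\<lambda>n. if n = i then a else \<zero>)"
    by (rule hcomp_eqI[where T="{i}"]) (use a A_carrier[OF a] in auto)
  then show ?thesis by simp
qed

lemma hcomp_zero [simp]: "hcomp \<zero> n = \<zero>"
  using hcomp_hom[OF A_zero, of n n] by simp

lemma hcomp_add:
  assumes "a \<in> carrier R" "b \<in> carrier R"
  shows "hcomp (a \<oplus> b) n = hcomp a n \<oplus> hcomp b n"
proof -
  let ?T = "{n. hcomp a n \<noteq> \<zero>} \<union> {n. hcomp b n \<noteq> \<zero>}"
  have f: "finite ?T" using assms hcomp_finite by auto
  have "hcomp (a \<oplus> b) = (\<lambda>n. hcomp a n \<oplus> hcomp b n)"
  proof (rule hcomp_eqI[OF _ f])
    have "a = finsum R (hcomp a) ?T" "b = finsum R (hcomp b) ?T"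
      by (rule hcomp_sum; use assms f in auto)+
    then have "a \<oplus> b = finsum R (hcomp a) ?T \<oplus> finsum R (hcomp b) ?T" by simp
    also have "\<dots> = finsum R (\<lambda>n. hcomp a n \<oplus> hcomp b n) ?T"
      by (rule finsum_addf[symmetric]) (use assms in auto)
    finally show "a \<oplus> b = \<dots>" .
  qed (use assms in \<open>auto intro!: A_add\<close>)
  then show ?thesis by simp
qed

lemma hcomp_mult:
  assumes "a \<in> A i" "b \<in> carrier R"
  shows "hcomp (a \<otimes> b) n = a \<otimes> hcomp b (n - i)"
proof -
  note ac = A_carrier[OF assms(1)]
  let ?S = "{n. hcomp b n \<noteq> \<zero>}"
  let ?T = "(\<lambda>n. n + i) ` ?S"
  have f: "finite ?S" using assms hcomp_finite by auto
  have "hcomp (a \<otimes> b) = (\<lambda>n. a \<otimes> hcomp b (n - i))"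
  proof (rule hcomp_eqI[where T = ?T])
    show "finite ?T" using f by simp
    fix n
    show "a \<otimes> hcomp b (n - i) \<in> A n"
      using component_mult[OF assms(1) hcomp_A[OF assms(2)], of "n - i"] by simp
    assume "n \<notin> ?T"
    then have "n - i \<notin> ?S" by (force simp: image_iff)
    then show "a \<otimes> hcomp b (n - i) = \<zero>" using ac by simp
  next
    have "b = finsum R (hcomp b) ?S"
      by (rule hcomp_sum) (use assms f in auto)
    then have "a \<otimes> b = a \<otimes> finsum R (hcomp b) ?S" by simp
    also have "\<dots> = finsum R (\<lambda>n. a \<otimes> hcomp b n) ?S"
      by (rule finsum_rdistr) (use ac assms f in auto)
    also have "\<dots> = finsum R (\<lambda>n. a \<otimes> hcomp b (n - i)) ?T"
      by (subst finsum_reindex) (use ac assms f in \<open>auto simp: inj_on_def intro!: finsum_cong'\<close>)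
    finally show "a \<otimes> b = \<dots>" .
  qed
  then show ?thesis by simp
qed

text \<open>The \<open>hom\<close> case ranges only over the nonzero components of \<open>b\<close>
  itself, so that facts about \<open>b\<close>, such as the degrees in which it is supported, remain
  usable there.\<close>

lemma hom_induct [consumes 1, case_names zero hom add]:
  assumes "b \<in> carrier R" "P \<zero>" "\<And>n. hcomp b n \<noteq> \<zero> \<Longrightarrow> P (hcomp b n)"
    and "\<And>a b. a \<in> carrier R \<Longrightarrow> b \<in> carrier R \<Longrightarrow> P a \<Longrightarrow> P b \<Longrightarrow> P (a \<oplus> b)"
  shows "P b"
proof -
  have "P (finsum R (hcomp b) T)" if "finite T" "T \<subseteq> {n. hcomp b n \<noteq> \<zero>}" for T
    using that
  proof (induction T)
    case (insert x T)
    then show ?case using assms(1,3,4) by (simp add: Pi_def)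
  qed (simp add: assms(2))
  from this[OF hcomp_finite[OF assms(1)] order_refl]
  have "P (finsum R (hcomp b) {n. hcomp b n \<noteq> \<zero>})" .
  then show ?thesis using hcomp_sum[OF assms(1) hcomp_finite[OF assms(1)]] by simp
qed

lemma nonzero_comp:
  assumes "b \<in> carrier R" "b \<noteq> \<zero>"
  obtains n where "hcomp b n \<noteq> \<zero>"
  using hcomp_sum[OF assms(1), of "{}"] assms by auto

text \<open>A nonzero component \<open>hcomp \<one> i\<close> has the same product with
  \<open>\<one>\<close> and with \<open>hcomp \<one> 0\<close>, as comparing components of degree
  \<open>i\<close> shows; cancelling it identifies the two.\<close>

lemma one_A: "\<one> \<in> A 0"
proof -
  obtain i where i: "hcomp \<one> i \<noteq> \<zero>" using nonzero_comp[of \<one>] by auto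
  have "hcomp (hcomp \<one> i \<otimes> \<one>) i = hcomp \<one> i \<otimes> hcomp \<one> (i - i)"
    by (rule hcomp_mult) auto
  then have "hcomp \<one> i \<otimes> \<one> = hcomp \<one> i \<otimes> hcomp \<one> 0"
    by (simp add: hcomp_hom[OF hcomp_A])
  then have "hcomp \<one> 0 = \<one>" using m_lcancel[OF i, of \<one> "hcomp \<one> 0"] by simp
  then show ?thesis by (metis hcomp_A one_closed)
qed

lemma A_pow: "x \<in> A i \<Longrightarrow> x [^] (n::nat) \<in> A (int n * i)"
proof (induction n)
  case (Suc n)
  then have "x [^] n \<otimes> x \<in> A (int n * i + i)" by (intro component_mult) auto
  then show ?case by (simp add: algebra_simps)
qed (auto simp: one_A)

lemma hcomp_finsum:
  assumes "finite T" "\<And>i. i \<in> T \<Longrightarrow> f i \<in> carrier R"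
  shows "hcomp (finsum R f T) n = finsum R (\<lambda>i. hcomp (f i) n) T"
  using assms
proof (induction T)
  case (insert x F)
  then have "f \<in> F \<rightarrow> carrier R" by auto
  then show ?case using insert by (simp add: hcomp_add Pi_def)
qed simp

lemma hcomp_mult_finsum:
  assumes a: "a \<in> carrier R" and b: "b \<in> carrier R"
    and f: "finite T" and T: "{n. hcomp a n \<noteq> \<zero>} \<subseteq> T"
  shows "hcomp (a \<otimes> b) k = finsum R (\<lambda>n. hcomp a n \<otimes> hcomp b (k - n)) T"
proof -
  have "a = finsum R (hcomp a) T"
    by (rule hcomp_sum) (use a f T in auto)
  then have "a \<otimes> b = finsum R (hcomp a) T \<otimes> b" by simp
  also have "\<dots> = finsum R (\<lambda>n. hcomp a n \<otimes> b) T"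
    by (rule finsum_ldistr) (use f a b in auto)
  finally have "hcomp (a \<otimes> b) k = finsum R (\<lambda>n. hcomp (hcomp a n \<otimes> b) k) T"
    using hcomp_finsum[OF f] a b by simp
  also have "\<dots> = finsum R (\<lambda>n. hcomp a n \<otimes> hcomp b (k - n)) T"
    by (intro finsum_cong') (use a b in \<open>auto simp: hcomp_mult\<close>)
  finally show ?thesis .
qed

text \<open>The hypothesis leaves no other pair of supported degrees with this sum, so a single term
  of the convolution survives. The cases of interest are the two highest and the two lowest
  degrees.\<close>

lemma hcomp_mult_extremal:
  assumes a: "a \<in> carrier R" and b: "b \<in> carrier R"
    and u: "\<And>i' j'. hcomp a i' \<noteq> \<zero> \<Longrightarrow> hcomp b j' \<noteq> \<zero> \<Longrightarrow> i' + j' = i + j \<Longrightarrow> i' = i"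
  shows "hcomp (a \<otimes> b) (i + j) = hcomp a i \<otimes> hcomp b j"
proof -
  let ?S = "insert i {n. hcomp a n \<noteq> \<zero>}"
  have f: "finite ?S" using hcomp_finite[OF a] by simp
  have "hcomp (a \<otimes> b) (i + j) = finsum R (\<lambda>n. hcomp a n \<otimes> hcomp b (i + j - n)) ?S"
    by (rule hcomp_mult_finsum[OF a b f]) blast
  also have "\<dots> = finsum R (\<lambda>n. hcomp a n \<otimes> hcomp b (i + j - n)) {i}"
  proof (rule finsum_neutral[symmetric])
    fix n assume "n \<in> ?S - {i}"
    then have "n \<noteq> i" "hcomp a n \<noteq> \<zero>" by auto
    then have "hcomp b (i + j - n) = \<zero>" using u[of n "i + j - n"] by auto
    then show "hcomp a n \<otimes> hcomp b (i + j - n) = \<zero>" using a by simp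
  qed (use f a b in auto)
  also have "\<dots> = hcomp a i \<otimes> hcomp b j" using a b by simp
  finally show ?thesis .
qed

text \<open>The highest components of \<open>u\<close> and \<open>v\<close> multiply to a nonzero
  component of \<open>\<one>\<close>, and so do the lowest ones. Hence the maxima of the two
  supports add up to 0, as do the minima, which forces each support to be a single degree.\<close>

lemma unit_homogeneous:
  assumes "u \<in> carrier R" "v \<in> carrier R" "u \<otimes> v = \<one>"
  shows "\<exists>i. u \<in> A i"
proof -
  let ?U = "{n. hcomp u n \<noteq> \<zero>}" and ?V = "{n. hcomp v n \<noteq> \<zero>}"
  have "u \<noteq> \<zero>" "v \<noteq> \<zero>" using assms by auto
  then have ne: "?U \<noteq> {}" "?V \<noteq> {}" using nonzero_comp assms by (metis empty_iff mem_Collect_eq)+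
  have f: "finite ?U" "finite ?V" using hcomp_finite assms by auto
  have one: "hcomp \<one> n = \<zero>" if "n \<noteq> 0" for n using hcomp_hom[OF one_A] that by auto
  have ext: "i + j = 0"
    if "i \<in> ?U" "j \<in> ?V" "\<And>i' j'. i' \<in> ?U \<Longrightarrow> j' \<in> ?V \<Longrightarrow> i' + j' = i + j \<Longrightarrow> i' = i" for i j
  proof -
    have "hcomp (u \<otimes> v) (i + j) = hcomp u i \<otimes> hcomp v j"
      by (rule hcomp_mult_extremal) (use assms that(3) in auto)
    then have "hcomp \<one> (i + j) \<noteq> \<zero>" using that(1,2) assms by (simp add: integral_iff)
    then show ?thesis using one by blast
  qed
  have mx: "Max ?U + Max ?V = 0"
  proof (rule ext[OF Max_in[OF f(1) ne(1)] Max_in[OF f(2) ne(2)]])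
    fix i' j' assume "i' \<in> ?U" "j' \<in> ?V" "i' + j' = Max ?U + Max ?V"
    moreover have "i' \<le> Max ?U" "j' \<le> Max ?V" using f calculation by auto
    ultimately show "i' = Max ?U" by linarith
  qed
  have mn: "Min ?U + Min ?V = 0"
  proof (rule ext[OF Min_in[OF f(1) ne(1)] Min_in[OF f(2) ne(2)]])
    fix i' j' assume "i' \<in> ?U" "j' \<in> ?V" "i' + j' = Min ?U + Min ?V"
    moreover have "i' \<ge> Min ?U" "j' \<ge> Min ?V" using f calculation by auto
    ultimately show "i' = Min ?U" by linarith
  qed
  have "Min ?U \<le> Max ?U" "Min ?V \<le> Max ?V" using f ne Max_in Min_le by meson+
  then have eq: "Min ?U = Max ?U" using mx mn by linarith
  have z: "hcomp u n = \<zero>" if "n \<notin> {Max ?U}" for n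
  proof (rule ccontr)
    assume "hcomp u n \<noteq> \<zero>"
    then have "Min ?U \<le> n" "n \<le> Max ?U" using f by auto
    then show False using eq that by auto
  qed
  have "u = finsum R (hcomp u) {Max ?U}" by (rule hcomp_sum) (use assms z in auto)
  then have "u = hcomp u (Max ?U)" using assms by simp
  then show ?thesis using hcomp_A[OF assms(1)] by metis
qed

text \<open>Nonzero elements of \<open>F\<close> are units, hence homogeneous. If a nonzero
  \<open>c\<close> had degree other than 0, then \<open>c \<oplus> \<one>\<close>, again in
  \<open>F\<close>, would have nonzero components in two degrees.\<close>

lemma subfield_degree_zero:
  assumes "subfield F R" shows "F \<subseteq> A 0"
proof
  fix c assume c: "c \<in> F"
  have sub: "subring F R" using subfieldE(1)[OF assms] .
  have Fc: "F \<subseteq> carrier R" using subringE(1)[OF sub] .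
  have hom: "\<exists>i. x \<in> A i" if x: "x \<in> F" for x
  proof (cases "x = \<zero>")
    case False
    then have "x \<in> Units (R\<lparr>carrier := F\<rparr>)" using x subfield.subfield_Units[OF assms] by auto
    then obtain y where "y \<in> F" "x \<otimes> y = \<one>" by (auto simp: Units_def)
    then show ?thesis using unit_homogeneous x Fc by blast
  qed auto
  obtain i where i: "c \<in> A i" using hom[OF c] by blast
  have cc: "c \<in> carrier R" using c Fc by auto
  have "c \<oplus> \<one> \<in> F" using subringE(3,7)[OF sub] c by auto
  then obtain j where j: "c \<oplus> \<one> \<in> A j" using hom by blast
  show "c \<in> A 0"
  proof (cases "i = 0 \<or> c = \<zero>")
    case False
    have "hcomp (c \<oplus> \<one>) i = c" "hcomp (c \<oplus> \<one>) 0 = \<one>"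
      using False i cc hcomp_hom[OF one_A] hcomp_hom[OF i] by (simp_all add: hcomp_add)
    then have "i = j" "0 = j" using hcomp_hom[OF j] False one_not_zero by metis+
    then show ?thesis using False by simp
  qed (use i in auto)
qed

text \<open>Veronese subrings are treated as subsets of \<open>carrier R\<close>: they can then be
  compared by inclusion, and quotients formed in the ambient ring need no embedding maps.\<close>

definition V :: "nat \<Rightarrow> 'a set"
  where "V d = {b \<in> carrier R. \<forall>n. \<not> int d dvd n \<longrightarrow> hcomp b n = \<zero>}"

lemma veronese_V: "veronese R A d = R\<lparr>carrier := V d\<rparr>"
proof -
  have "{b. \<exists>f. decomposition R A b f \<and> (\<forall>n. \<not> int d dvd n \<longrightarrow> f n = \<zero>)} = V d"
    using hcomp_decomposition hcomp_unique decomposition_carrier unfolding V_def by blast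
  then show ?thesis by (simp add: veronese_def)
qed

lemma V_carrier: "x \<in> V d \<Longrightarrow> x \<in> carrier R" by (simp add: V_def)

lemma A_V: "x \<in> A i \<Longrightarrow> int d dvd i \<Longrightarrow> x \<in> V d"
  by (auto simp: V_def hcomp_hom A_carrier)

lemma hcomp_V: "x \<in> V d \<Longrightarrow> hcomp x n \<in> V d"
  by (auto simp: V_def hcomp_hom[OF hcomp_A])

lemma V_add: "x \<in> V d \<Longrightarrow> y \<in> V d \<Longrightarrow> x \<oplus> y \<in> V d"
  by (auto simp: V_def hcomp_add)

lemma V_zero [simp]: "\<zero> \<in> V d" by (simp add: V_def)

lemma V_induct [consumes 1, case_names hom add]:
  assumes "b \<in> V d" "\<And>n x. x \<in> A n \<Longrightarrow> int d dvd n \<Longrightarrow> P x"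
    and "\<And>a b. a \<in> V d \<Longrightarrow> b \<in> V d \<Longrightarrow> P a \<Longrightarrow> P b \<Longrightarrow> P (a \<oplus> b)"
  shows "P b"
proof -
  have "b \<in> V d \<and> P b" using V_carrier[OF assms(1)]
  proof (induction rule: hom_induct)
    case zero then show ?case using assms(2)[of \<zero> 0] by simp
  next
    case (hom n)
    then have "int d dvd n" using assms(1) by (auto simp: V_def)
    then show ?case using assms(2)[OF hcomp_A[OF V_carrier[OF assms(1)]]] hcomp_V[OF assms(1)] by blast
  next
    case (add a b) then show ?case using assms V_add by auto
  qed
  then show ?thesis by simp
qed

lemma V_mult: "x \<in> V d \<Longrightarrow> y \<in> V d \<Longrightarrow> x \<otimes> y \<in> V d"
proof (induction rule: V_induct)
  case (hom n x)
  have "hcomp (x \<otimes> y) k = \<zero>" if "\<not> int d dvd k" for k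
  proof -
    have "\<not> int d dvd k - n" using that hom(2) by (metis diff_add_cancel dvd_add)
    then show ?thesis using hom hcomp_mult[OF hom(1), of y k] A_carrier[OF hom(1)] by (auto simp: V_def)
  qed
  then show ?case using hom by (auto simp: V_def A_carrier)
next
  case (add a b)
  then show ?case using V_add by (simp add: l_distr V_carrier)
qed

lemma veronese_subring: "subring (V d) R"
proof (rule subringI)
  show "\<one> \<in> V d" using A_V one_A by simp
  fix h assume "h \<in> V d"
  moreover have "\<ominus> \<one> \<in> V d" using A_V[OF A_neg[OF one_A]] by simp
  ultimately have "\<ominus> \<one> \<otimes> h \<in> V d" using V_mult by blast
  then show "\<ominus> h \<in> V d" using \<open>h \<in> V d\<close> V_carrier by (simp add: l_minus)
qed (auto simp: V_carrier V_add V_mult)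

text \<open>Multiplication by \<open>a\<close> is injective and shifts degrees by \<open>i\<close>,
  so the components of \<open>w\<close> outside degree \<open>n - i\<close> vanish. This gives the
  degree of derivations that are defined by division.\<close>

lemma quotient_degree:
  assumes "a \<in> A i" "a \<noteq> \<zero>" "w \<in> carrier R" "a \<otimes> w \<in> A n"
  shows "w \<in> A (n - i)"
proof -
  have "hcomp w k = \<zero>" if "k \<noteq> n - i" for k
  proof -
    have "hcomp (a \<otimes> w) (k + i) = a \<otimes> hcomp w k"
      using hcomp_mult[OF assms(1,3), of "k + i"] by simp
    moreover have "hcomp (a \<otimes> w) (k + i) = \<zero>"
      using hcomp_hom[OF assms(4)] that by auto
    ultimately show ?thesis using assms integral A_carrier hcomp_closed by metis
  qed
  then have "w = finsum R (hcomp w) {n - i}" by (intro hcomp_sum) (use assms in auto)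
  then have "w = hcomp w (n - i)" using assms by simp
  then show ?thesis using hcomp_A[OF assms(3)] by metis
qed

end

section \<open>The Noetherian property\<close>

context cring
begin

section \<open>Linear spans over a subring and the Noetherian property\<close>

inductive_set lin_span :: "'a set \<Rightarrow> 'a set \<Rightarrow> 'a set" for Q W where
  zero: "\<zero> \<in> lin_span Q W"
| step: "c \<in> Q \<Longrightarrow> w \<in> W \<Longrightarrow> v \<in> lin_span Q W \<Longrightarrow> c \<otimes> w \<oplus> v \<in> lin_span Q W"

lemma lin_span_carrier: "Q \<subseteq> carrier R \<Longrightarrow> W \<subseteq> carrier R \<Longrightarrow> lin_span Q W \<subseteq> carrier R"
proof
  fix x assume "x \<in> lin_span Q W" "Q \<subseteq> carrier R" "W \<subseteq> carrier R"
  then show "x \<in> carrier R" by (induction rule: lin_span.induct) auto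
qed

lemma lin_span_mono: "W \<subseteq> W' \<Longrightarrow> lin_span Q W \<subseteq> lin_span Q W'"
proof
  fix x assume W: "W \<subseteq> W'" and "x \<in> lin_span Q W"
  from this(2) show "x \<in> lin_span Q W'"
  proof (induction rule: lin_span.induct)
    case (step c w v)
    then show ?case using W lin_span.step[of c Q w W' v] by blast
  qed (rule lin_span.zero)
qed

lemma lin_span_add:
  assumes "Q \<subseteq> carrier R" "W \<subseteq> carrier R" "x \<in> lin_span Q W" "y \<in> lin_span Q W"
  shows "x \<oplus> y \<in> lin_span Q W"
  using assms(3)
proof (induction rule: lin_span.induct)
  case zero
  have "y \<in> carrier R" using assms(4) lin_span_carrier[OF assms(1,2)] by blast
  then show ?case using assms(4) by simp
next
  case (step c w v)
  have "v \<in> carrier R" "y \<in> carrier R" using step(3) assms(4) lin_span_carrier[OF assms(1,2)] by blast+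
  then have "c \<otimes> w \<oplus> v \<oplus> y = c \<otimes> w \<oplus> (v \<oplus> y)"
    using step assms by (intro a_assoc) auto
  then show ?case using step lin_span.step by auto
qed

lemma lin_span_smult:
  assumes "subring Q R" "W \<subseteq> carrier R" "a \<in> Q" "x \<in> lin_span Q W"
  shows "a \<otimes> x \<in> lin_span Q W"
  using assms(4)
proof (induction rule: lin_span.induct)
  case zero
  have "a \<in> carrier R" using subringE(1)[OF assms(1)] assms(3) by blast
  then show ?case using lin_span.zero by simp
next
  case (step c w v)
  have Q: "Q \<subseteq> carrier R" using subringE(1)[OF assms(1)] .
  have "v \<in> carrier R" using step(3) lin_span_carrier[OF Q assms(2)] by blast
  moreover have "c \<in> carrier R" "w \<in> carrier R" "a \<in> carrier R" using step assms Q by auto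
  ultimately have "a \<otimes> (c \<otimes> w \<oplus> v) = (a \<otimes> c) \<otimes> w \<oplus> a \<otimes> v"
    by (simp add: r_distr m_assoc)
  moreover have "a \<otimes> c \<in> Q" using subringE(6)[OF assms(1)] assms(3) step(1) by blast
  ultimately show ?case using step lin_span.step by auto
qed

lemma lin_span_neg:
  assumes "subring Q R" "W \<subseteq> carrier R" "x \<in> lin_span Q W"
  shows "\<ominus> x \<in> lin_span Q W"
proof -
  have "\<ominus> \<one> \<in> Q" using subringE(3,5)[OF assms(1)] by blast
  moreover have "x \<in> carrier R" using assms lin_span_carrier[OF subringE(1)[OF assms(1)] assms(2)] by blast
  ultimately show ?thesis using lin_span_smult[OF assms(1,2) _ assms(3), of "\<ominus> \<one>"] by (simp add: l_minus)
qed

lemma lin_span_base: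
  assumes "subring Q R" "w \<in> W" "W \<subseteq> carrier R"
  shows "w \<in> lin_span Q W"
proof -
  have "w \<in> carrier R" using assms by blast
  then have "\<one> \<otimes> w \<oplus> \<zero> = w" by simp
  then show ?thesis using lin_span.step[OF subringE(3)[OF assms(1)] assms(2) lin_span.zero] by simp
qed

lemma lin_span_subset:
  assumes "subring Q R" "W' \<subseteq> carrier R" "W \<subseteq> lin_span Q W'"
  shows "lin_span Q W \<subseteq> lin_span Q W'"
proof
  fix x assume "x \<in> lin_span Q W"
  then show "x \<in> lin_span Q W'"
  proof (induction rule: lin_span.induct)
    case (step c w v)
    then show ?case using assms lin_span_smult lin_span_add subringE(1)[OF assms(1)] by blast
  qed (rule lin_span.zero)
qed

lemma lin_span_UN:
  assumes "Q \<subseteq> carrier R" "W = (\<Union>n. w ` {..<n::nat})" "W \<subseteq> carrier R" "x \<in> lin_span Q W"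
  shows "\<exists>n. x \<in> lin_span Q (w ` {..<n})"
  using assms(4)
proof (induction rule: lin_span.induct)
  case zero then show ?case using lin_span.zero by blast
next
  case (step c z v)
  then obtain n m where n: "v \<in> lin_span Q (w ` {..<n})" "z \<in> w ` {..<m}" using assms by auto
  have "lin_span Q (w ` {..<n}) \<subseteq> lin_span Q (w ` {..<max n m})"
    by (rule lin_span_mono) auto
  moreover have "z \<in> w ` {..<max n m}" using n(2) by auto
  ultimately have "c \<otimes> z \<oplus> v \<in> lin_span Q (w ` {..<max n m})"
    using lin_span.step[OF step(1)] n(1) by (meson subsetD)
  then show ?case by (rule exI)
qed

text \<open>For a subring \<open>P\<close> this is the Noetherian property.\<close>

definition noeth :: "'a set \<Rightarrow> bool"
  where "noeth P \<longleftrightarrow> (\<forall>w :: nat \<Rightarrow> 'a. range w \<subseteq> P \<longrightarrow> (\<exists>n. w n \<in> lin_span P (w ` {..<n})))"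

text \<open>Values at \<open>x\<close> of polynomials over \<open>P\<close> of degree below
  \<open>n\<close>. The index counts coefficients, so that the zero polynomial has an index of its
  own.\<close>

fun low_degree :: "'a set \<Rightarrow> 'a \<Rightarrow> nat \<Rightarrow> 'a set"
  where "low_degree P x 0 = {\<zero>}"
  | "low_degree P x (Suc n) = {r \<otimes> x [^] n \<oplus> e | r e. r \<in> P \<and> e \<in> low_degree P x n}"

lemma low_degree_carrier:
  "P \<subseteq> carrier R \<Longrightarrow> x \<in> carrier R \<Longrightarrow> y \<in> low_degree P x n \<Longrightarrow> y \<in> carrier R"
  by (induction n arbitrary: y) auto

lemma low_degree_zero: "subring P R \<Longrightarrow> x \<in> carrier R \<Longrightarrow> \<zero> \<in> low_degree P x n"
proof (induction n)
  case (Suc n)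
  then have "\<zero> = \<zero> \<otimes> x [^] n \<oplus> \<zero>" "\<zero> \<in> P" "\<zero> \<in> low_degree P x n" using subringE(2) by auto
  then show ?case by auto
qed simp

lemma low_degree_Suc: "subring P R \<Longrightarrow> x \<in> carrier R \<Longrightarrow> low_degree P x n \<subseteq> low_degree P x (Suc n)"
proof
  fix y assume P: "subring P R" and x: "x \<in> carrier R" and y: "y \<in> low_degree P x n"
  have "y \<in> carrier R" using low_degree_carrier[OF subringE(1)[OF P] x y] .
  then have "y = \<zero> \<otimes> x [^] n \<oplus> y" using x by simp
  then show "y \<in> low_degree P x (Suc n)" using y subringE(2)[OF P] by auto
qed

lemma low_degree_mono:
  "subring P R \<Longrightarrow> x \<in> carrier R \<Longrightarrow> n \<le> m \<Longrightarrow> low_degree P x n \<subseteq> low_degree P x m"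
  using lift_Suc_mono_le[of "low_degree P x"] low_degree_Suc by blast

lemma low_degree_add:
  assumes P: "subring P R" and x: "x \<in> carrier R"
  shows "y \<in> low_degree P x n \<Longrightarrow> z \<in> low_degree P x n \<Longrightarrow> y \<oplus> z \<in> low_degree P x n"
proof (induction n arbitrary: y z)
  case (Suc n)
  note Pc = subringE(1)[OF P]
  from Suc obtain r e r' e' where
    *: "y = r \<otimes> x [^] n \<oplus> e" "z = r' \<otimes> x [^] n \<oplus> e'" "r \<in> P" "r' \<in> P"
       "e \<in> low_degree P x n" "e' \<in> low_degree P x n" by auto
  have c: "r \<in> carrier R" "r' \<in> carrier R" "e \<in> carrier R" "e' \<in> carrier R"
    using * Pc low_degree_carrier[OF Pc x] by auto
  have "y \<oplus> z = (r \<oplus> r') \<otimes> x [^] n \<oplus> (e \<oplus> e')"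
    using c x unfolding * by (simp add: l_distr a_ac)
  moreover have "r \<oplus> r' \<in> P" using * subringE(7)[OF P] by auto
  ultimately show ?case using Suc.IH * by auto
qed simp

lemma low_degree_smult:
  assumes P: "subring P R" and x: "x \<in> carrier R" and a: "a \<in> P"
  shows "y \<in> low_degree P x n \<Longrightarrow> a \<otimes> y \<in> low_degree P x n"
proof (induction n arbitrary: y)
  case 0 then show ?case using a subringE(1)[OF P] by auto
next
  case (Suc n)
  note Pc = subringE(1)[OF P]
  from Suc obtain r e where *: "y = r \<otimes> x [^] n \<oplus> e" "r \<in> P" "e \<in> low_degree P x n" by auto
  have c: "r \<in> carrier R" "e \<in> carrier R" "a \<in> carrier R"
    using * Pc low_degree_carrier[OF Pc x] a by auto
  have "a \<otimes> y = (a \<otimes> r) \<otimes> x [^] n \<oplus> a \<otimes> e"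
    using c x unfolding * by (simp add: r_distr m_assoc)
  moreover have "a \<otimes> r \<in> P" using * a subringE(6)[OF P] by auto
  ultimately show ?case using Suc.IH * by auto
qed

lemma low_degree_shift:
  assumes P: "subring P R" and x: "x \<in> carrier R"
  shows "y \<in> low_degree P x n \<Longrightarrow> x [^] (k::nat) \<otimes> y \<in> low_degree P x (n + k)"
proof (induction n arbitrary: y)
  case 0 then show ?case using x low_degree_zero[OF P x] by auto
next
  case (Suc n)
  note Pc = subringE(1)[OF P]
  from Suc obtain r e where *: "y = r \<otimes> x [^] n \<oplus> e" "r \<in> P" "e \<in> low_degree P x n" by auto
  have c: "r \<in> carrier R" "e \<in> carrier R"
    using * Pc low_degree_carrier[OF Pc x] by auto
  have "x [^] k \<otimes> y = r \<otimes> (x [^] n \<otimes> x [^] k) \<oplus> x [^] k \<otimes> e"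
    using c x unfolding * by (simp add: r_distr m_ac)
  then have "x [^] k \<otimes> y = r \<otimes> x [^] (n + k) \<oplus> x [^] k \<otimes> e"
    using x by (simp add: nat_pow_mult)
  then show ?case using Suc.IH * by auto
qed

lemma low_degree_mult:
  assumes P: "subring P R" and x: "x \<in> carrier R" and z: "z \<in> low_degree P x m"
  shows "y \<in> low_degree P x n \<Longrightarrow> y \<otimes> z \<in> low_degree P x (n + m)"
proof (induction n arbitrary: y)
  case 0
  then show ?case using low_degree_carrier[OF subringE(1)[OF P] x z] low_degree_zero[OF P x] by auto
next
  case (Suc n)
  note Pc = subringE(1)[OF P]
  from Suc obtain r e where *: "y = r \<otimes> x [^] n \<oplus> e" "r \<in> P" "e \<in> low_degree P x n" by auto
  have c: "r \<in> carrier R" "e \<in> carrier R" "z \<in> carrier R"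
    using * Pc low_degree_carrier[OF Pc x] z by auto
  have eq: "y \<otimes> z = r \<otimes> (x [^] n \<otimes> z) \<oplus> e \<otimes> z"
    using c x unfolding * by (simp add: l_distr m_assoc)
  have "r \<otimes> (x [^] n \<otimes> z) \<in> low_degree P x (m + n)"
    using low_degree_smult[OF P x *(2) low_degree_shift[OF P x z]] .
  then have "r \<otimes> (x [^] n \<otimes> z) \<in> low_degree P x (Suc n + m)"
    using low_degree_mono[OF P x, of "m + n" "Suc n + m"] by auto
  moreover have "e \<otimes> z \<in> low_degree P x (Suc n + m)"
    using Suc.IH[OF *(3)] low_degree_mono[OF P x, of "n + m" "Suc n + m"] by auto
  ultimately show ?case unfolding eq by (rule low_degree_add[OF P x])
qed

lemma generate_ring_low_degree:
  assumes P: "subring P R" and x: "x \<in> carrier R"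
  shows "generate_ring R (insert x P) \<subseteq> (\<Union>n. low_degree P x n)"
proof
  note Pc = subringE(1)[OF P]
  note c = low_degree_carrier[OF Pc x]
  have const: "r \<in> low_degree P x (Suc 0)" if "r \<in> P" for r
  proof -
    have "r = r \<otimes> x [^] (0::nat) \<oplus> \<zero>" using that Pc by auto
    then show ?thesis using that by auto
  qed
  fix y assume "y \<in> generate_ring R (insert x P)"
  then show "y \<in> (\<Union>n. low_degree P x n)"
  proof (induction rule: generate_ring.induct)
    case one
    then show ?case using const subringE(3)[OF P] by blast
  next
    case (incl h)
    show ?case
    proof (cases "h = x")
      case True
      have "\<one> \<in> low_degree P x (Suc 0)" using const subringE(3)[OF P] by blast
      from low_degree_shift[OF P x this, of 1] x True have "h \<in> low_degree P x (Suc 1)" by simp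
      then show ?thesis by blast
    next
      case False then show ?thesis using incl const by blast
    qed
  next
    case (a_inv h)
    then obtain n where n: "h \<in> low_degree P x n" by blast
    have "\<ominus> \<one> \<in> P" using subringE(3,5)[OF P] by blast
    then have "\<ominus> \<one> \<otimes> h \<in> low_degree P x n" using low_degree_smult[OF P x _ n] by blast
    then show ?case using c[OF n] by (auto simp: l_minus)
  next
    case (eng_add h1 h2)
    then obtain n m where "h1 \<in> low_degree P x n" "h2 \<in> low_degree P x m" by blast
    then have "h1 \<in> low_degree P x (max n m)" "h2 \<in> low_degree P x (max n m)"
      using low_degree_mono[OF P x] by (meson max.cobounded1 max.cobounded2 subsetD)+
    then show ?case using low_degree_add[OF P x] by blast
  next
    case (eng_mult h1 h2)
    then obtain n m where "h1 \<in> low_degree P x n" "h2 \<in> low_degree P x m" by blast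
    then have "h1 \<otimes> h2 \<in> low_degree P x (n + m)" by (metis low_degree_mult[OF P x])
    then show ?case by blast
  qed
qed

text \<open>Hilbert's basis theorem. From a non-finitely generated submodule \<open>J\<close> one picks successively
  \<open>f k\<close> of least degree outside the span of its predecessors; the leading coefficients then violate
  the Noetherian property of \<open>P\<close>.\<close>

lemma noeth_adjoin:
  assumes P: "subring P R" and x: "x \<in> carrier R" and N: "noeth P"
  shows "noeth (generate_ring R (insert x P))"
proof (rule ccontr)
  define Q where "Q = generate_ring R (insert x P)"
  note Pc = subringE(1)[OF P]
  have Q: "subring Q R" unfolding Q_def using generate_ring_is_subring[of "insert x P"] x Pc by auto
  note Qc = subringE(1)[OF Q]
  have PQ: "P \<subseteq> Q" unfolding Q_def by (auto intro: generate_ring.incl)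
  have xQ: "x [^] n \<in> Q" for n :: nat
    unfolding Q_def by (induction n) (auto intro: generate_ring.intros)
  have QL: "Q \<subseteq> (\<Union>n. low_degree P x n)" unfolding Q_def using generate_ring_low_degree[OF P x] .
  assume "\<not> noeth (generate_ring R (insert x P))"
  then obtain w where w: "range w \<subseteq> Q" "\<And>n::nat. w n \<notin> lin_span Q (w ` {..<n})"
    unfolding noeth_def Q_def by blast
  have wc: "range w \<subseteq> carrier R" using w Qc by blast
  define J where "J = lin_span Q (range w)"
  have JQ: "J \<subseteq> Q"
  proof
    fix y assume "y \<in> J" then show "y \<in> Q" unfolding J_def
    proof (induction rule: lin_span.induct)
      case zero then show ?case using subringE(2)[OF Q] .
    next
      case (step c v z) then show ?case using subringE(6,7)[OF Q] w(1) by blast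
    qed
  qed
  have Jc: "J \<subseteq> carrier R" using JQ Qc by blast
  \<comment> \<open>A finite part of \<open>J\<close> lies in the span of some
    \<open>w 0, ..., w (n - 1)\<close>, and \<open>w n\<close> lies outside that span.\<close>
  have nfg: "\<exists>y\<in>J. y \<notin> lin_span Q G" if "finite G" "G \<subseteq> J" for G
  proof -
    have "\<exists>n. G \<subseteq> lin_span Q (w ` {..<n})"
      using that
    proof (induction G)
      case (insert g G)
      then obtain n where n: "G \<subseteq> lin_span Q (w ` {..<n})" by auto
      have "\<exists>m. g \<in> lin_span Q (w ` {..<m})"
        by (rule lin_span_UN[of Q "range w"]) (use insert Qc wc J_def in auto)
      then obtain m where m: "g \<in> lin_span Q (w ` {..<m})" by blast
      have "lin_span Q (w ` {..<n}) \<subseteq> lin_span Q (w ` {..<max n m})"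
        "lin_span Q (w ` {..<m}) \<subseteq> lin_span Q (w ` {..<max n m})"
        by (rule lin_span_mono; auto)+
      then show ?case using n m by blast
    qed auto
    then obtain n where n: "G \<subseteq> lin_span Q (w ` {..<n})" by blast
    have "lin_span Q G \<subseteq> lin_span Q (w ` {..<n})"
      by (rule lin_span_subset[OF Q _ n]) (use wc in auto)
    then have "w n \<notin> lin_span Q G" using w(2) by blast
    moreover have "w n \<in> J" unfolding J_def by (rule lin_span_base[OF Q _ wc]) auto
    ultimately show ?thesis by blast
  qed
  \<comment> \<open>As \<open>x\<close> may be algebraic over \<open>P\<close>, an element has many
    polynomial representations; \<open>dg\<close> is the least coefficient count among them.\<close>
  define dg where "dg y = (LEAST n. y \<in> low_degree P x n)" for y
  have dg: "y \<in> low_degree P x (dg y)" if "y \<in> Q" for y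
  proof -
    have "\<exists>n. y \<in> low_degree P x n" using that QL by blast
    then show ?thesis unfolding dg_def by (rule LeastI_ex)
  qed
  have dg_le: "dg y \<le> n" if "y \<in> low_degree P x n" for y n
    unfolding dg_def using that by (rule Least_le)
  define good where "good F y \<longleftrightarrow> y \<in> J \<and> y \<notin> lin_span Q F \<and>
      (\<forall>z\<in>J. z \<notin> lin_span Q F \<longrightarrow> dg y \<le> dg z)" for F y
  have good_ex: "\<exists>y. good F y" if F: "finite F" "F \<subseteq> J" for F
  proof -
    obtain y where y: "y \<in> J \<and> y \<notin> lin_span Q F" using nfg[OF F] by blast
    have "\<exists>y. (y \<in> J \<and> y \<notin> lin_span Q F) \<and> (\<forall>z. z \<in> J \<and> z \<notin> lin_span Q F \<longrightarrow> dg y \<le> dg z)"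
      using ex_has_least_nat[of "\<lambda>y. y \<in> J \<and> y \<notin> lin_span Q F" y dg] y by blast
    then show ?thesis unfolding good_def by blast
  qed
  have "\<exists>f. \<forall>n::nat. good (f ` {..<n}) (f n)"
  proof -
    \<comment> \<open>Each choice depends on all earlier ones, so the recursion carries the list of
      choices made so far.\<close>
    define step where "step ys = ys @ [SOME y. good (set ys) y]" for ys
    define L where "L n = (step ^^ n) []" for n
    have L0: "L 0 = []" and LS: "L (Suc n) = L n @ [SOME y. good (set (L n)) y]" for n
      by (auto simp: L_def step_def)
    have LJ: "set (L n) \<subseteq> J" for n
    proof (induction n)
      case (Suc n)
      have "good (set (L n)) (SOME y. good (set (L n)) y)" by (rule someI_ex, rule good_ex) (use Suc in auto)
      then show ?case using Suc by (auto simp: LS good_def)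
    qed (simp add: L0)
    define fs where "fs n = (SOME y. good (set (L n)) y)" for n
    have L: "L n = map fs [0..<n]" for n
      by (induction n) (auto simp: L0 LS fs_def)
    have "good (set (L n)) (fs n)" for n
      unfolding fs_def by (rule someI_ex, rule good_ex) (use LJ in auto)
    then have "\<forall>n::nat. good (fs ` {..<n}) (fs n)" unfolding L by (simp add: atLeast0LessThan)
    then show ?thesis by blast
  qed
  then obtain f where "\<forall>n::nat. good (f ` {..<n}) (f n)" by (rule exE)
  note f = this[rule_format]
  have fJ: "f n \<in> J" for n using f unfolding good_def by blast
  then have fc: "f ` U \<subseteq> carrier R" for U using Jc by blast
  have fpos: "dg (f n) \<noteq> 0" for n
  proof
    assume "dg (f n) = 0"
    then have "f n \<in> low_degree P x 0" using dg[of "f n"] fJ JQ by force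
    then have "f n = \<zero>" by simp
    then show False using f[of n] lin_span.zero unfolding good_def by simp
  qed
  have "\<exists>r e. r \<in> P \<and> e \<in> low_degree P x (dg (f n) - 1) \<and> f n = r \<otimes> x [^] (dg (f n) - 1) \<oplus> e" for n
  proof -
    obtain k where k: "dg (f n) = Suc k" using fpos[of n] not0_implies_Suc by blast
    have "f n \<in> low_degree P x (Suc k)" using dg[of "f n"] fJ JQ k by auto
    then show ?thesis unfolding k by auto
  qed
  then obtain r e where re: "\<And>n. r n \<in> P" "\<And>n. e n \<in> low_degree P x (dg (f n) - 1)"
      "\<And>n. f n = r n \<otimes> x [^] (dg (f n) - 1) \<oplus> e n" by metis
  have mono: "dg (f i) \<le> dg (f n)" if "i < n" for i n
  proof -
    have "lin_span Q (f ` {..<i}) \<subseteq> lin_span Q (f ` {..<n})" using that by (intro lin_span_mono) auto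
    then show ?thesis using f[of n] f[of i] unfolding good_def by blast
  qed
  obtain n where n: "r n \<in> lin_span P (r ` {..<n})" using N re(1) unfolding noeth_def by blast
  define k where "k = dg (f n) - 1"
  \<comment> \<open>A relation between leading coefficients is lifted to the \<open>f i\<close>.
    Because \<open>dg (f i) \<le> dg (f n)\<close>, multiplying \<open>f i\<close> by
    \<open>x [^] (k - j)\<close> brings its leading term to the exponent \<open>k\<close>.\<close>
  have "\<exists>g \<in> lin_span Q (f ` {..<n}). \<exists>e \<in> low_degree P x k. g = s \<otimes> x [^] k \<oplus> e"
    if "s \<in> lin_span P (r ` {..<n})" for s
    using that
  proof (induction rule: lin_span.induct)
    case zero
    have "\<zero> = \<zero> \<otimes> x [^] k \<oplus> \<zero>" using x by simp
    then show ?case using lin_span.zero low_degree_zero[OF P x] by blast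
  next
    case (step c s v)
    then obtain g e1 where g: "g \<in> lin_span Q (f ` {..<n})" "e1 \<in> low_degree P x k" "g = v \<otimes> x [^] k \<oplus> e1"
      by blast
    obtain i where i: "i < n" "s = r i" using step by auto
    define j where "j = dg (f i) - 1"
    have jk: "j \<le> k" unfolding j_def k_def using mono[OF i(1)] by simp
    have ec: "e i \<in> carrier R" "e1 \<in> carrier R"
      using low_degree_carrier[OF Pc x] re(2) g by blast+
    have cc: "c \<in> carrier R" "r i \<in> carrier R" using step(1) re(1) Pc by auto
    have "lin_span P (r ` {..<n}) \<subseteq> carrier R" using re(1) Pc by (intro lin_span_carrier) auto
    then have vc: "v \<in> carrier R" using step by blast
    have fi: "f i = r i \<otimes> x [^] j \<oplus> e i" using re(3) j_def by blast
    have "(c \<otimes> x [^] (k - j)) \<otimes> f i \<oplus> g \<in> lin_span Q (f ` {..<n})"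
      by (rule lin_span.step) (use g step PQ xQ subringE(6)[OF Q] i in auto)
    moreover have "(c \<otimes> x [^] (k - j)) \<otimes> f i \<oplus> g
        = (c \<otimes> s \<oplus> v) \<otimes> x [^] k \<oplus> (c \<otimes> (x [^] (k - j) \<otimes> e i) \<oplus> e1)"
    proof -
      have xx: "x [^] (k - j) \<otimes> x [^] j = x [^] k" using x jk by (simp add: nat_pow_mult)
      have "(c \<otimes> x [^] (k - j)) \<otimes> f i
          = c \<otimes> r i \<otimes> (x [^] (k - j) \<otimes> x [^] j) \<oplus> c \<otimes> (x [^] (k - j) \<otimes> e i)"
        unfolding fi using ec cc x by (simp add: r_distr m_ac)
      then show ?thesis unfolding xx g(3) i(2) using ec cc vc x by (simp add: l_distr a_ac)
    qed
    moreover have "c \<otimes> (x [^] (k - j) \<otimes> e i) \<oplus> e1 \<in> low_degree P x k"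
    proof -
      have "x [^] (k - j) \<otimes> e i \<in> low_degree P x k"
        using low_degree_shift[OF P x re(2)[of i], of "k - j"] jk j_def by simp
      then show ?thesis using low_degree_smult[OF P x] low_degree_add[OF P x] step g by blast
    qed
    ultimately show ?case by blast
  qed
  from this[OF n] obtain g e1 where g: "g \<in> lin_span Q (f ` {..<n})" "e1 \<in> low_degree P x k"
      "g = r n \<otimes> x [^] k \<oplus> e1" by blast
  have gc: "g \<in> carrier R" using g(1) lin_span_carrier[OF Qc fc] by blast
  have gJ: "g \<in> J"
  proof -
    have "lin_span Q (f ` {..<n}) \<subseteq> J" unfolding J_def
      by (rule lin_span_subset[OF Q wc]) (use fJ J_def in auto)
    then show ?thesis using g by blast
  qed
  have m1: "\<ominus> \<one> \<in> P" using subringE(3,5)[OF P] by blast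
  have e1c: "e1 \<in> carrier R" "e n \<in> carrier R" "r n \<in> carrier R"
    using low_degree_carrier[OF Pc x] g re Pc by blast+
  have fn: "f n = r n \<otimes> x [^] k \<oplus> e n" using re(3) k_def by blast
  \<comment> \<open>Subtracting \<open>g\<close> cancels the leading term of \<open>f n\<close> but
    leaves the element outside the span, against the minimality of \<open>dg (f n)\<close>.\<close>
  let ?h = "f n \<oplus> \<ominus> g"
  have "?h = e n \<oplus> \<ominus> \<one> \<otimes> e1"
  proof -
    have "?h = (r n \<otimes> x [^] k \<oplus> \<ominus> (r n \<otimes> x [^] k)) \<oplus> (e n \<oplus> \<ominus> e1)"
      unfolding fn g(3) using e1c x by (simp add: minus_add a_ac del: r_neg)
    then show ?thesis using e1c x by (simp add: r_neg l_minus)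
  qed
  then have hl: "?h \<in> low_degree P x k"
    using low_degree_add[OF P x re(2)[of n]] low_degree_smult[OF P x m1 g(2)] k_def by simp
  have fnc: "f n \<in> carrier R" using fJ Jc by blast
  have "?h \<in> J" unfolding J_def
    by (rule lin_span_add[OF Qc wc]) (use fJ gJ J_def lin_span_neg[OF Q wc] in auto)
  moreover have "?h \<notin> lin_span Q (f ` {..<n})"
  proof
    assume "?h \<in> lin_span Q (f ` {..<n})"
    then have "?h \<oplus> g \<in> lin_span Q (f ` {..<n})" using lin_span_add[OF Qc fc] g by blast
    moreover have "?h \<oplus> g = f n" using gc fnc by (simp add: a_assoc l_neg)
    ultimately show False using f[of n] unfolding good_def by simp
  qed
  ultimately have "dg (f n) \<le> dg ?h" using f[of n] unfolding good_def by blast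
  also have "\<dots> \<le> k" using dg_le[OF hl] .
  finally show False using fpos[of n] unfolding k_def by simp
qed

end

context domain
begin

text \<open>Either \<open>w 0\<close> is zero and lies in the empty span, or \<open>w 0\<close> is
  invertible and \<open>w 1\<close> is a multiple of it.\<close>

lemma noeth_subfield:
  assumes "subfield F R" shows "noeth F"
  unfolding noeth_def
proof (intro allI impI)
  fix w :: "nat \<Rightarrow> 'a" assume w: "range w \<subseteq> F"
  have sub: "subring F R" using subfieldE(1)[OF assms] .
  note Fc = subringE(1)[OF sub]
  show "\<exists>n. w n \<in> lin_span F (w ` {..<n})"
  proof (cases "w 0 = \<zero>")
    case True then show ?thesis using lin_span.zero by metis
  next
    case False
    then have "w 0 \<in> Units (R\<lparr>carrier := F\<rparr>)" using w subfield.subfield_Units[OF assms] by auto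
    then obtain y where y: "y \<in> F" "y \<otimes> w 0 = \<one>" by (auto simp: Units_def)
    have c: "w 0 \<in> carrier R" "w 1 \<in> carrier R" "y \<in> carrier R" using w Fc y by auto
    have "w 1 \<otimes> y \<in> F" using w y subringE(6)[OF sub] by auto
    then have "(w 1 \<otimes> y) \<otimes> w 0 \<oplus> \<zero> \<in> lin_span F (w ` {..<1})"
      by (intro lin_span.step lin_span.zero) auto
    moreover have "(w 1 \<otimes> y) \<otimes> w 0 \<oplus> \<zero> = w 1" using c y by (simp add: m_assoc)
    ultimately show ?thesis by auto
  qed
qed

lemma noeth_fin_gen:
  assumes F: "subfield F R" and "finite S" "S \<subseteq> carrier R"
  shows "noeth (generate_ring R (F \<union> S))"
  using assms(2,3)
proof (induction S)
  case empty
  have "generate_ring R F = F"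
    using generate_ring_min_subring1[OF subringE(1)[OF subfieldE(1)[OF F]] subfieldE(1)[OF F]]
      generate_ring.incl[of _ F R] by blast
  then show ?case using noeth_subfield[OF F] by simp
next
  case (insert x S)
  note Fc = subringE(1)[OF subfieldE(1)[OF F]]
  let ?P = "generate_ring R (F \<union> S)"
  have P: "subring ?P R" using generate_ring_is_subring Fc insert by auto
  have "noeth (generate_ring R (insert x ?P))"
    by (rule noeth_adjoin[OF P]) (use insert in auto)
  moreover have "generate_ring R (insert x ?P) = generate_ring R (F \<union> insert x S)"
  proof
    have c: "F \<union> insert x S \<subseteq> carrier R" using Fc insert by auto
    show "generate_ring R (insert x ?P) \<subseteq> generate_ring R (F \<union> insert x S)"
    proof (rule generate_ring_min_subring1[OF _ generate_ring_is_subring[OF c]])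
      show "insert x ?P \<subseteq> carrier R" using subringE(1)[OF P] insert by auto
      have "?P \<subseteq> generate_ring R (F \<union> insert x S)" by (rule mono_generate_ring[OF _ c]) auto
      then show "insert x ?P \<subseteq> generate_ring R (F \<union> insert x S)"
        using generate_ring.incl[of x "F \<union> insert x S" R] by simp
    qed
    show "generate_ring R (F \<union> insert x S) \<subseteq> generate_ring R (insert x ?P)"
      by (rule mono_generate_ring) (use insert subringE(1)[OF P] in \<open>auto intro: generate_ring.incl\<close>)
  qed
  ultimately show ?case by simp
qed

end

section \<open>Degrees with respect to a locally nilpotent derivation\<close>

context cring
begin

definition nat_el :: "nat \<Rightarrow> 'a" where "nat_el n = [n] \<cdot> \<one>"

lemma nat_el_closed [simp]: "nat_el n \<in> carrier R"
  by (simp add: nat_el_def)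

lemma nat_el_0 [simp]: "nat_el 0 = \<zero>" by (simp add: nat_el_def)

lemma nat_el_1 [simp]: "nat_el (Suc 0) = \<one>" by (simp add: nat_el_def)

lemma nat_el_add: "nat_el (m + n) = nat_el m \<oplus> nat_el n"
  by (simp add: nat_el_def add.nat_pow_mult)

lemma nat_el_Suc: "nat_el (Suc n) = nat_el n \<oplus> \<one>"
  using nat_el_add[of n 1] by simp

lemma nat_el_mult: "nat_el (m * n) = nat_el m \<otimes> nat_el n"
  by (induction m) (simp_all add: nat_el_add nat_el_Suc l_distr a_comm)

lemma nat_el_subring: "subring P R \<Longrightarrow> nat_el n \<in> P"
  by (induction n) (simp_all add: nat_el_Suc subringE(2,3,7))

lemma pow_subring: "subring P R \<Longrightarrow> x \<in> P \<Longrightarrow> x [^] (n::nat) \<in> P"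
  by (induction n) (simp_all add: subringE(3,6))

end

lemma (in domain) pow_eq_zero: "x \<in> carrier R \<Longrightarrow> x [^] (n::nat) = \<zero> \<Longrightarrow> x = \<zero>"
  by (induction n) (auto simp: integral_iff)

text \<open>A locally nilpotent derivation of the subring \<open>V\<close>, kept inside the ambient
  domain; outside \<open>V\<close> the values of \<open>D\<close> are arbitrary. Characteristic 0 is
  included because the degree theory below rests on it.\<close>

locale lnd = domain R for R (structure) +
  fixes V :: "'a set" and D :: "'a \<Rightarrow> 'a"
  assumes V_subring: "subring V R"
    and D_closed: "x \<in> V \<Longrightarrow> D x \<in> V"
    and D_add: "x \<in> V \<Longrightarrow> y \<in> V \<Longrightarrow> D (x \<oplus> y) = D x \<oplus> D y"
    and D_mult: "x \<in> V \<Longrightarrow> y \<in> V \<Longrightarrow> D (x \<otimes> y) = D x \<otimes> y \<oplus> x \<otimes> D y"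
    and D_nilp: "x \<in> V \<Longrightarrow> \<exists>n. (D ^^ n) x = \<zero>"
    and char0: "n > 0 \<Longrightarrow> nat_el n \<noteq> \<zero>"
begin

lemmas V_rules = subringE(2,3,5,6,7)[OF V_subring] nat_el_subring[OF V_subring] pow_subring[OF V_subring]

lemma Vc: "x \<in> V \<Longrightarrow> x \<in> carrier R" using subringE(1)[OF V_subring] by blast

lemma D_zero [simp]: "D \<zero> = \<zero>"
proof -
  have "D \<zero> \<in> carrier R" "D (\<zero> \<oplus> \<zero>) = D \<zero> \<oplus> D \<zero>"
    using V_rules(1) D_closed[of \<zero>] Vc[of "D \<zero>"] D_add[of \<zero> \<zero>] by auto
  then show ?thesis using add.l_cancel[of "D \<zero>" "D \<zero>" \<zero>] by simp
qed

lemma D_neg: "x \<in> V \<Longrightarrow> D (\<ominus> x) = \<ominus> D x"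
proof -
  assume x: "x \<in> V"
  have "D (\<ominus> x \<oplus> x) = D (\<ominus> x) \<oplus> D x" using x V_rules by (intro D_add)
  then have "D (\<ominus> x) \<oplus> D x = \<zero>" using Vc[OF x] by (simp add: l_neg)
  then show ?thesis using x V_rules D_closed Vc by (simp add: minus_equality)
qed

lemma D_minus: "x \<in> V \<Longrightarrow> y \<in> V \<Longrightarrow> D (x \<ominus> y) = D x \<ominus> D y"
  by (simp add: a_minus_def V_rules D_add D_neg)

lemma D_one [simp]: "D \<one> = \<zero>"
proof -
  have "D \<one> \<in> carrier R" "D (\<one> \<otimes> \<one>) = D \<one> \<otimes> \<one> \<oplus> \<one> \<otimes> D \<one>"
    using V_rules(2) D_closed[of \<one>] Vc[of "D \<one>"] D_mult[of \<one> \<one>] by auto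
  then show ?thesis using add.l_cancel[of "D \<one>" "D \<one>" \<zero>] by simp
qed

lemma D_nat_el [simp]: "D (nat_el n) = \<zero>"
  by (induction n) (simp_all add: nat_el_Suc D_add V_rules)

lemma Dn_closed: "x \<in> V \<Longrightarrow> (D ^^ n) x \<in> V"
  by (induction n) (simp_all add: D_closed)

lemma Dn_zero [simp]: "(D ^^ n) \<zero> = \<zero>"
  by (induction n) simp_all

lemma Dn_add: "x \<in> V \<Longrightarrow> y \<in> V \<Longrightarrow> (D ^^ n) (x \<oplus> y) = (D ^^ n) x \<oplus> (D ^^ n) y"
  by (induction n) (simp_all add: D_add Dn_closed)

lemma Dn_minus: "x \<in> V \<Longrightarrow> y \<in> V \<Longrightarrow> (D ^^ n) (x \<ominus> y) = (D ^^ n) x \<ominus> (D ^^ n) y"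
  by (induction n) (simp_all add: D_minus Dn_closed)

lemma D_ker_mult: "a \<in> V \<Longrightarrow> b \<in> V \<Longrightarrow> D a = \<zero> \<Longrightarrow> D (a \<otimes> b) = a \<otimes> D b"
  by (simp add: D_mult D_closed Vc)

lemma Dn_ker_mult: "a \<in> V \<Longrightarrow> b \<in> V \<Longrightarrow> D a = \<zero> \<Longrightarrow> (D ^^ n) (a \<otimes> b) = a \<otimes> (D ^^ n) b"
  by (induction n) (simp_all add: D_ker_mult Dn_closed)

lemma D_ker_pow: "a \<in> V \<Longrightarrow> D a = \<zero> \<Longrightarrow> D (a [^] (n::nat)) = \<zero>"
  by (induction n) (simp_all add: D_mult V_rules Vc)

lemma D_pow:
  assumes "x \<in> V"
  shows "D (x [^] Suc n) = nat_el (Suc n) \<otimes> (x [^] n \<otimes> D x)"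
proof (induction n)
  case 0 then show ?case using assms Vc D_closed by (simp add: D_mult V_rules)
next
  case (Suc n)
  note c = Vc[OF assms] Vc[OF D_closed[OF assms]]
  have "D (x [^] Suc (Suc n)) = D (x [^] Suc n) \<otimes> x \<oplus> x [^] Suc n \<otimes> D x"
    using D_mult[of "x [^] Suc n" x] V_rules assms by simp
  also have "\<dots> = nat_el (Suc n) \<otimes> (x [^] Suc n \<otimes> D x) \<oplus> x [^] Suc n \<otimes> D x"
    unfolding Suc using c by (simp add: m_ac)
  also have "\<dots> = nat_el (Suc (Suc n)) \<otimes> (x [^] Suc n \<otimes> D x)"
    using c by (simp add: nat_el_Suc[of "Suc n"] l_distr del: nat_pow_Suc)
  finally show ?case .
qed

lemma Dn_mono_zero: "x \<in> V \<Longrightarrow> (D ^^ n) x = \<zero> \<Longrightarrow> n \<le> m \<Longrightarrow> (D ^^ m) x = \<zero>"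
proof -
  assume "(D ^^ n) x = \<zero>" "n \<le> m"
  then have "(D ^^ (m - n + n)) x = \<zero>" unfolding funpow_add by simp
  then show ?thesis using \<open>n \<le> m\<close> by simp
qed

text \<open>Of the Leibniz expansion of order \<open>n + m\<close> only the term with
  \<open>n\<close> derivatives on \<open>a\<close> and \<open>m\<close> on \<open>b\<close>
  survives. Induction on \<open>n + m\<close> produces its coefficient through Pascal's
  rule.\<close>

lemma Dn_mult_top:
  assumes "a \<in> V" "b \<in> V" "(D ^^ Suc n) a = \<zero>" "(D ^^ Suc m) b = \<zero>"
  shows "(D ^^ (n + m)) (a \<otimes> b) = nat_el (n + m choose n) \<otimes> ((D ^^ n) a \<otimes> (D ^^ m) b)"
  using assms
proof (induction k \<equiv> "n + m" arbitrary: n m a b)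
  case 0 then show ?case by (simp add: Vc)
next
  case (Suc k)
  note V = Suc.prems(1,2)
  have D1: "(D ^^ Suc j) x = (D ^^ j) (D x)" for j x by (simp add: funpow_swap1)
  have V': "D a \<in> V" "D b \<in> V" using V D_closed by auto
  have *: "(D ^^ Suc k) (a \<otimes> b) = (D ^^ k) (D a \<otimes> b) \<oplus> (D ^^ k) (a \<otimes> D b)"
    unfolding D1 using V V' V_rules by (simp add: D_mult Dn_add)
  show ?case
  proof (cases n)
    case 0
    then have "D a = \<zero>" "m = Suc k" using Suc by auto
    then show ?thesis unfolding 0 using V V' Dn_closed[of b m] Vc
      by (simp add: Dn_ker_mult del: funpow.simps)
  next
    case n: (Suc n')
    show ?thesis
    proof (cases m)
      case 0
      then have m: "D b = \<zero>" "n = Suc k" using Suc by auto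
      have "(D ^^ n) (a \<otimes> b) = (D ^^ n) (b \<otimes> a)" using V Vc m_comm by simp
      also have "\<dots> = b \<otimes> (D ^^ n) a" using V m Dn_ker_mult by blast
      finally show ?thesis using 0 V Vc Dn_closed[OF V(1), of n] by (simp add: m_comm)
    next
      case m: (Suc m')
      have k: "k = n' + m" "k = n + m'" "n + m = Suc k" using Suc.hyps(2) n m by auto
      have 1: "(D ^^ k) (D a \<otimes> b) = nat_el (n' + m choose n') \<otimes> ((D ^^ n) a \<otimes> (D ^^ m) b)"
        using Suc.hyps(1)[OF k(1) V'(1) V(2)] Suc.prems(3,4) unfolding k(1)[symmetric] n D1 by simp
      have 2: "(D ^^ k) (a \<otimes> D b) = nat_el (n + m' choose n) \<otimes> ((D ^^ n) a \<otimes> (D ^^ m) b)"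
        using Suc.hyps(1)[OF k(2) V(1) V'(2)] Suc.prems(3,4) unfolding k(2)[symmetric] m D1 by simp
      have ch: "(n + m choose n) = (n' + m choose n') + (n + m' choose n)"
        using n m by simp
      have c: "(D ^^ n) a \<in> carrier R" "(D ^^ m) b \<in> carrier R" using V Vc Dn_closed by blast+
      have "(n + m choose n) = (n' + m choose n') + (n + m' choose n)" by (fact ch)
      then have "nat_el (n + m choose n) = nat_el (n' + m choose n') \<oplus> nat_el (n + m' choose n)"
        by (simp only: nat_el_add)
      then show ?thesis using * 1 2 c k(3) by (simp only: l_distr nat_el_closed m_closed)
    qed
  qed
qed

text \<open>The usual degree function of a locally nilpotent derivation, as a relation so that
  \<open>\<zero>\<close> has no degree.\<close>

definition has_deg :: "nat \<Rightarrow> 'a \<Rightarrow> bool"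
  where "has_deg n x \<longleftrightarrow> x \<in> V \<and> (D ^^ n) x \<noteq> \<zero> \<and> (D ^^ Suc n) x = \<zero>"

lemma has_deg_ex:
  assumes "x \<in> V" "x \<noteq> \<zero>" shows "\<exists>n. has_deg n x"
proof -
  define k where "k = (LEAST n. (D ^^ n) x = \<zero>)"
  have k: "(D ^^ k) x = \<zero>" unfolding k_def using D_nilp[OF assms(1)] by (rule LeastI_ex)
  then obtain n where n: "k = Suc n" using assms(2) by (cases k) auto
  have "(D ^^ n) x \<noteq> \<zero>" using not_less_Least[of n "\<lambda>n. (D ^^ n) x = \<zero>"] n k_def by auto
  then show ?thesis unfolding has_deg_def using k n assms by auto
qed

lemma has_deg_zero_iff: "has_deg n x \<Longrightarrow> (D ^^ m) x = \<zero> \<longleftrightarrow> n < m"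
  using Dn_mono_zero[of x m n] Dn_mono_zero[of x "Suc n" m] unfolding has_deg_def
  by (metis Suc_leI not_le)

lemma has_deg_unique: "has_deg n x \<Longrightarrow> has_deg m x \<Longrightarrow> n = m"
  using has_deg_zero_iff by (meson has_deg_def linorder_neqE_nat)

text \<open>The top derivative of the product is a binomial coefficient times two nonzero elements
  of the kernel: nonzero in a domain of characteristic 0, and killed by one more application of
  \<open>D\<close>.\<close>

lemma has_deg_mult:
  assumes "has_deg n a" "has_deg m b" shows "has_deg (n + m) (a \<otimes> b)"
proof -
  have *: "a \<in> V" "b \<in> V" "(D ^^ Suc n) a = \<zero>" "(D ^^ Suc m) b = \<zero>"
      "(D ^^ n) a \<noteq> \<zero>" "(D ^^ m) b \<noteq> \<zero>"
    using assms unfolding has_deg_def by auto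
  have c: "(D ^^ n) a \<in> V" "(D ^^ m) b \<in> V" using * Dn_closed by auto
  have z: "D ((D ^^ n) a) = \<zero>" "D ((D ^^ m) b) = \<zero>" using * by auto
  note t = Dn_mult_top[OF *(1-4)]
  have "nat_el (n + m choose n) \<noteq> \<zero>" by (rule char0) simp
  then have 1: "(D ^^ (n + m)) (a \<otimes> b) \<noteq> \<zero>"
    unfolding t using * c Vc by (simp add: integral_iff)
  have "D (nat_el (n + m choose n) \<otimes> ((D ^^ n) a \<otimes> (D ^^ m) b)) = \<zero>"
    using c z Vc V_rules by (simp add: D_ker_mult)
  then have "(D ^^ Suc (n + m)) (a \<otimes> b) = \<zero>" using t by simp
  then show ?thesis unfolding has_deg_def using 1 * V_rules by auto
qed

lemma has_deg_pow: "has_deg n a \<Longrightarrow> has_deg (k * n) (a [^] k)"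
proof (induction k)
  case 0
  then show ?case unfolding has_deg_def using V_rules by simp
next
  case (Suc k)
  then have "has_deg (k * n + n) (a [^] k \<otimes> a)" by (intro has_deg_mult) auto
  then show ?case by (simp add: add.commute)
qed

lemma has_deg_D: "has_deg (Suc n) a \<Longrightarrow> has_deg n (D a)"
  unfolding has_deg_def by (auto simp: funpow_swap1 D_closed)

text \<open>Degrees are nonnegative, and those of \<open>u\<close> and \<open>v\<close> add up to
  the degree 0 of \<open>\<one>\<close>.\<close>

lemma unit_ker:
  assumes "u \<in> V" "v \<in> V" "u \<otimes> v = \<one>" shows "D u = \<zero>"
proof -
  have "u \<noteq> \<zero>" "v \<noteq> \<zero>" using assms Vc by auto
  then obtain n m where nm: "has_deg n u" "has_deg m v" using has_deg_ex assms by blast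
  have "has_deg 0 \<one>" unfolding has_deg_def using V_rules by simp
  then have "n + m = 0" using has_deg_mult[OF nm] assms(3) has_deg_unique by metis
  then show ?thesis using nm unfolding has_deg_def by simp
qed

text \<open>By additivity the degree of a factor does not exceed that of a nonzero product; this
  carries nilpotency over to quotients.\<close>

lemma Dn_cancel:
  assumes "a \<in> V" "b \<in> V" "a \<noteq> \<zero>" "(D ^^ n) (a \<otimes> b) = \<zero>" shows "(D ^^ n) b = \<zero>"
proof (cases "b = \<zero>")
  case False
  then obtain k m where k: "has_deg k a" "has_deg m b" using has_deg_ex assms by blast
  then have "k + m < n" using has_deg_zero_iff[OF has_deg_mult[OF k]] assms by blast
  then show ?thesis using has_deg_zero_iff[OF k(2)] by simp
qed simp

lemma pow_ker:
  assumes "x \<in> V" "n > 0" "D (x [^] (n::nat)) = \<zero>" shows "D x = \<zero>"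
proof (cases "x = \<zero>")
  case False
  then obtain k where k: "has_deg k x" using has_deg_ex assms by blast
  then have "n * k < 1" using has_deg_zero_iff[OF has_deg_pow[OF k, of n], of 1] assms by simp
  then have "k = 0" using assms by simp
  then show ?thesis using k unfolding has_deg_def by simp
qed simp

text \<open>For a local slice \<open>s\<close> the element \<open>D s\<close> behaves like a
  constant, and \<open>s\<close> like a variable with that derivative.\<close>

lemma Dn_slice_pow:
  assumes "s \<in> V" "D (D s) = \<zero>"
  shows "(D ^^ n) (s [^] n) = nat_el (fact n) \<otimes> D s [^] n"
proof (induction n)
  case (Suc n)
  have V: "s [^] n \<in> V" "D s \<in> V" "nat_el (Suc n) \<otimes> D s \<in> V" using assms D_closed V_rules by auto
  have ker: "D (nat_el (Suc n) \<otimes> D s) = \<zero>" using V V_rules assms by (simp add: D_ker_mult Vc del: nat_pow_Suc)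
  have "(D ^^ Suc n) (s [^] Suc n) = (D ^^ n) (D (s [^] Suc n))" by (simp add: funpow_swap1)
  also have "D (s [^] Suc n) = (nat_el (Suc n) \<otimes> D s) \<otimes> s [^] n"
    unfolding D_pow[OF assms(1)] using V Vc by (simp add: m_ac)
  also have "(D ^^ n) \<dots> = (nat_el (Suc n) \<otimes> D s) \<otimes> (nat_el (fact n) \<otimes> D s [^] n)"
    unfolding Dn_ker_mult[OF V(3,1) ker] Suc ..
  also have "\<dots> = nat_el (fact (Suc n)) \<otimes> D s [^] Suc n"
  proof -
    have "nat_el (fact (Suc n)) = nat_el (Suc n) \<otimes> nat_el (fact n)"
      using nat_el_mult[of "Suc n" "fact n"] by (simp only: fact_Suc of_nat_id)
    then show ?thesis using V Vc by (simp add: m_ac)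
  qed
  finally show ?case .
qed simp

end

section \<open>Generators of Veronese subrings\<close>

context cring
begin

lemma lin_span_subring:
  assumes Q: "subring Q R" and M: "M \<subseteq> carrier R" "\<one> \<in> M" "\<And>m n. m \<in> M \<Longrightarrow> n \<in> M \<Longrightarrow> m \<otimes> n \<in> M"
  shows "subring (lin_span Q M) R"
proof (rule subringI)
  note Qc = subringE(1)[OF Q]
  note Sc = lin_span_carrier[OF Qc M(1)]
  show "lin_span Q M \<subseteq> carrier R" by (rule Sc)
  show "\<one> \<in> lin_span Q M" by (rule lin_span_base[OF Q M(2,1)])
  show "\<ominus> h \<in> lin_span Q M" if "h \<in> lin_span Q M" for h by (rule lin_span_neg[OF Q M(1) that])
  show "h1 \<oplus> h2 \<in> lin_span Q M" if "h1 \<in> lin_span Q M" "h2 \<in> lin_span Q M" for h1 h2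
    by (rule lin_span_add[OF Qc M(1) that])
  have mono: "m \<otimes> y \<in> lin_span Q M" if m: "m \<in> M" and y: "y \<in> lin_span Q M" for m y
    using y
  proof (induction rule: lin_span.induct)
    case zero
    have "m \<in> carrier R" using m M by blast
    then show ?case using lin_span.zero by simp
  next
    case (step c w v)
    have c: "m \<in> carrier R" "c \<in> carrier R" "w \<in> carrier R" "v \<in> carrier R"
      using m M step Qc Sc by blast+
    have "c \<otimes> (m \<otimes> w) \<oplus> m \<otimes> v \<in> lin_span Q M"
      by (rule lin_span.step) (use step m M in auto)
    moreover have "c \<otimes> (m \<otimes> w) \<oplus> m \<otimes> v = m \<otimes> (c \<otimes> w \<oplus> v)"
      using c by (simp add: r_distr m_ac)
    ultimately show ?case by simp
  qed
  fix h1 h2 assume h: "h1 \<in> lin_span Q M" "h2 \<in> lin_span Q M"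
  have h2c: "h2 \<in> carrier R" using h Sc by blast
  from h(1) show "h1 \<otimes> h2 \<in> lin_span Q M"
  proof (induction rule: lin_span.induct)
    case zero
    then show ?case using h2c lin_span.zero by simp
  next
    case (step c w v)
    have c: "c \<in> carrier R" "w \<in> carrier R" "v \<in> carrier R"
      using M step Qc Sc by blast+
    have "c \<otimes> (w \<otimes> h2) \<oplus> v \<otimes> h2 \<in> lin_span Q M"
      by (rule lin_span_add[OF Qc M(1) lin_span_smult[OF Q M(1) step(1) mono]]) (use step h in auto)
    moreover have "c \<otimes> (w \<otimes> h2) \<oplus> v \<otimes> h2 = (c \<otimes> w \<oplus> v) \<otimes> h2"
      using c h2c by (simp add: l_distr m_assoc)
    ultimately show ?case by simp
  qed
qed

lemma finprod_subring:
  assumes "subring P R" "finite I" "\<And>i. i \<in> I \<Longrightarrow> f i \<in> P"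
  shows "finprod R f I \<in> P"
  using assms(2,3)
proof (induction I)
  case empty then show ?case using subringE(3)[OF assms(1)] by simp
next
  case (insert x I)
  have "f \<in> I \<rightarrow> carrier R" "f x \<in> carrier R" using insert subringE(1)[OF assms(1)] by auto
  then show ?case using insert subringE(6)[OF assms(1)] by (simp add: finprod_insert)
qed

end

text \<open>The base field enters only through its image \<open>F\<close> in \<open>R\<close>, which
  \<open>affine_graded\<close> supplies.\<close>

locale graded_affine_domain = graded_domain R A for R (structure) and A +
  fixes F S
  assumes F: "subfield F R" and finS: "finite S" and S_carrier: "S \<subseteq> carrier R"
    and gen: "carrier R = generate_ring R (F \<union> S)"
    and char0: "n > 0 \<Longrightarrow> nat_el n \<noteq> \<zero>"
begin

lemmas F_subring = subfieldE(1)[OF F]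
lemmas F_rules = subringE(2,3,5,6,7)[OF F_subring] nat_el_subring[OF F_subring]

lemma F_A: "c \<in> F \<Longrightarrow> c \<in> A 0"
  using subfield_degree_zero[OF F] by blast

lemma F_carrier: "c \<in> F \<Longrightarrow> c \<in> carrier R" using F_A A_carrier by blast

lemma F_V: "F \<subseteq> V d" using A_V[OF F_A] by auto

lemma F_inverse:
  assumes "c \<in> F" "c \<noteq> \<zero>" obtains u where "u \<in> F" "u \<otimes> c = \<one>" "c \<otimes> u = \<one>"
proof -
  have "c \<in> Units (R\<lparr>carrier := F\<rparr>)" using assms subfield.subfield_Units[OF F] by auto
  then show ?thesis using that by (auto simp: Units_def)
qed

lemma noeth_carrier: "noeth (carrier R)"
  using noeth_fin_gen[OF F finS S_carrier] gen by simp

definition homS :: "'a set"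
  where "homS = (\<Union>s\<in>S. hcomp s ` {n. hcomp s n \<noteq> \<zero>})"

lemma finite_homS: "finite homS"
  unfolding homS_def using finS S_carrier hcomp_finite by auto

lemma homS_hom: "s \<in> homS \<Longrightarrow> \<exists>i. s \<in> A i"
  unfolding homS_def using S_carrier hcomp_A by blast

lemma homS_carrier: "homS \<subseteq> carrier R" using homS_hom A_carrier by blast

lemma gen_homS: "carrier R = generate_ring R (F \<union> homS)"
proof
  have c: "F \<union> homS \<subseteq> carrier R" using homS_carrier F_carrier by auto
  have sub: "subring (generate_ring R (F \<union> homS)) R" by (rule generate_ring_is_subring[OF c])
  show "generate_ring R (F \<union> homS) \<subseteq> carrier R" by (rule subringE(1)[OF sub])
  have "s \<in> generate_ring R (F \<union> homS)" if s: "s \<in> S" for s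
  proof -
    have sc: "s \<in> carrier R" using s S_carrier by auto
    have "hcomp s n \<in> generate_ring R (F \<union> homS)" if "hcomp s n \<noteq> \<zero>" for n
      by (rule generate_ring.incl) (use s that homS_def in auto)
    moreover have "x \<in> generate_ring R (F \<union> homS)"
      if "x \<in> carrier R" "\<And>n. hcomp x n \<noteq> \<zero> \<Longrightarrow> hcomp x n \<in> generate_ring R (F \<union> homS)" for x
      by (rule hom_induct[OF that(1)]) (use that(2) subringE(2,7)[OF sub] in auto)
    ultimately show ?thesis using sc by blast
  qed
  then have "generate_ring R (F \<union> S) \<subseteq> generate_ring R (F \<union> homS)"
    by (intro generate_ring_min_subring1[OF _ sub]) (use S_carrier F_carrier in \<open>auto intro: generate_ring.incl\<close>)
  then show "carrier R \<subseteq> generate_ring R (F \<union> homS)" using gen by simp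
qed

section \<open>Monomials in homogeneous generators\<close>

definition monomial :: "('a \<Rightarrow> nat) \<Rightarrow> 'a"
  where "monomial e = finprod R (\<lambda>s. s [^] e s) homS"

definition hdeg :: "'a \<Rightarrow> int" where "hdeg s = (SOME i. s \<in> A i)"

lemma hdeg: "s \<in> homS \<Longrightarrow> s \<in> A (hdeg s)"
  unfolding hdeg_def using homS_hom by (rule someI_ex)

lemma monomial_closed [simp]: "monomial e \<in> carrier R"
  unfolding monomial_def by (rule finprod_closed) (use homS_carrier in auto)

lemma finprod_A:
  assumes "finite I" "\<And>i. i \<in> I \<Longrightarrow> f i \<in> A (g i)"
  shows "finprod R f I \<in> A (\<Sum>i\<in>I. g i)"
  using assms
proof (induction I)
  case empty then show ?case using one_A by simp
next
  case (insert x I)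
  have "f \<in> I \<rightarrow> carrier R" "f x \<in> carrier R" using insert A_carrier by auto
  then show ?case using insert component_mult by (simp add: finprod_insert)
qed

lemma monomial_A: "monomial e \<in> A (\<Sum>s\<in>homS. int (e s) * hdeg s)"
  unfolding monomial_def by (rule finprod_A[OF finite_homS]) (use A_pow hdeg in blast)

lemma monomial_mult: "monomial e \<otimes> monomial e' = monomial (\<lambda>s. e s + e' s)"
proof -
  have "monomial (\<lambda>s. e s + e' s) = finprod R (\<lambda>s. s [^] e s \<otimes> s [^] e' s) homS"
    unfolding monomial_def by (rule finprod_cong') (use homS_carrier in \<open>auto simp: nat_pow_mult\<close>)
  also have "\<dots> = monomial e \<otimes> monomial e'"
    unfolding monomial_def by (rule finprod_multf) (use homS_carrier in auto)
  finally show ?thesis by simp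
qed

lemma monomial_gen: "s \<in> homS \<Longrightarrow> monomial (\<lambda>t. if t = s then 1 else 0) = s"
proof -
  assume s: "s \<in> homS"
  have "monomial (\<lambda>t. if t = s then 1 else 0) = finprod R (\<lambda>t. if s = t then t else \<one>) homS"
    unfolding monomial_def by (rule finprod_cong') (use homS_carrier in auto)
  also have "\<dots> = s" by (rule finprod_singleton) (use s finite_homS homS_carrier in auto)
  finally show ?thesis .
qed

lemma carrier_span: "carrier R = lin_span F (range monomial)"
proof
  have one: "\<one> = monomial (\<lambda>_. 0)"
    unfolding monomial_def by (simp add: finprod_one_eqI)
  have sub: "subring (lin_span F (range monomial)) R"
  proof (rule lin_span_subring[OF F_subring])
    show "\<one> \<in> range monomial" unfolding one by blast
  qed (auto simp: monomial_mult)
  show "lin_span F (range monomial) \<subseteq> carrier R" by (rule subringE(1)[OF sub])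
  have "F \<union> homS \<subseteq> lin_span F (range monomial)"
  proof
    fix x assume x: "x \<in> F \<union> homS"
    show "x \<in> lin_span F (range monomial)"
    proof (cases "x \<in> F")
      case True
      have "x \<otimes> monomial (\<lambda>_. 0) \<oplus> \<zero> \<in> lin_span F (range monomial)"
        by (rule lin_span.step) (use True lin_span.zero in auto)
      then show ?thesis using F_carrier[OF True] one[symmetric] by simp
    next
      case False
      then have "x \<in> range monomial" using x monomial_gen by (metis UnE rangeI)
      then show ?thesis by (rule lin_span_base[OF F_subring]) auto
    qed
  qed
  then show "carrier R \<subseteq> lin_span F (range monomial)"
    unfolding gen_homS using homS_carrier F_carrier by (intro generate_ring_min_subring1[OF _ sub]) auto
qed

text \<open>Dividing all exponents by \<open>d\<close> with remainder splits a monomial of degree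
  divisible by \<open>d\<close> into \<open>d\<close>-th powers of generators and a monomial with
  exponents below \<open>d\<close>, whose degree is again divisible by \<open>d\<close>. Only
  finitely many factors of either kind exist.\<close>

lemma veronese_fin_gen:
  assumes d: "d > 0"
  obtains T where "finite T" "\<And>t. t \<in> T \<Longrightarrow> \<exists>i. t \<in> A i \<and> int d dvd i" "V d = generate_ring R (F \<union> T)"
proof -
  define E where "E = {e \<in> homS \<rightarrow>\<^sub>E {..<d}. int d dvd (\<Sum>s\<in>homS. int (e s) * hdeg s)}"
  define T where "T = (\<lambda>s. s [^] d) ` homS \<union> monomial ` E"
  have finE: "finite E" unfolding E_def using finite_PiE[OF finite_homS, of "\<lambda>_. {..<d}"] by simp
  have T: "\<exists>i. t \<in> A i \<and> int d dvd i" if tT: "t \<in> T" for t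
  proof (cases "t \<in> monomial ` E")
    case True
    then show ?thesis using monomial_A unfolding E_def by blast
  next
    case False
    then obtain s where "s \<in> homS" "t = s [^] d" using tT unfolding T_def by blast
    then have "t \<in> A (int d * hdeg s)" using A_pow hdeg by blast
    then show ?thesis by (meson dvd_triv_left)
  qed
  have Tc: "F \<union> T \<subseteq> carrier R" using T A_carrier F_carrier by blast
  let ?G = "generate_ring R (F \<union> T)"
  have G: "subring ?G R" by (rule generate_ring_is_subring[OF Tc])
  have mG: "monomial e \<in> ?G" if e: "int d dvd (\<Sum>s\<in>homS. int (e s) * hdeg s)" for e
  proof -
    define r where "r = restrict (\<lambda>s. e s mod d) homS"
    have "(\<Sum>s\<in>homS. int (e s) * hdeg s)
        = (\<Sum>s\<in>homS. int d * (int (e s div d) * hdeg s) + int (r s) * hdeg s)"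
    proof (rule sum.cong)
      fix s assume "s \<in> homS"
      have "int (e s) = int d * int (e s div d) + int (e s mod d)"
        by (metis mult_div_mod_eq of_nat_add of_nat_mult)
      then show "int (e s) * hdeg s = int d * (int (e s div d) * hdeg s) + int (r s) * hdeg s"
        using \<open>s \<in> homS\<close> by (simp add: r_def algebra_simps)
    qed simp
    also have "\<dots> = int d * (\<Sum>s\<in>homS. int (e s div d) * hdeg s) + (\<Sum>s\<in>homS. int (r s) * hdeg s)"
      by (simp add: sum.distrib sum_distrib_left)
    finally have "int d dvd (\<Sum>s\<in>homS. int (r s) * hdeg s)"
      using e by (simp add: dvd_add_right_iff)
    moreover have "r \<in> homS \<rightarrow>\<^sub>E {..<d}" unfolding r_def using d by auto
    ultimately have "r \<in> E" unfolding E_def by simp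
    then have rG: "monomial r \<in> ?G" unfolding T_def by (auto intro: generate_ring.incl)
    have "finprod R (\<lambda>s. (s [^] d) [^] (e s div d)) homS \<in> ?G"
      by (rule finprod_subring[OF G finite_homS])
        (rule pow_subring[OF G], rule generate_ring.incl, simp add: T_def)
    moreover have "finprod R (\<lambda>s. (s [^] d) [^] (e s div d)) homS = monomial (\<lambda>s. d * (e s div d))"
      unfolding monomial_def by (rule finprod_cong') (use homS_carrier in \<open>auto simp: nat_pow_pow\<close>)
    moreover have "monomial (\<lambda>s. d * (e s div d) + r s) = monomial e"
      unfolding monomial_def by (rule finprod_cong') (use homS_carrier in \<open>auto simp: r_def\<close>)
    ultimately show ?thesis using rG subringE(6)[OF G, of "monomial (\<lambda>s. d * (e s div d))" "monomial r"]
      by (simp add: monomial_mult)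
  qed
  \<comment> \<open>Taking the component of degree \<open>i\<close> keeps or kills a scalar multiple
    of a monomial, so only monomials of degree divisible by \<open>d\<close> contribute.\<close>
  have comp: "hcomp x i \<in> ?G" if "x \<in> lin_span F (range monomial)" "int d dvd i" for x i
    using that(1)
  proof (induction rule: lin_span.induct)
    case zero then show ?case using subringE(2)[OF G] by simp
  next
    case (step c w v)
    then obtain e where w: "w = monomial e" by auto
    have vc: "v \<in> carrier R" using step carrier_span by simp
    let ?j = "\<Sum>s\<in>homS. int (e s) * hdeg s"
    have cw: "c \<otimes> w \<in> A ?j" using component_mult[OF F_A[OF step(1)] monomial_A[of e]] w by simp
    have "hcomp (c \<otimes> w) i \<in> ?G"
    proof (cases "i = ?j")
      case True
      then have "monomial e \<in> ?G" using mG that(2) by simp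
      moreover have "c \<in> ?G" using step by (auto intro: generate_ring.incl)
      ultimately show ?thesis using hcomp_hom[OF cw, of i] True subringE(6)[OF G] w by simp
    next
      case False
      then show ?thesis using hcomp_hom[OF cw, of i] subringE(2)[OF G] by simp
    qed
    then show ?case using step.IH subringE(7)[OF G] hcomp_add[OF A_carrier[OF cw] vc] by simp
  qed
  have "V d = ?G"
  proof
    have "T \<subseteq> V d" using T A_V by blast
    then show "?G \<subseteq> V d" using generate_ring_min_subring1[OF Tc veronese_subring] F_V by blast
    show "V d \<subseteq> ?G"
    proof
      fix x assume x: "x \<in> V d"
      show "x \<in> ?G"
      proof (rule hom_induct[OF V_carrier[OF x]])
        fix n assume n: "hcomp x n \<noteq> \<zero>"
        then have "int d dvd n" using x by (auto simp: V_def)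
        then show "hcomp x n \<in> ?G" using comp V_carrier[OF x] carrier_span by auto
      qed (use subringE(2,7)[OF G] in auto)
    qed
  qed
  moreover have "finite T" unfolding T_def using finE finite_homS by simp
  ultimately show ?thesis using T that by blast
qed

end

section \<open>Homogeneous locally nilpotent derivations\<close>

context graded_affine_domain
begin

lemma not_rigid_iff:
  "\<not> rigid (veronese R A d) \<longleftrightarrow> (\<exists>D. lnd R (V d) D \<and> (\<exists>x\<in>V d. D x \<noteq> \<zero>))"
proof -
  have sum: "derivation (R\<lparr>carrier := V d\<rparr>) D \<and> locally_nilpotent (R\<lparr>carrier := V d\<rparr>) D \<longleftrightarrow> lnd R (V d) D" for D
  proof
    assume l: "derivation (R\<lparr>carrier := V d\<rparr>) D \<and> locally_nilpotent (R\<lparr>carrier := V d\<rparr>) D"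
    show "lnd R (V d) D"
    proof (intro lnd.intro lnd_axioms.intro domain_axioms veronese_subring char0)
    qed (use l in \<open>auto simp: derivation_def locally_nilpotent_def\<close>)
  next
    assume "lnd R (V d) D"
    then interpret lnd R "V d" D .
    \<comment> \<open>Local nilpotency of the ring asks for a positive exponent while
      \<open>lnd\<close> admits 0; one further application of \<open>D\<close> bridges the
      gap.\<close>
    have "\<exists>n>0. (D ^^ n) b = \<zero>" if b: "b \<in> V d" for b
    proof -
      obtain n where n: "(D ^^ n) b = \<zero>" using D_nilp[OF b] by blast
      have "(D ^^ Suc n) b = \<zero>" using n by simp
      then show ?thesis by blast
    qed
    then show "derivation (R\<lparr>carrier := V d\<rparr>) D \<and> locally_nilpotent (R\<lparr>carrier := V d\<rparr>) D"
      using D_closed D_add D_mult by (auto simp: derivation_def locally_nilpotent_def)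
  qed
  show ?thesis unfolding rigid_def veronese_V sum by auto
qed

text \<open>Linearity over the base field is not assumed of derivations; local nilpotency forces it,
  because nonzero scalars are units.\<close>

lemma lnd_scalar:
  assumes "lnd R (V d) D" "c \<in> F" shows "D c = \<zero>"
proof -
  interpret lnd R "V d" D by fact
  show ?thesis
  proof (cases "c = \<zero>")
    case False
    then obtain u where "u \<in> F" "c \<otimes> u = \<one>" using F_inverse[OF assms(2)] by blast
    then show ?thesis using unit_ker assms(2) F_V by blast
  qed simp
qed

definition hom_lnd :: "nat \<Rightarrow> int \<Rightarrow> ('a \<Rightarrow> 'a) \<Rightarrow> bool"
  where "hom_lnd d \<delta> D \<longleftrightarrow> lnd R (V d) D \<and> int d dvd \<delta> \<and>
    (\<forall>i x. x \<in> A i \<longrightarrow> int d dvd i \<longrightarrow> D x \<in> A (i + \<delta>))"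

definition hom_nonrigid :: "nat \<Rightarrow> bool"
  where "hom_nonrigid d \<longleftrightarrow> (\<exists>\<delta> D. hom_lnd d \<delta> D \<and> (\<exists>i x. x \<in> A i \<and> int d dvd i \<and> D x \<noteq> \<zero>))"

lemma V_supp: "x \<in> V d \<Longrightarrow> hcomp x i \<noteq> \<zero> \<Longrightarrow> int d dvd i"
  by (auto simp: V_def)

text \<open>Both the leading component of a derivation and the quotient by
  \<open>p x [^] (p - 1)\<close> are specified on homogeneous elements only. Extending additively
  preserves the Leibniz rule, which is bilinear, and local nilpotency, since an element has finitely
  many components.\<close>

lemma extend_hom:
  assumes d\<delta>: "int d dvd \<delta>"
    and E_A: "\<And>i x. x \<in> A i \<Longrightarrow> int d dvd i \<Longrightarrow> E x \<in> A (i + \<delta>)"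
    and E_add: "\<And>i x y. x \<in> A i \<Longrightarrow> y \<in> A i \<Longrightarrow> int d dvd i \<Longrightarrow> E (x \<oplus> y) = E x \<oplus> E y"
    and E_mult: "\<And>i j x y. x \<in> A i \<Longrightarrow> y \<in> A j \<Longrightarrow> int d dvd i \<Longrightarrow> int d dvd j \<Longrightarrow>
      E (x \<otimes> y) = E x \<otimes> y \<oplus> x \<otimes> E y"
    and E_nilp: "\<And>i x. x \<in> A i \<Longrightarrow> int d dvd i \<Longrightarrow> \<exists>n. (E ^^ n) x = \<zero>"
  obtains D where "hom_lnd d \<delta> D" "\<And>i x. x \<in> A i \<Longrightarrow> int d dvd i \<Longrightarrow> D x = E x"
proof -
  define D where "D x = finsum R (\<lambda>i. E (hcomp x i)) {i. hcomp x i \<noteq> \<zero>}" for x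
  have E0: "E \<zero> = \<zero>"
  proof -
    have "E \<zero> \<in> carrier R" using E_A[of \<zero> 0] A_carrier by simp
    moreover have "E \<zero> \<oplus> E \<zero> = E \<zero>" using E_add[of \<zero> 0 \<zero>] by simp
    ultimately show ?thesis using add.l_cancel[of "E \<zero>" "E \<zero>" \<zero>] by simp
  qed
  have EV: "E x \<in> V d" if "x \<in> A i" "int d dvd i" for x i
    using E_A[OF that] A_V d\<delta> that(2) by (meson dvd_add)
  have Ec: "E (hcomp x i) \<in> V d" if "x \<in> V d" for x i
  proof (cases "int d dvd i")
    case True
    show ?thesis by (rule EV[OF hcomp_A[OF V_carrier[OF that]] True])
  next
    case False then show ?thesis using that E0 by (simp add: V_def)
  qed
  have DT: "D x = finsum R (\<lambda>i. E (hcomp x i)) T"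
    if "x \<in> V d" "finite T" "\<And>n. n \<notin> T \<Longrightarrow> hcomp x n = \<zero>" for x T
    unfolding D_def
  proof (rule finsum_neutral[OF that(2)])
    show "{i. hcomp x i \<noteq> \<zero>} \<subseteq> T" using that(3) by blast
    show "E (hcomp x n) = \<zero>" if "n \<in> T - {i. hcomp x i \<noteq> \<zero>}" for n using that E0 by simp
    show "E (hcomp x n) \<in> carrier R" for n using Ec[OF that(1)] V_carrier by blast
  qed
  have D_hom: "D x = E x" if "x \<in> A i" "int d dvd i" for x i
  proof -
    have "D x = finsum R (\<lambda>j. E (hcomp x j)) {i}"
      by (rule DT) (use A_V[OF that] hcomp_hom[OF that(1)] in auto)
    then show ?thesis using hcomp_hom[OF that(1)] A_carrier[OF E_A[OF that]] by simp
  qed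
  have D_closed: "D x \<in> V d" if "x \<in> V d" for x
  proof -
    have "finsum R (\<lambda>i. E (hcomp x i)) T \<in> V d" if "finite T" for T
      using that
    proof (induction T)
      case (insert i T)
      have "(\<lambda>i. E (hcomp x i)) \<in> T \<rightarrow> carrier R" "E (hcomp x i) \<in> carrier R"
        using Ec[OF \<open>x \<in> V d\<close>] V_carrier by auto
      then show ?case using insert Ec[OF \<open>x \<in> V d\<close>] V_add by simp
    qed simp
    then show ?thesis unfolding D_def using hcomp_finite[OF V_carrier[OF that]] by blast
  qed
  have D_add: "D (x \<oplus> y) = D x \<oplus> D y" if xy: "x \<in> V d" "y \<in> V d" for x y
  proof -
    let ?T = "{i. hcomp x i \<noteq> \<zero>} \<union> {i. hcomp y i \<noteq> \<zero>}"
    have c: "x \<in> carrier R" "y \<in> carrier R" using xy V_carrier by auto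
    have f: "finite ?T" using hcomp_finite c by simp
    have "D (x \<oplus> y) = finsum R (\<lambda>i. E (hcomp (x \<oplus> y) i)) ?T"
      by (rule DT[OF V_add[OF xy] f]) (use c in \<open>simp add: hcomp_add\<close>)
    also have "\<dots> = finsum R (\<lambda>i. E (hcomp x i) \<oplus> E (hcomp y i)) ?T"
    proof (rule finsum_cong')
      fix i assume "i \<in> ?T"
      then have "int d dvd i" using xy V_supp by blast
      then show "E (hcomp (x \<oplus> y) i) = E (hcomp x i) \<oplus> E (hcomp y i)"
        using E_add[of "hcomp x i" i "hcomp y i"] c by (simp add: hcomp_add)
    qed (use Ec[OF xy(1)] Ec[OF xy(2)] V_carrier in blast)+
    also have "\<dots> = finsum R (\<lambda>i. E (hcomp x i)) ?T \<oplus> finsum R (\<lambda>i. E (hcomp y i)) ?T"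
      by (rule finsum_addf) (use Ec xy V_carrier in auto)
    also have "finsum R (\<lambda>i. E (hcomp x i)) ?T = D x"
      by (rule DT[symmetric]) (use xy f in auto)
    also have "finsum R (\<lambda>i. E (hcomp y i)) ?T = D y"
      by (rule DT[symmetric]) (use xy f in auto)
    finally show ?thesis .
  qed
  have D_mult1: "D (x \<otimes> y) = D x \<otimes> y \<oplus> x \<otimes> D y"
    if x: "x \<in> A i" "int d dvd i" and y: "y \<in> V d" for x y i
    using y
  proof (induction rule: V_induct)
    case (hom n y)
    then show ?case using x D_hom[OF component_mult[OF x(1) hom(1)]] by (simp add: D_hom E_mult)
  next
    case (add a b)
    note xV = A_V[OF x]
    have c: "x \<in> carrier R" "a \<in> carrier R" "b \<in> carrier R" "D x \<in> carrier R" "D a \<in> carrier R"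
       "D b \<in> carrier R" using x add xV D_closed V_carrier by auto
    have "D (x \<otimes> (a \<oplus> b)) = D (x \<otimes> a) \<oplus> D (x \<otimes> b)"
      using c add xV by (simp add: r_distr D_add V_mult)
    then show ?case using add c by (simp add: D_add r_distr a_ac)
  qed
  have D_mult: "D (x \<otimes> y) = D x \<otimes> y \<oplus> x \<otimes> D y" if x: "x \<in> V d" and y: "y \<in> V d" for x y
    using x
  proof (induction rule: V_induct)
    case (hom n x)
    then show ?case using D_mult1 y by blast
  next
    case (add a b)
    have c: "y \<in> carrier R" "a \<in> carrier R" "b \<in> carrier R" "D y \<in> carrier R" "D a \<in> carrier R"
       "D b \<in> carrier R" using y add D_closed V_carrier by auto
    have "D ((a \<oplus> b) \<otimes> y) = D (a \<otimes> y) \<oplus> D (b \<otimes> y)"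
      using c add y by (simp add: l_distr D_add V_mult)
    then show ?case using add c by (simp add: D_add l_distr a_ac)
  qed
  have D0: "D \<zero> = \<zero>" using D_hom[of \<zero> 0] E0 by simp
  have Dn0: "(D ^^ n) \<zero> = \<zero>" for n by (induction n) (auto simp: D0)
  have Dn_V: "(D ^^ n) x \<in> V d" if "x \<in> V d" for x n by (induction n) (auto simp: that D_closed)
  have Dn_add: "(D ^^ n) (x \<oplus> y) = (D ^^ n) x \<oplus> (D ^^ n) y" if "x \<in> V d" "y \<in> V d" for x y n
    by (induction n) (auto simp: that D_add Dn_V)
  have Dn_hom: "(D ^^ n) x = (E ^^ n) x \<and> (E ^^ n) x \<in> A (i + int n * \<delta>)"
    if "x \<in> A i" "int d dvd i" for x i n
  proof (induction n)
    case (Suc n)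
    have dv: "int d dvd i + int n * \<delta>" using that d\<delta> by simp
    have eq: "i + int (Suc n) * \<delta> = i + int n * \<delta> + \<delta>" by (simp add: algebra_simps)
    show ?case unfolding eq using Suc D_hom[OF _ dv, of "(E ^^ n) x"] E_A[OF _ dv, of "(E ^^ n) x"] by simp
  qed (use that in simp)
  have D_nilp: "\<exists>n. (D ^^ n) x = \<zero>" if "x \<in> V d" for x
    using that
  proof (induction rule: V_induct)
    case (hom n x)
    then show ?case using E_nilp Dn_hom by metis
  next
    case (add a b)
    then obtain n m where nm: "(D ^^ n) a = \<zero>" "(D ^^ m) b = \<zero>" by blast
    have "(D ^^ (m + n)) a = \<zero>" unfolding funpow_add using nm Dn0 by simp
    moreover have "(D ^^ (n + m)) b = \<zero>" unfolding funpow_add using nm Dn0 by simp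
    ultimately have "(D ^^ (n + m)) (a \<oplus> b) = \<zero>" using Dn_add add by (simp add: add.commute)
    then show ?case by blast
  qed
  have "lnd R (V d) D"
  proof (intro lnd.intro lnd_axioms.intro domain_axioms veronese_subring char0)
  qed (use D_closed D_add D_mult D_nilp in auto)
  then have "hom_lnd d \<delta> D" unfolding hom_lnd_def using d\<delta> D_hom E_A by simp
  then show ?thesis using D_hom that by blast
qed

lemma degree_unique: "x \<in> A i \<Longrightarrow> x \<in> A j \<Longrightarrow> x \<noteq> \<zero> \<Longrightarrow> i = j"
  using hcomp_hom[of x i j] hcomp_hom[of x j j] by (metis (full_types))

text \<open>The homogeneous component of highest degree of a locally nilpotent derivation is again locally
  nilpotent; it exists because the ring is finitely generated.\<close>

lemma nonrigid_hom:
  assumes d: "d > 0" and "lnd R (V d) D" and nz: "\<exists>x\<in>V d. D x \<noteq> \<zero>"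
  shows "hom_nonrigid d"
proof -
  interpret lnd R "V d" D by fact
  note DF = lnd_scalar[OF assms(2)]
  obtain T where T: "finite T" "\<And>t. t \<in> T \<Longrightarrow> \<exists>i. t \<in> A i \<and> int d dvd i" "V d = generate_ring R (F \<union> T)"
    by (rule veronese_fin_gen[OF d]) (rule that)
  \<comment> \<open>On each component of \<open>x\<close> the derivation raises degrees by at most
    \<open>N\<close>. This property survives the ring operations, so a common bound for finitely
    many generators serves all of \<open>V d\<close>.\<close>
  define P where "P N x \<longleftrightarrow> (\<forall>i n. n > N \<longrightarrow> hcomp (D (hcomp x i)) (i + n) = \<zero>)" for N x
  have Dc: "D x \<in> carrier R" if "x \<in> V d" for x using that D_closed V_carrier by blast
  have P_hom: "P N x \<longleftrightarrow> (\<forall>n>N. hcomp (D x) (i + n) = \<zero>)" if "x \<in> A i" for N x i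
    unfolding P_def using hcomp_hom[OF that] by auto
  have P_comp: "P N (hcomp x i)" if "P N x" "x \<in> V d" for N x i
    using that P_hom[OF hcomp_A[OF V_carrier[OF that(2)]]] unfolding P_def by blast
  have P_add: "P N (x \<oplus> y)" if "P N x" "P N y" "x \<in> V d" "y \<in> V d" for N x y
  proof -
    have "hcomp (D (hcomp (x \<oplus> y) i)) (i + n)
        = hcomp (D (hcomp x i)) (i + n) \<oplus> hcomp (D (hcomp y i)) (i + n)" for i n
      using that by (simp add: hcomp_add D_add V_carrier hcomp_V Dc)
    then show ?thesis using that unfolding P_def by simp
  qed
  have P_zero: "P N \<zero>" for N unfolding P_def by simp
  have P_multh: "P N (x \<otimes> y)"
    if "P N x" "P N y" and x: "x \<in> A i" "int d dvd i" and y: "y \<in> A j" "int d dvd j" for N x y i j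
  proof -
    note V = A_V[OF x] A_V[OF y]
    note c = V_carrier[OF V(1)] V_carrier[OF V(2)]
    have "hcomp (D (x \<otimes> y)) (i + j + n) = \<zero>" if n: "n > N" for n
    proof -
      have "hcomp (D (x \<otimes> y)) (i + j + n)
          = hcomp (y \<otimes> D x) (i + j + n) \<oplus> hcomp (x \<otimes> D y) (i + j + n)"
        using V c Dc by (simp add: D_mult hcomp_add m_comm)
      also have "\<dots> = y \<otimes> hcomp (D x) (i + n) \<oplus> x \<otimes> hcomp (D y) (j + n)"
        using hcomp_mult[OF y(1) Dc[OF V(1)], of "i + j + n"] hcomp_mult[OF x(1) Dc[OF V(2)], of "i + j + n"]
        by (simp add: algebra_simps)
      also have "\<dots> = \<zero>"
        using \<open>P N x\<close> \<open>P N y\<close> P_hom[OF x(1)] P_hom[OF y(1)] n c by simp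
      finally show ?thesis .
    qed
    then show ?thesis using P_hom[OF component_mult[OF x(1) y(1)]] by blast
  qed
  have P_mult: "P N (x \<otimes> y)" if x: "P N x" "x \<in> V d" and y: "P N y" "y \<in> V d" for N x y
  proof -
    note c = V_carrier[OF x(2)] V_carrier[OF y(2)]
    have 1: "P N (hcomp x i \<otimes> y)" if i: "hcomp x i \<noteq> \<zero>" for i
    proof -
      have di: "int d dvd i" using V_supp[OF x(2) i] .
      have "y \<in> carrier R \<Longrightarrow> y \<in> V d \<and> P N (hcomp x i \<otimes> y)"
      proof (induction rule: hom_induct)
        case zero
        then show ?case using P_zero c by simp
      next
        case (hom n)
        then have "int d dvd n" using V_supp[OF y(2)] by blast
        then show ?case
          using P_multh[OF P_comp[OF x] P_comp[OF y] hcomp_A[OF c(1)] di hcomp_A[OF c(2)]] hcomp_V[OF y(2)]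
          by blast
      next
        case (add a b)
        have "P N (hcomp x i \<otimes> a \<oplus> hcomp x i \<otimes> b)"
          by (rule P_add) (use add hcomp_V[OF x(2)] V_mult in auto)
        then show ?case using add V_add c by (simp add: r_distr)
      qed
      then show ?thesis using c by blast
    qed
    have "x \<in> V d \<and> P N (x \<otimes> y)"
      using c(1)
    proof (induction rule: hom_induct)
      case zero
      then show ?case using P_zero c by simp
    next
      case (hom n)
      then show ?case using 1 hcomp_V[OF x(2)] by blast
    next
      case (add a b)
      have "P N (a \<otimes> y \<oplus> b \<otimes> y)"
        by (rule P_add) (use add y V_mult in auto)
      then show ?case using add V_add c by (simp add: l_distr)
    qed
    then show ?thesis by blast
  qed
  have P_neg: "P N (\<ominus> x)" if x: "P N x" "x \<in> V d" for N x
  proof -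
    have m: "\<ominus> \<one> \<in> F" using F_rules by blast
    then have "P N (\<ominus> \<one>)" using P_hom[OF F_A[OF m]] DF by simp
    then have "P N (\<ominus> \<one> \<otimes> x)" using P_mult x F_V m by blast
    then show ?thesis using V_carrier[OF x(2)] by (simp add: l_minus)
  qed
  have "\<exists>N. P N t" if t: "t \<in> T" for t
  proof -
    obtain i where i: "t \<in> A i" "int d dvd i" using T(2)[OF t] by blast
    have "finite {n. hcomp (D t) n \<noteq> \<zero>}" using hcomp_finite Dc A_V[OF i] by blast
    then obtain M where M: "\<And>n. hcomp (D t) n \<noteq> \<zero> \<Longrightarrow> n \<le> M"
      using bdd_above_finite[of "{n. hcomp (D t) n \<noteq> \<zero>}"] unfolding bdd_above_def by blast
    have "P (M - i) t" unfolding P_hom[OF i(1)] using M by force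
    then show ?thesis by blast
  qed
  then obtain N where N: "\<And>t. t \<in> T \<Longrightarrow> P (N t) t" by metis
  define M where "M = Max (insert 0 (N ` T))"
  have PT: "P M t" if "t \<in> T" for t
  proof -
    have "N t \<le> M" unfolding M_def using T(1) that by simp
    then show ?thesis using N[OF that] unfolding P_def by auto
  qed
  have "x \<in> V d \<and> P M x" if "x \<in> generate_ring R (F \<union> T)" for x
    using that
  proof (induction rule: generate_ring.induct)
    case one
    then show ?case using P_hom[OF one_A] V_rules by simp
  next
    case (incl h)
    then show ?case
    proof
      assume "h \<in> F"
      then show ?thesis using P_hom[OF F_A, of h] DF F_V[of d] by auto
    next
      assume "h \<in> T"
      then show ?thesis using PT T(2) A_V by blast
    qed
  next
    case (a_inv h) then show ?case using P_neg V_rules by blast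
  next
    case (eng_add h1 h2) then show ?case using P_add V_add by blast
  next
    case (eng_mult h1 h2) then show ?case using P_mult V_mult by blast
  qed
  then have PV: "P M x" if "x \<in> V d" for x using T(3) that by blast
  define Ns where "Ns = {n. \<exists>i x. x \<in> A i \<and> int d dvd i \<and> hcomp (D x) (i + n) \<noteq> \<zero>}"
  have Ns_le: "n \<le> M" if n: "n \<in> Ns" for n
  proof (rule ccontr)
    assume "\<not> n \<le> M"
    obtain i x where x: "x \<in> A i" "int d dvd i" "hcomp (D x) (i + n) \<noteq> \<zero>" using n Ns_def by blast
    then show False using PV[OF A_V[OF x(1,2)]] P_hom[OF x(1)] \<open>\<not> n \<le> M\<close> by auto
  qed
  have "Ns \<noteq> {}"
  proof
    assume e: "Ns = {}"
    have "D x = \<zero>" if "x \<in> V d" for x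
      using that
    proof (induction rule: V_induct)
      case (hom n x)
      have "hcomp (D x) m = \<zero>" for m
      proof -
        have "m - n \<notin> Ns" using e by simp
        then show ?thesis using hom unfolding Ns_def by fastforce
      qed
      then show ?case using nonzero_comp Dc A_V hom by metis
    next
      case (add a b) then show ?case by (simp add: D_add)
    qed
    then show False using nz by blast
  qed
  then obtain n0 where n0: "n0 \<in> Ns" by blast
  \<comment> \<open>\<open>Ns\<close> is known to be bounded from above only, so the maximum is
    taken over the part from \<open>n0\<close> on.\<close>
  define \<delta> where "\<delta> = Max {n \<in> Ns. n0 \<le> n}"
  have fin: "finite {n \<in> Ns. n0 \<le> n}"
    by (rule finite_subset[of _ "{n0..M}"]) (use Ns_le in auto)
  have \<delta>: "\<delta> \<in> Ns" using Max_in[OF fin] n0 unfolding \<delta>_def by blast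
  have \<delta>_max: "n \<le> \<delta>" if "n \<in> Ns" for n
  proof (cases "n0 \<le> n")
    case True then show ?thesis unfolding \<delta>_def using that fin by auto
  next
    case False
    moreover have "n0 \<le> \<delta>" unfolding \<delta>_def using n0 fin by auto
    ultimately show ?thesis by simp
  qed
  have high: "hcomp (D x) m = \<zero>" if "x \<in> A i" "int d dvd i" "m > i + \<delta>" for x i m
  proof -
    have "m - i \<notin> Ns" using \<delta>_max that by force
    then show ?thesis using that unfolding Ns_def by fastforce
  qed
  \<comment> \<open>For \<open>\<zero>\<close> the chosen degree is arbitrary, but
    \<open>E \<zero>\<close> is \<open>\<zero>\<close> in any case.\<close>
  define dg where "dg x = (SOME i. x \<in> A i)" for x
  define E where "E x = hcomp (D x) (dg x + \<delta>)" for x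
  have E: "E x = hcomp (D x) (i + \<delta>)" if "x \<in> A i" for x i
  proof (cases "x = \<zero>")
    case False
    have "x \<in> A (dg x)" unfolding dg_def using that by (rule someI)
    then have "dg x = i" using degree_unique False that by blast
    then show ?thesis by (simp add: E_def)
  qed (simp add: E_def)
  have d\<delta>: "int d dvd \<delta>"
  proof -
    obtain i x where x: "x \<in> A i" "int d dvd i" "hcomp (D x) (i + \<delta>) \<noteq> \<zero>" using \<delta> Ns_def by blast
    then have "int d dvd i + \<delta>" using V_supp D_closed A_V by blast
    then show ?thesis using x(2) dvd_add_right_iff by blast
  qed
  \<comment> \<open>Since \<open>D\<close> raises degrees by at most \<open>\<delta>\<close>, degree
    \<open>t + \<delta>\<close> of \<open>D y\<close> is reached only from the component of
    \<open>y\<close> of degree \<open>t\<close>. Iterating, \<open>(E ^^ n) x\<close> is a component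
    of \<open>(D ^^ n) x\<close>, so nilpotency passes to \<open>E\<close>.\<close>
  have top: "(\<forall>m>t + \<delta>. hcomp (D y) m = \<zero>) \<and> hcomp (D y) (t + \<delta>) = hcomp (D (hcomp y t)) (t + \<delta>)"
    if y: "y \<in> V d" "\<forall>m>t. hcomp y m = \<zero>" for y t
  proof -
    note yc = V_carrier[OF y(1)]
    have "y \<in> V d \<and> (\<forall>m>t + \<delta>. hcomp (D y) m = \<zero>) \<and>
        hcomp (D y) (t + \<delta>) = hcomp (D (hcomp y t)) (t + \<delta>)"
      using yc
    proof (induction rule: hom_induct)
      case zero show ?case by simp
    next
      case (hom n)
      then have n: "int d dvd n" "n \<le> t" using y V_supp by (auto simp: not_less[symmetric])
      have "hcomp (D (hcomp y n)) m = \<zero>" if "m > t + \<delta>" for m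
        using high[OF hcomp_A[OF yc] n(1)] n that by simp
      moreover have "hcomp (D (hcomp y n)) (t + \<delta>) = hcomp (D (hcomp (hcomp y n) t)) (t + \<delta>)"
        using high[OF hcomp_A[OF yc] n(1), of "t + \<delta>"] n by (cases "n = t") (auto simp: hcomp_hom[OF hcomp_A[OF yc]])
      ultimately show ?case using hcomp_V[OF y(1)] by blast
    next
      case (add a b)
      then show ?case by (simp add: V_add D_add hcomp_add Dc hcomp_V V_carrier)
    qed
    then show ?thesis by blast
  qed
  have iter: "(\<forall>m>i + int n * \<delta>. hcomp ((D ^^ n) x) m = \<zero>) \<and>
      (E ^^ n) x = hcomp ((D ^^ n) x) (i + int n * \<delta>)"
    if x: "x \<in> A i" "int d dvd i" for x i n
  proof (induction n)
    case 0
    then show ?case using hcomp_hom[OF x(1)] by auto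
  next
    case (Suc n)
    let ?t = "i + int n * \<delta>" and ?y = "(D ^^ n) x"
    have yV: "?y \<in> V d" using Dn_closed A_V[OF x] by blast
    have eq: "i + int (Suc n) * \<delta> = ?t + \<delta>" by (simp add: algebra_simps)
    have "(E ^^ Suc n) x = E (hcomp ?y ?t)" using Suc by simp
    also have "\<dots> = hcomp (D (hcomp ?y ?t)) (?t + \<delta>)"
      by (rule E[OF hcomp_A[OF V_carrier[OF yV]]])
    finally show ?case unfolding eq using top[OF yV, of ?t] Suc by simp
  qed
  have "\<exists>D'. hom_lnd d \<delta> D' \<and> (\<forall>i x. x \<in> A i \<longrightarrow> int d dvd i \<longrightarrow> D' x = E x)"
  proof (rule extend_hom[of d \<delta> E])
    show "int d dvd \<delta>" by (rule d\<delta>)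
    show "E x \<in> A (i + \<delta>)" if "x \<in> A i" "int d dvd i" for i x
      using E that Dc A_V by simp
    show "E (x \<oplus> y) = E x \<oplus> E y" if "x \<in> A i" "y \<in> A i" "int d dvd i" for i x y
    proof -
      have "x \<in> V d" "y \<in> V d" using that A_V by auto
      then show ?thesis using E[OF that(1)] E[OF that(2)] E[OF A_add[OF that(1,2)]]
        by (simp add: D_add hcomp_add Dc)
    qed
    show "E (x \<otimes> y) = E x \<otimes> y \<oplus> x \<otimes> E y"
      if x: "x \<in> A i" and y: "y \<in> A j" and "int d dvd i" "int d dvd j" for i j x y
    proof -
      have V: "x \<in> V d" "y \<in> V d" using that A_V by auto
      then have c: "x \<in> carrier R" "y \<in> carrier R" "D x \<in> carrier R" "D y \<in> carrier R"
        using V_carrier Dc by auto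
      have "E (x \<otimes> y) = hcomp (y \<otimes> D x) (i + j + \<delta>) \<oplus> hcomp (x \<otimes> D y) (i + j + \<delta>)"
        using E[OF component_mult[OF x y]] V c by (simp add: D_mult hcomp_add m_comm)
      also have "\<dots> = y \<otimes> hcomp (D x) (i + \<delta>) \<oplus> x \<otimes> hcomp (D y) (j + \<delta>)"
        using hcomp_mult[OF y c(3), of "i + j + \<delta>"] hcomp_mult[OF x c(4), of "i + j + \<delta>"]
        by (simp add: algebra_simps)
      finally show ?thesis using E[OF x] E[OF y] c by (simp add: m_comm)
    qed
    show "\<exists>n. (E ^^ n) x = \<zero>" if x: "x \<in> A i" "int d dvd i" for i x
    proof -
      obtain n where "(D ^^ n) x = \<zero>" using D_nilp A_V[OF x] by blast
      then have "(E ^^ n) x = \<zero>" using iter[OF x, of n] by simp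
      then show ?thesis by blast
    qed
  qed blast
  then obtain D' where D': "hom_lnd d \<delta> D'" "\<And>i x. x \<in> A i \<Longrightarrow> int d dvd i \<Longrightarrow> D' x = E x" by blast
  obtain i x where x: "x \<in> A i" "int d dvd i" "hcomp (D x) (i + \<delta>) \<noteq> \<zero>" using \<delta> Ns_def by blast
  then have "D' x \<noteq> \<zero>" using D'(2) E by metis
  then show ?thesis unfolding hom_nonrigid_def using D'(1) x by blast
qed

lemma nonrigid_iff_hom:
  assumes "d > 0"
  shows "\<not> rigid (veronese R A d) \<longleftrightarrow> hom_nonrigid d"
proof
  assume "\<not> rigid (veronese R A d)"
  then show "hom_nonrigid d" using nonrigid_hom[OF assms] not_rigid_iff by blast
next
  assume "hom_nonrigid d"
  then show "\<not> rigid (veronese R A d)"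
    unfolding hom_nonrigid_def hom_lnd_def not_rigid_iff using A_V by blast
qed

end

section \<open>Veronese subrings of larger index\<close>

text \<open>As \<open>i\<close> is invertible modulo \<open>p\<close>, \<open>m\<close> is the
  residue of \<open>-c / i\<close>, taken nonnegative so that it can serve as an exponent.\<close>

lemma prime_solve:
  assumes p: "Factorial_Ring.prime p" and i: "\<not> int p dvd i"
  shows "\<exists>m::nat. int p dvd int m * i + c"
proof -
  have cop: "coprime (int p) i" using p i by (simp add: prime_imp_coprime)
  obtain u v where "u * int p + v * i = gcd (int p) i" using bezout_int by blast
  then have uv: "u * int p + v * i = 1" using cop by simp
  define m where "m = nat ((- c * v) mod int p)"
  have "int p > 0" using p prime_gt_0_nat by simp
  then have m: "int m = - c * v - int p * ((- c * v) div int p)"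
    unfolding m_def by (simp add: minus_mult_div_eq_mod)
  have "int m * i + c = c * (1 - v * i) - int p * ((- c * v) div int p * i)"
    unfolding m by (simp add: algebra_simps)
  also have "\<dots> = int p * (c * u - (- c * v) div int p * i)"
    unfolding uv[symmetric] by (simp add: algebra_simps)
  finally show ?thesis by (metis dvd_triv_left)
qed

context graded_affine_domain
begin

lemma V_mono: "d dvd e \<Longrightarrow> V e \<subseteq> V d"
  unfolding V_def by (auto dest: dvd_trans[of "int d" "int e", OF of_nat_dvd_iff[THEN iffD2]])

lemma nat_el_inverse:
  assumes "n > 0" obtains u where "u \<in> F" "u \<otimes> nat_el n = \<one>"
  using F_inverse[of "nat_el n"] F_rules(6) char0[OF assms] by metis

lemma hom_lnd_iterate:
  assumes "hom_lnd d \<delta> D" "x \<in> A i" "int d dvd i"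
  shows "(D ^^ n) x \<in> A (i + int n * \<delta>)" and "int d dvd i + int n * \<delta>"
proof -
  have d\<delta>: "int d dvd \<delta>" and D: "\<And>i x. x \<in> A i \<Longrightarrow> int d dvd i \<Longrightarrow> D x \<in> A (i + \<delta>)"
    using assms(1) unfolding hom_lnd_def by auto
  show dv: "int d dvd i + int n * \<delta>" for n using d\<delta> assms(3) by simp
  show "(D ^^ n) x \<in> A (i + int n * \<delta>)"
  proof (induction n)
    case (Suc n)
    have "i + int (Suc n) * \<delta> = i + int n * \<delta> + \<delta>" by (simp add: algebra_simps)
    then show ?case using D[OF Suc dv] by (metis comp_apply funpow.simps(2))
  qed (use assms(2) in simp)
qed

text \<open>If \<open>x\<close> has degree \<open>n\<close> with respect to \<open>D\<close>, the
  iterate of order \<open>n - 1\<close> is killed by the square of \<open>D\<close> but not by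
  \<open>D\<close>, and it is still homogeneous.\<close>

lemma homogeneous_slice:
  assumes "hom_lnd d \<delta> D" "x \<in> A i" "int d dvd i" "D x \<noteq> \<zero>"
  obtains s \<sigma> where "s \<in> A \<sigma>" "int d dvd \<sigma>" "D s \<noteq> \<zero>" "D (D s) = \<zero>"
proof -
  interpret lnd R "V d" D using assms(1) by (simp add: hom_lnd_def)
  have xV: "x \<in> V d" using A_V assms by blast
  have "x \<noteq> \<zero>" using assms(4) by auto
  then obtain n where n: "has_deg n x" using has_deg_ex xV by blast
  have "n \<noteq> 0" using n assms(4) unfolding has_deg_def by (cases n) auto
  then obtain m where m: "n = Suc m" using not0_implies_Suc by blast
  show ?thesis
  proof (rule that[of "(D ^^ m) x" "i + int m * \<delta>"])
    show "(D ^^ m) x \<in> A (i + int m * \<delta>)" "int d dvd i + int m * \<delta>"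
      using hom_lnd_iterate[OF assms(1-3)] by auto
  qed (use n m in \<open>auto simp: has_deg_def\<close>)
qed

text \<open>With \<open>a\<close> in the kernel, the \<open>n\<close>-th iterate of
  \<open>a D\<close> is \<open>a [^] n\<close> times that of \<open>D\<close>, so nilpotency
  persists. The degree \<open>i + \<delta>\<close> of \<open>a D\<close> is divisible by
  \<open>e\<close>, so \<open>V e\<close> is preserved.\<close>

lemma nonrigid_scaled:
  assumes D: "hom_lnd d \<delta> D" and e: "d dvd e"
    and a: "a \<in> A i" "int d dvd i" "a \<noteq> \<zero>" "D a = \<zero>" "int e dvd i + \<delta>"
    and x: "x \<in> V e" "D x \<noteq> \<zero>"
  shows "\<not> rigid (veronese R A e)"
proof -
  interpret lnd R "V d" D using D by (simp add: hom_lnd_def)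
  have VeV: "y \<in> V d" if "y \<in> V e" for y using that V_mono[OF e] by blast
  have aV: "a \<in> V d" using A_V a by blast
  have ac: "a \<in> carrier R" using A_carrier a by blast
  define E where "E x = a \<otimes> D x" for x
  have Dc: "D y \<in> carrier R" if "y \<in> V e" for y using VeV[OF that] D_closed V_carrier by blast
  have E_add: "E (y \<oplus> z) = E y \<oplus> E z" if "y \<in> V e" "z \<in> V e" for y z
    unfolding E_def using that VeV Dc ac by (simp add: D_add r_distr)
  have E_closed: "E y \<in> V e" if "y \<in> V e" for y
    using that
  proof (induction rule: V_induct)
    case (hom n y)
    have "int d dvd n" using hom(2) e by (meson dvd_trans of_nat_dvd_iff)
    then have "D y \<in> A (n + \<delta>)" using D hom unfolding hom_lnd_def by blast
    then have "E y \<in> A (i + (n + \<delta>))" unfolding E_def using component_mult a by blast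
    moreover have "int e dvd i + (n + \<delta>)" using a(5) hom(2) by (metis add.left_commute dvd_add)
    ultimately show ?case by (rule A_V)
  next
    case (add u v) then show ?case using E_add V_add by simp
  qed
  have "(E ^^ n) y = a [^] n \<otimes> (D ^^ n) y" if "y \<in> V e" for y n
  proof (induction n)
    case 0 then show ?case using that V_carrier by simp
  next
    case (Suc n)
    have V: "(D ^^ n) y \<in> V d" "a [^] n \<in> V d" using VeV[OF that] Dn_closed V_rules aV by auto
    have "(E ^^ Suc n) y = E ((E ^^ n) y)" by simp
    also have "\<dots> = a \<otimes> D (a [^] n \<otimes> (D ^^ n) y)" unfolding Suc by (rule E_def)
    also have "\<dots> = a \<otimes> (a [^] n \<otimes> D ((D ^^ n) y))"
      using D_ker_mult[OF V(2,1) D_ker_pow[OF aV a(4)]] by simp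
    finally show ?case using V D_closed Vc ac by (simp add: m_assoc m_lcomm[of a])
  qed
  then have E_nilp: "\<exists>n. (E ^^ n) y = \<zero>" if "y \<in> V e" for y
    using D_nilp[OF VeV[OF that]] that ac by (metis nat_pow_closed r_null)
  have "lnd R (V e) E"
  proof (intro lnd.intro lnd_axioms.intro domain_axioms veronese_subring char0)
    fix y z assume yz: "y \<in> V e" "z \<in> V e"
    then show "E (y \<otimes> z) = E y \<otimes> z \<oplus> y \<otimes> E z"
      unfolding E_def using VeV Dc ac V_carrier[OF yz(1)] V_carrier[OF yz(2)] by (simp add: D_mult r_distr m_ac)
  qed (use E_add E_closed E_nilp in auto)
  moreover have "E x \<noteq> \<zero>" unfolding E_def using x a ac Dc by (simp add: integral_iff)
  ultimately show ?thesis using not_rigid_iff x by blast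
qed

text \<open>If \<open>D\<close> has degree \<open>\<delta>\<close> and no multiple of \<open>D\<close> by a homogeneous element of its kernel maps
  \<open>V (d * p)\<close> into itself, then over a localization of the kernel \<open>V (d * p)\<close> becomes the polynomial ring
  in \<open>s\<^sup>p\<close>, where \<open>s\<close> is a slice, and \<open>D / s [^] (p - 1)\<close> is a multiple of the derivative by \<open>s\<^sup>p\<close>.\<close>

lemma nonrigid_multiple_prime:
  assumes d: "d > 0" and p: "Factorial_Ring.prime p" and nr: "hom_nonrigid d"
  shows "\<not> rigid (veronese R A (d * p))"
proof -
  define e where "e = d * p"
  have e0: "e > 0" using d p prime_gt_0_nat e_def by simp
  have de: "d dvd e" unfolding e_def by simp
  obtain \<delta> D i0 x0 where D: "hom_lnd d \<delta> D" and x0: "x0 \<in> A i0" "int d dvd i0" "D x0 \<noteq> \<zero>"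
    using nr unfolding hom_nonrigid_def by blast
  interpret lnd R "V d" D using D by (simp add: hom_lnd_def)
  have d\<delta>: "int d dvd \<delta>" and D_A: "\<And>i x. x \<in> A i \<Longrightarrow> int d dvd i \<Longrightarrow> D x \<in> A (i + \<delta>)"
    using D unfolding hom_lnd_def by auto
  have VeV: "y \<in> V d" if "y \<in> V e" for y using that V_mono[OF de] by blast
  have ed: "int d dvd i" if "int e dvd i" for i using that de by (meson dvd_trans of_nat_dvd_iff)
  have x0V: "x0 \<in> V d" using A_V x0 by blast
  \<comment> \<open>A witness that \<open>D\<close> does not vanish on \<open>V e\<close>: the
    \<open>p\<close>-th power moves \<open>x0\<close> into \<open>V e\<close>, and it stays outside
    the kernel by \<open>pow_ker\<close>.\<close>
  have z: "x0 [^] p \<in> V e"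
  proof -
    have "int e dvd int p * i0" using x0(2) unfolding e_def by (simp add: mult.commute mult_dvd_mono)
    then show ?thesis using A_V[OF A_pow[OF x0(1)]] by blast
  qed
  have Dz: "D (x0 [^] p) \<noteq> \<zero>" using pow_ker[OF x0V, of p] x0(3) p prime_gt_0_nat by blast
  show ?thesis
  proof (cases "\<exists>a i. a \<in> A i \<and> int d dvd i \<and> a \<noteq> \<zero> \<and> D a = \<zero> \<and> int e dvd i + \<delta>")
    case True
    then show ?thesis using nonrigid_scaled[OF D de _ _ _ _ _ z Dz] unfolding e_def by blast
  next
    case False
    have no\<delta>: "\<not> int e dvd \<delta>" using False one_A by (metis D_one add_0 dvd_0_right one_not_zero)
    \<comment> \<open>Otherwise some power of \<open>a\<close> would have degree congruent to
      \<open>-\<delta>\<close> modulo \<open>e\<close> and fall under the first case.\<close>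
    have ker_deg: "int e dvd i" if a: "a \<in> A i" "int d dvd i" "a \<noteq> \<zero>" "D a = \<zero>" for a i
    proof (rule ccontr)
      assume ne: "\<not> int e dvd i"
      obtain i' where i': "i = int d * i'" using a(2) by blast
      obtain \<delta>' where \<delta>': "\<delta> = int d * \<delta>'" using d\<delta> by blast
      have "\<not> int p dvd i'" using ne unfolding i' e_def by (auto simp: mult_dvd_mono)
      then obtain m :: nat where "int p dvd int m * i' + \<delta>'" using prime_solve[OF p] by blast
      then have "int e dvd int m * i + \<delta>"
        unfolding i' \<delta>' e_def by (metis distrib_left mult.left_commute mult_dvd_mono of_nat_mult dvd_refl)
      moreover have "a [^] m \<in> A (int m * i)" using A_pow a by blast
      moreover have "int d dvd int m * i" using a by simp
      moreover have "a [^] m \<noteq> \<zero>" using pow_eq_zero a A_carrier by blast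
      moreover have "D (a [^] m) = \<zero>" using D_ker_pow A_V a by blast
      ultimately show False using False by blast
    qed
    obtain s \<sigma> where s: "s \<in> A \<sigma>" "int d dvd \<sigma>" "D s \<noteq> \<zero>" "D (D s) = \<zero>"
      by (rule homogeneous_slice[OF D x0]) (rule that)
    define f where "f = D s"
    define \<phi> where "\<phi> = \<sigma> + \<delta>"
    have f: "f \<in> A \<phi>" "f \<noteq> \<zero>" "D f = \<zero>" "int d dvd \<phi>"
      unfolding f_def \<phi>_def using s D_A d\<delta> by auto
    have e\<phi>: "int e dvd \<phi>" using ker_deg[OF f(1,4,2,3)] .
    have sV: "s \<in> V d" and fV: "f \<in> V d" using A_V s f by auto
    have sc: "s \<in> carrier R" and fc: "f \<in> carrier R" using sV fV V_carrier by auto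
    have s0: "s \<noteq> \<zero>" using s(3) by auto
    have fpow: "f [^] (k::nat) \<in> V d" "D (f [^] k) = \<zero>" "f [^] k \<in> A (int k * \<phi>)" "f [^] k \<in> carrier R" for k
      using V_rules fV D_ker_pow f A_pow fc by auto
    \<comment> \<open>Induction on the degree of \<open>y\<close> with respect to \<open>D\<close>:
      a power of \<open>f\<close> times \<open>y\<close> is, up to a term of lower degree, a kernel
      element times a power of \<open>s\<close> whose exponent is a multiple of
      \<open>p\<close>.\<close>
    have claim: "\<exists>k::nat. \<exists>w\<in>carrier R. f [^] k \<otimes> D y = s [^] (p - 1) \<otimes> w"
      if "y \<in> A j" "int e dvd j" "(D ^^ Suc n) y = \<zero>" for n y j
      using that
    proof (induction n arbitrary: y j)
      case 0
      then have "f [^] (0::nat) \<otimes> D y = s [^] (p - 1) \<otimes> \<zero>" using sc by simp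
      then show ?case by blast
    next
      case (Suc n)
      define N where "N = Suc n"
      have yV: "y \<in> V d" using A_V Suc.prems ed by blast
      have yc: "y \<in> carrier R" "D y \<in> carrier R" using yV D_closed Vc by auto
      define c where "c = (D ^^ N) y"
      have cA: "c \<in> A (j + int N * \<delta>)" and dj: "int d dvd j + int N * \<delta>"
        unfolding c_def using hom_lnd_iterate[OF D Suc.prems(1) ed[OF Suc.prems(2)]] by auto
      have Dc: "D c = \<zero>" unfolding c_def N_def using Suc.prems(3) by simp
      have cV: "c \<in> V d" unfolding c_def using Dn_closed yV by blast
      show ?case
      proof (cases "c = \<zero>")
        case True
        then have "(D ^^ Suc n) y = \<zero>" unfolding c_def N_def .
        then show ?thesis using Suc by blast
      next
        case c0: False
        \<comment> \<open>The kernel element \<open>c\<close> has degree divisible by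
          \<open>e\<close>, hence so is \<open>N * \<delta>\<close>. As \<open>\<delta>\<close>
          itself is not, \<open>p\<close> divides \<open>N\<close>, and \<open>D (s [^] N)\<close>
          contains the factor \<open>s [^] (p - 1)\<close>.\<close>
        have "int e dvd j + int N * \<delta>" using ker_deg[OF cA dj c0 Dc] .
        then have "int e dvd int N * \<delta>" using Suc.prems(2) dvd_add_right_iff by blast
        moreover obtain \<delta>' where \<delta>': "\<delta> = int d * \<delta>'" using d\<delta> by blast
        ultimately have "int d * int p dvd int d * (int N * \<delta>')"
          unfolding e_def by (simp add: mult.left_commute)
        then have "int p dvd int N * \<delta>'" using d by simp
        moreover have "\<not> int p dvd \<delta>'" using no\<delta> unfolding \<delta>' e_def by (auto simp: mult_dvd_mono)
        ultimately have "int p dvd int N" using p by (simp add: prime_dvd_mult_iff)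
        then have "p dvd N" by simp
        then have pN: "p \<le> N" unfolding N_def by (simp add: dvd_imp_le)
        obtain u where u: "u \<in> F" "u \<otimes> nat_el (fact N) = \<one>" by (rule nat_el_inverse[of "fact N"]) auto
        have uA: "u \<in> A 0" and uV: "u \<in> V d" and uc: "u \<in> carrier R" using u F_A F_V F_carrier by auto
        have Du: "D u = \<zero>" by (rule unit_ker[OF uV _ u(2)]) (rule V_rules)
        \<comment> \<open>Division by \<open>fact N\<close> gives
          \<open>c' \<otimes> s [^] N\<close> and \<open>f [^] N \<otimes> y\<close> the same
          derivative of order \<open>N\<close>, by \<open>Dn_slice_pow\<close>.\<close>
        define c' where "c' = u \<otimes> c"
        have c'A: "c' \<in> A (j + int N * \<delta>)" unfolding c'_def using component_mult[OF uA cA] by simp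
        have c'V: "c' \<in> V d" unfolding c'_def using uV cV V_mult by blast
        have Dc': "D c' = \<zero>" unfolding c'_def using D_ker_mult[OF uV cV Du] Dc uc by simp
        have cc: "c' \<in> carrier R" "c \<in> carrier R" using c'V cV V_carrier by auto
        define y' where "y' = f [^] N \<otimes> y \<ominus> c' \<otimes> s [^] N"
        have V: "f [^] N \<otimes> y \<in> V d" "c' \<otimes> s [^] N \<in> V d" "s [^] N \<in> V d"
          using fpow yV V_mult c'V V_rules sV by auto
        have deg: "j + int N * \<delta> + int N * \<sigma> = int N * \<phi> + j" unfolding \<phi>_def by (simp add: algebra_simps)
        have "f [^] N \<otimes> y \<in> A (int N * \<phi> + j)" using component_mult[OF fpow(3) Suc.prems(1)] .
        moreover have "c' \<otimes> s [^] N \<in> A (int N * \<phi> + j)"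
          using component_mult[OF c'A A_pow[OF s(1)]] deg by metis
        ultimately have y'A: "y' \<in> A (int N * \<phi> + j)" unfolding y'_def by (rule A_minus)
        have ey': "int e dvd int N * \<phi> + j" using e\<phi> Suc.prems(2) by simp
        have "(D ^^ N) y' = f [^] N \<otimes> c \<ominus> c' \<otimes> (nat_el (fact N) \<otimes> f [^] N)"
          using Dn_slice_pow[OF sV s(4), of N] unfolding y'_def Dn_minus[OF V(1,2)]
            Dn_ker_mult[OF fpow(1) yV fpow(2)] Dn_ker_mult[OF c'V V(3) Dc'] c_def f_def[symmetric] by simp
        also have "c' \<otimes> (nat_el (fact N) \<otimes> f [^] N) = f [^] N \<otimes> c"
        proof -
          have "c' \<otimes> (nat_el (fact N) \<otimes> f [^] N) = (u \<otimes> nat_el (fact N)) \<otimes> (f [^] N \<otimes> c)"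
            unfolding c'_def using uc cc fpow(4) by (simp add: m_ac)
          then show ?thesis using u cc fpow(4) by simp
        qed
        finally have "(D ^^ N) y' = \<zero>" using cc fpow(4) by (simp add: a_minus_def r_neg)
        then have "(D ^^ Suc n) y' = \<zero>" unfolding N_def .
        from Suc.IH[OF y'A ey' this] obtain k :: nat and w where
          w: "w \<in> carrier R" "f [^] k \<otimes> D y' = s [^] (p - 1) \<otimes> w" by blast
        define q where "q = n - (p - 1)"
        have q: "n = (p - 1) + q" using pN unfolding q_def N_def by simp
        have sn: "s [^] n = s [^] (p - 1) \<otimes> s [^] q" unfolding q using sc by (simp add: nat_pow_mult)
        have "D y' = f [^] N \<otimes> D y \<ominus> c' \<otimes> D (s [^] N)"
          unfolding y'_def D_minus[OF V(1,2)] D_ker_mult[OF fpow(1) yV fpow(2)] D_ker_mult[OF c'V V(3) Dc'] ..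
        moreover have "D (s [^] N) = nat_el N \<otimes> (s [^] n \<otimes> f)"
          unfolding N_def D_pow[OF sV] f_def ..
        ultimately have Dy': "D y' = f [^] N \<otimes> D y \<ominus> s [^] (p - 1) \<otimes> (s [^] q \<otimes> (c' \<otimes> (nat_el N \<otimes> f)))"
          (is "_ = _ \<ominus> _ \<otimes> ?r")
          using sn sc cc fc by (simp add: m_ac)
        have rc: "?r \<in> carrier R" using sc cc fc by simp
        have Dyc: "f [^] N \<otimes> D y \<in> carrier R" using fpow yc by simp
        have spc: "s [^] (p - 1) \<in> carrier R" using sc by simp
        have "f [^] N \<otimes> D y = D y' \<oplus> s [^] (p - 1) \<otimes> ?r"
          unfolding Dy' using Dyc rc spc by (simp add: a_minus_def a_assoc l_neg del: nat_pow_Suc)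
        moreover have "D y' \<in> carrier R" unfolding Dy' using Dyc rc spc by simp
        ultimately have "f [^] k \<otimes> (f [^] N \<otimes> D y) = f [^] k \<otimes> D y' \<oplus> f [^] k \<otimes> (s [^] (p - 1) \<otimes> ?r)"
          using fpow(4) rc spc by (simp only: r_distr m_closed)
        also have "f [^] k \<otimes> (s [^] (p - 1) \<otimes> ?r) = s [^] (p - 1) \<otimes> (f [^] k \<otimes> ?r)"
          using fpow(4) rc spc m_lcomm by presburger
        also have "f [^] k \<otimes> D y' \<oplus> s [^] (p - 1) \<otimes> (f [^] k \<otimes> ?r) = s [^] (p - 1) \<otimes> (w \<oplus> f [^] k \<otimes> ?r)"
          unfolding w(2) using fpow(4) rc spc w(1) by (simp only: r_distr m_closed)
        also have "f [^] k \<otimes> (f [^] N \<otimes> D y) = f [^] (k + N) \<otimes> D y"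
          using fpow(4) yc fc by (simp add: m_assoc[symmetric] nat_pow_mult)
        finally have "f [^] (k + N) \<otimes> D y = s [^] (p - 1) \<otimes> (w \<oplus> f [^] k \<otimes> ?r)" .
        moreover have "w \<oplus> f [^] k \<otimes> ?r \<in> carrier R" using fpow(4) rc w(1) by simp
        ultimately show ?thesis by blast
      qed
    qed
    obtain T where T: "finite T" "\<And>t. t \<in> T \<Longrightarrow> \<exists>i. t \<in> A i \<and> int e dvd i" "V e = generate_ring R (F \<union> T)"
      by (rule veronese_fin_gen[OF e0]) (rule that)
    have "\<exists>k::nat. \<exists>w\<in>carrier R. f [^] k \<otimes> D t = s [^] (p - 1) \<otimes> w" if t: "t \<in> T" for t
    proof -
      obtain j where j: "t \<in> A j" "int e dvd j" using T(2)[OF t] by blast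
      obtain n where "(D ^^ n) t = \<zero>" using D_nilp A_V[OF j(1) ed[OF j(2)]] by blast
      then have "(D ^^ Suc n) t = \<zero>" by simp
      then show ?thesis using claim j by blast
    qed
    then obtain N where N: "\<And>t. t \<in> T \<Longrightarrow> \<exists>w\<in>carrier R. f [^] (N t :: nat) \<otimes> D t = s [^] (p - 1) \<otimes> w"
      by metis
    \<comment> \<open>The sum dominates each exponent, so one power of \<open>f\<close> serves all
      generators.\<close>
    define M where "M = (\<Sum>t\<in>T. N t)"
    define g where "g = f [^] M"
    define h where "h = s [^] (p - 1)"
    have gc: "g \<in> carrier R" and gV: "g \<in> V d" and Dg: "D g = \<zero>" and gA: "g \<in> A (int M * \<phi>)"
      unfolding g_def using fpow by auto
    have g0: "g \<noteq> \<zero>" unfolding g_def using pow_eq_zero fc f(2) by blast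
    have hc: "h \<in> carrier R" and hV: "h \<in> V d" and hA: "h \<in> A (int (p - 1) * \<sigma>)"
      unfolding h_def using sc V_rules sV A_pow[OF s(1)] by auto
    have h0: "h \<noteq> \<zero>" unfolding h_def using pow_eq_zero sc s0 by blast
    \<comment> \<open>By the Leibniz rule this divisibility is stable under the ring operations;
      checking generators therefore suffices to define \<open>E\<close> as \<open>g D / h\<close> on
      \<open>V e\<close>.\<close>
    define Q where "Q y \<longleftrightarrow> (\<exists>w\<in>carrier R. g \<otimes> D y = h \<otimes> w)" for y
    have QT: "Q t" if t: "t \<in> T" for t
    proof -
      have "N t \<le> M" unfolding M_def using T(1) t by (simp add: member_le_sum)
      then have gg: "g = f [^] (M - N t) \<otimes> f [^] N t" unfolding g_def using fc by (simp add: nat_pow_mult)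
      obtain w where w: "w \<in> carrier R" "f [^] N t \<otimes> D t = h \<otimes> w" using N[OF t] h_def by blast
      obtain j where "t \<in> A j" "int e dvd j" using T(2)[OF t] by blast
      then have Dt: "D t \<in> carrier R" using A_V ed D_closed V_carrier by blast
      have "g \<otimes> D t = f [^] (M - N t) \<otimes> (f [^] N t \<otimes> D t)" unfolding gg using Dt fc by (simp add: m_assoc)
      also have "\<dots> = h \<otimes> (f [^] (M - N t) \<otimes> w)" unfolding w(2) using w fc hc by (simp add: m_ac)
      finally show ?thesis unfolding Q_def using w fc by blast
    qed
    have Q_add: "Q (y \<oplus> z)" if "Q y" "Q z" "y \<in> V d" "z \<in> V d" for y z
    proof -
      obtain u w where uw: "u \<in> carrier R" "w \<in> carrier R" "g \<otimes> D y = h \<otimes> u" "g \<otimes> D z = h \<otimes> w"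
        using \<open>Q y\<close> \<open>Q z\<close> unfolding Q_def by blast
      have "g \<otimes> D (y \<oplus> z) = h \<otimes> (u \<oplus> w)"
        using uw that gc hc D_closed Vc by (simp add: D_add r_distr)
      then show ?thesis unfolding Q_def using uw by blast
    qed
    have Q_mult: "Q (y \<otimes> z)" if "Q y" "Q z" "y \<in> V d" "z \<in> V d" for y z
    proof -
      obtain u w where uw: "u \<in> carrier R" "w \<in> carrier R" "g \<otimes> D y = h \<otimes> u" "g \<otimes> D z = h \<otimes> w"
        using \<open>Q y\<close> \<open>Q z\<close> unfolding Q_def by blast
      have c: "y \<in> carrier R" "z \<in> carrier R" "D y \<in> carrier R" "D z \<in> carrier R"
        using that D_closed Vc by auto
      have "g \<otimes> D (y \<otimes> z) = (g \<otimes> D y) \<otimes> z \<oplus> y \<otimes> (g \<otimes> D z)"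
        using c gc that by (simp add: D_mult r_distr m_ac)
      also have "\<dots> = h \<otimes> (u \<otimes> z \<oplus> y \<otimes> w)" unfolding uw using uw c hc by (simp add: r_distr m_ac)
      finally show ?thesis unfolding Q_def using uw c by blast
    qed
    have Q_ker: "Q c" if "D c = \<zero>" for c
      unfolding Q_def using that gc hc by (intro bexI[of _ \<zero>]) auto
    note DF = lnd_scalar[OF lnd_axioms]
    have "y \<in> V d \<and> Q y" if "y \<in> generate_ring R (F \<union> T)" for y
      using that
    proof (induction rule: generate_ring.induct)
      case one
      then show ?case using Q_ker V_rules by simp
    next
      case (incl y)
      then show ?case
      proof
        assume "y \<in> F" then show ?thesis using Q_ker DF F_V[of d] by auto
      next
        assume "y \<in> T" then show ?thesis using QT T(2) A_V ed by blast
      qed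
    next
      case (a_inv y)
      have "\<ominus> \<one> \<in> V d" "D (\<ominus> \<one>) = \<zero>" using V_rules D_neg by auto
      then have "Q (\<ominus> \<one> \<otimes> y)" using Q_mult Q_ker a_inv by blast
      then show ?case using a_inv V_rules Vc by (simp add: l_minus)
    next
      case (eng_add y z) then show ?case using Q_add V_add by blast
    next
      case (eng_mult y z) then show ?case using Q_mult V_mult by blast
    qed
    then have "Q y" if "y \<in> V e" for y using T(3) that by blast
    then obtain E where E: "\<And>y. y \<in> V e \<Longrightarrow> E y \<in> carrier R" "\<And>y. y \<in> V e \<Longrightarrow> g \<otimes> D y = h \<otimes> E y"
      unfolding Q_def by metis
    have cancel: "y = z" if "h \<otimes> y = h \<otimes> z" "y \<in> carrier R" "z \<in> carrier R" for y z
      using that hc h0 m_lcancel by blast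
    have E_add: "E (y \<oplus> z) = E y \<oplus> E z" if yz: "y \<in> V e" "z \<in> V e" for y z
    proof (rule cancel)
      have c: "D y \<in> carrier R" "D z \<in> carrier R" using yz VeV D_closed V_carrier by blast+
      have "h \<otimes> E (y \<oplus> z) = g \<otimes> D y \<oplus> g \<otimes> D z"
        using E(2)[OF V_add[OF yz]] yz VeV c gc by (simp add: D_add r_distr)
      then show "h \<otimes> E (y \<oplus> z) = h \<otimes> (E y \<oplus> E z)" using E yz hc by (simp add: r_distr)
    qed (use E yz V_add in auto)
    have E_mult: "E (y \<otimes> z) = E y \<otimes> z \<oplus> y \<otimes> E z" if yz: "y \<in> V e" "z \<in> V e" for y z
    proof (rule cancel)
      have c: "D y \<in> carrier R" "D z \<in> carrier R" "y \<in> carrier R" "z \<in> carrier R"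
        "E y \<in> carrier R" "E z \<in> carrier R" using yz VeV D_closed V_carrier E by blast+
      have "h \<otimes> E (y \<otimes> z) = (g \<otimes> D y) \<otimes> z \<oplus> y \<otimes> (g \<otimes> D z)"
        using E(2)[OF V_mult[OF yz]] yz VeV c gc by (simp add: D_mult r_distr m_ac)
      also have "\<dots> = h \<otimes> (E y \<otimes> z \<oplus> y \<otimes> E z)"
        using E(2)[OF yz(1)] E(2)[OF yz(2)] c hc by (simp add: r_distr m_ac)
      finally show "h \<otimes> E (y \<otimes> z) = h \<otimes> (E y \<otimes> z \<oplus> y \<otimes> E z)" .
      show "E y \<otimes> z \<oplus> y \<otimes> E z \<in> carrier R" using c by simp
    qed (use E yz V_mult in auto)
    have E_closed: "E y \<in> V e" if "y \<in> V e" for y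
      using that
    proof (induction rule: V_induct)
      case (hom j y)
      have yV: "y \<in> V e" using A_V hom by blast
      have "g \<otimes> D y \<in> A (int M * \<phi> + (j + \<delta>))"
        by (rule component_mult[OF gA D_A[OF hom(1) ed[OF hom(2)]]])
      then have "h \<otimes> E y \<in> A (int M * \<phi> + (j + \<delta>))" using E(2)[OF yV] by simp
      then have "E y \<in> A (int M * \<phi> + (j + \<delta>) - int (p - 1) * \<sigma>)"
        by (rule quotient_degree[OF hA h0 E(1)[OF yV]])
      \<comment> \<open>Substituting \<open>\<sigma> = \<phi> - \<delta>\<close> leaves only
        multiples of \<open>\<phi>\<close>, \<open>j\<close> and \<open>p * \<delta>\<close>, each
        divisible by \<open>e\<close>.\<close>
      moreover have "int M * \<phi> + (j + \<delta>) - int (p - 1) * \<sigma> = int M * \<phi> + j + int p * \<delta> - int (p - 1) * \<phi>"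
        using prime_gt_0_nat[OF p] unfolding \<phi>_def by (simp add: of_nat_diff algebra_simps)
      moreover have "int e dvd int p * \<delta>" using d\<delta> unfolding e_def by (simp add: mult.commute mult_dvd_mono)
      then have "int e dvd int M * \<phi> + j + int p * \<delta> - int (p - 1) * \<phi>"
        using e\<phi> hom(2) by (intro dvd_diff dvd_add) auto
      ultimately show ?case using A_V by metis
    next
      case (add a b) then show ?case using E_add V_add by simp
    qed
    \<comment> \<open>\<open>E\<close> lowers the degree with respect to \<open>D\<close>: the
      kernel factor \<open>g\<close> does not change it, \<open>D\<close> lowers it by one, and
      dividing by \<open>h\<close> cannot raise it.\<close>
    have E_drop: "(D ^^ n) (E y) = \<zero>" if y: "y \<in> V e" "(D ^^ Suc n) y = \<zero>" for y n
    proof (rule Dn_cancel[OF hV VeV[OF E_closed[OF y(1)]] h0])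
      have Dy: "D y \<in> V d" using VeV y D_closed by blast
      have "(D ^^ n) (g \<otimes> D y) = g \<otimes> (D ^^ n) (D y)" by (rule Dn_ker_mult[OF gV Dy Dg])
      then have "(D ^^ n) (g \<otimes> D y) = \<zero>" using y(2) gc by (simp add: funpow_swap1)
      then show "(D ^^ n) (h \<otimes> E y) = \<zero>" using E(2)[OF y(1)] by simp
    qed
    have E_nilp1: "(E ^^ n) y = \<zero>" if "y \<in> V e" "(D ^^ n) y = \<zero>" for y n
      using that
    proof (induction n arbitrary: y)
      case (Suc n)
      have "(E ^^ n) (E y) = \<zero>" using Suc.IH[OF E_closed[OF Suc.prems(1)] E_drop[OF Suc.prems]] .
      then show ?case by (simp add: funpow_swap1)
    qed simp
    have "lnd R (V e) E"
    proof (intro lnd.intro lnd_axioms.intro domain_axioms veronese_subring char0)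
      show "\<exists>n. (E ^^ n) y = \<zero>" if "y \<in> V e" for y using D_nilp[OF VeV[OF that]] E_nilp1[OF that] by blast
    qed (use E_add E_mult E_closed in auto)
    moreover have "E (x0 [^] p) \<noteq> \<zero>"
    proof
      assume "E (x0 [^] p) = \<zero>"
      then have "g \<otimes> D (x0 [^] p) = \<zero>" using E(2)[OF z] hc by simp
      moreover have "D (x0 [^] p) \<in> carrier R" using VeV z D_closed V_carrier by blast
      ultimately show False using g0 gc Dz integral by blast
    qed
    ultimately show ?thesis using not_rigid_iff z unfolding e_def by blast
  qed
qed

lemma nonrigid_multiple:
  assumes "d > 0" "k > 0" "\<not> rigid (veronese R A d)"
  shows "\<not> rigid (veronese R A (d * k))"
  using assms(2)
proof (induction k rule: less_induct)
  case (less k)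
  show ?case
  proof (cases "k = 1")
    case True then show ?thesis using assms by simp
  next
    case False
    then obtain p where p: "Factorial_Ring.prime p" "p dvd k" using prime_factor_nat by blast
    then obtain j where j: "k = j * p" by (metis dvd_div_mult_self)
    have "j > 0" "j < k" using less.prems j prime_gt_1_nat[OF p(1)] by auto
    then have "\<not> rigid (veronese R A (d * j))" "d * j > 0" using less.IH assms by auto
    then have "\<not> rigid (veronese R A (d * j * p))"
      using nonrigid_multiple_prime[OF _ p(1)] nonrigid_iff_hom by blast
    then show ?thesis using j by (simp add: mult.assoc)
  qed
qed

end

section \<open>Homogeneous primes of height one\<close>

context domain
begin

section \<open>Divisibility in normal domains, maximal ideals of a family, and height one\<close>

definition divides_in :: "'a \<Rightarrow> 'a \<Rightarrow> bool"
  where "divides_in b a \<longleftrightarrow> (\<exists>w\<in>carrier R. a = b \<otimes> w)"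

lemma frac_embed_subring: "subring (frac_embed R ` carrier R) (frac_field R)"
proof -
  interpret K: field "frac_field R" by (rule frac_field_field)
  interpret ring_hom_ring R "frac_field R" "frac_embed R"
    by (rule ring_hom_ringI2[OF ring_axioms K.ring_axioms frac_embed_hom])
  show ?thesis by (rule img_is_subring[OF carrier_is_subring])
qed

text \<open>The list has exactly \<open>n\<close> entries, leading zeros allowed, so that prefixing
  a one yields a monic polynomial of degree \<open>n\<close>.\<close>

lemma (in cring) low_degree_eval:
  "y \<in> low_degree P x n \<Longrightarrow> \<exists>p. length p = n \<and> set p \<subseteq> P \<and> eval p x = y"
proof (induction n arbitrary: y)
  case (Suc n)
  then obtain r e where "y = r \<otimes> x [^] n \<oplus> e" "r \<in> P" "e \<in> low_degree P x n" by auto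
  moreover then obtain p where "length p = n" "set p \<subseteq> P" "eval p x = e" using Suc by blast
  ultimately have "length (r # p) = Suc n \<and> set (r # p) \<subseteq> P \<and> eval (r # p) x = y" by simp
  then show ?case by blast
qed simp

text \<open>The elements \<open>w n = b (a / b)\<^sup>n\<close> of \<open>R\<close> are \<open>R\<close>-linearly dependent, which is an integral
  equation for \<open>a / b\<close>.\<close>

lemma normal_divides:
  assumes nd: "normal_domain R" and a: "a \<in> carrier R" and b: "b \<in> carrier R" "b \<noteq> \<zero>"
    and w: "\<And>n. w n \<in> carrier R" "w 0 = b" "\<And>n. w n \<otimes> a = b \<otimes> w (Suc n)"
    and n: "w n \<in> lin_span (carrier R) (w ` {..<n})"
  shows "divides_in b a"
proof -
  let ?K = "frac_field R" and ?P = "frac_embed R ` carrier R"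
  interpret K: field ?K by (rule frac_field_field)
  note P = frac_embed_subring
  define z where "z = fraction R a b"
  have zc: "z \<in> carrier ?K" unfolding z_def using a b by (simp add: frac_in_carrier)
  have z_pow: "z [^]\<^bsub>?K\<^esub> i = fraction R (w i) b" for i :: nat
  proof (induction i)
    case 0
    then show ?case using w(2) b by (simp add: frac_one frac_eq_iff)
  next
    case (Suc i)
    then have "z [^]\<^bsub>?K\<^esub> Suc i = fraction R (w i \<otimes> a) (b \<otimes> b)"
      unfolding z_def using a b w(1) by (simp add: frac_mult)
    also have "\<dots> = fraction R (w (Suc i)) b"
      using b w(1) by (subst frac_eq_iff) (auto simp: integral_iff w(3) m_ac)
    finally show ?case .
  qed
  have low: "fraction R v b \<in> K.low_degree ?P z n" if "v \<in> lin_span (carrier R) (w ` {..<n})" for v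
    using that
  proof (induction rule: lin_span.induct)
    case zero
    have "fraction R \<zero> b = \<zero>\<^bsub>?K\<^esub>" using b by (simp add: frac_zero frac_eq_iff)
    then show ?case using K.low_degree_zero[OF P zc] by simp
  next
    case (step c x v)
    then obtain i where i: "i < n" "x = w i" by auto
    have "lin_span (carrier R) (w ` {..<n}) \<subseteq> carrier R" using w(1) by (intro lin_span_carrier) auto
    then have c: "c \<in> carrier R" "x \<in> carrier R" "v \<in> carrier R" using step i w(1) by auto
    have "fraction R (c \<otimes> x \<oplus> v) b = frac_embed R c \<otimes>\<^bsub>?K\<^esub> fraction R x b \<oplus>\<^bsub>?K\<^esub> fraction R v b"
      using c b by (simp add: frac_embed_def frac_simps l_distr r_distr m_ac)
    moreover have "fraction R x b \<in> K.low_degree ?P z n"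
    proof -
      have o: "\<one>\<^bsub>?K\<^esub> \<in> ?P" using subringE(3)[OF P] .
      have "z [^]\<^bsub>?K\<^esub> i = \<one>\<^bsub>?K\<^esub> \<otimes>\<^bsub>?K\<^esub> z [^]\<^bsub>?K\<^esub> i \<oplus>\<^bsub>?K\<^esub> \<zero>\<^bsub>?K\<^esub>" using zc by simp
      then have "z [^]\<^bsub>?K\<^esub> i \<in> K.low_degree ?P z (Suc i)"
        using o K.low_degree_zero[OF P zc, of i] by auto
      then have "z [^]\<^bsub>?K\<^esub> i \<in> K.low_degree ?P z n"
        using K.low_degree_mono[OF P zc, of "Suc i" n] i by auto
      then show ?thesis using z_pow[of i] i by simp
    qed
    moreover have "frac_embed R c \<in> ?P" using c by blast
    ultimately show ?case using K.low_degree_add[OF P zc] K.low_degree_smult[OF P zc] step.IH by metis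
  qed
  have m1: "\<ominus>\<^bsub>?K\<^esub> \<one>\<^bsub>?K\<^esub> \<in> ?P" using subringE(3,5)[OF P] by blast
  have zn: "z [^]\<^bsub>?K\<^esub> n \<in> carrier ?K" using zc by simp
  have "z [^]\<^bsub>?K\<^esub> n \<in> K.low_degree ?P z n" using low[OF n] z_pow by simp
  then have "\<ominus>\<^bsub>?K\<^esub> \<one>\<^bsub>?K\<^esub> \<otimes>\<^bsub>?K\<^esub> z [^]\<^bsub>?K\<^esub> n \<in> K.low_degree ?P z n"
    by (rule K.low_degree_smult[OF P zc m1])
  then have "\<ominus>\<^bsub>?K\<^esub> (z [^]\<^bsub>?K\<^esub> n) \<in> K.low_degree ?P z n" using zn by (simp add: K.l_minus)
  then obtain p where p: "length p = n" "set p \<subseteq> ?P" "K.eval p z = \<ominus>\<^bsub>?K\<^esub> (z [^]\<^bsub>?K\<^esub> n)"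
    using K.low_degree_eval by blast
  have "polynomial\<^bsub>?K\<^esub> ?P (\<one>\<^bsub>?K\<^esub> # p)"
    unfolding polynomial_def using p(2) subringE(3)[OF P] by simp
  moreover have "K.eval (\<one>\<^bsub>?K\<^esub> # p) z = \<zero>\<^bsub>?K\<^esub>"
    using p zn by (simp add: K.r_neg)
  ultimately have "integral_over ?K ?P z"
    unfolding integral_over_def by (intro exI[of _ "\<one>\<^bsub>?K\<^esub> # p"]) simp
  then obtain c where c: "c \<in> carrier R" "z = frac_embed R c"
    using nd zc unfolding normal_domain_def by blast
  then have "a \<otimes> \<one> = c \<otimes> b" unfolding z_def frac_embed_def using a b by (simp add: frac_eq_iff)
  then have "a = b \<otimes> c" using a b c by (simp add: m_comm)
  then show ?thesis unfolding divides_in_def using c by blast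
qed

text \<open>In a strictly ascending chain, picking from each ideal an element outside its
  predecessor contradicts \<open>noeth\<close>. The family is indexed so that a maximal ideal comes
  with its index, later a homogeneous multiplier.\<close>

lemma noeth_maximal:
  assumes N: "noeth (carrier R)" and C: "c0 \<in> C"
    and J: "\<And>c. c \<in> C \<Longrightarrow> ideal (J c) R"
  obtains c where "c \<in> C" "\<And>c'. c' \<in> C \<Longrightarrow> J c \<subseteq> J c' \<Longrightarrow> J c' = J c"
proof -
  have "\<exists>c\<in>C. \<forall>c'\<in>C. J c \<subseteq> J c' \<longrightarrow> J c' = J c"
  proof (rule ccontr)
    assume "\<not> ?thesis"
    then have step: "\<forall>c\<in>C. \<exists>c'\<in>C. J c \<subset> J c'" by blast
    have "\<exists>f. \<forall>n::nat. f n \<in> C \<and> J (f n) \<subset> J (f (Suc n))"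
      using dependent_nat_choice[of "\<lambda>_ c. c \<in> C" "\<lambda>_ c c'. J c \<subset> J c'"] C step by blast
    then obtain f where f: "\<And>n::nat. f n \<in> C" "\<And>n. J (f n) \<subset> J (f (Suc n))" by blast
    then have mono: "J (f i) \<subseteq> J (f n)" if "i \<le> n" for i n
      using lift_Suc_mono_le[of "\<lambda>n. J (f n)" i n] that by blast
    have "\<exists>w. w \<in> J (f (Suc n)) \<and> w \<notin> J (f n)" for n using f(2) by blast
    then obtain w where w: "\<And>n. w n \<in> J (f (Suc n))" "\<And>n. w n \<notin> J (f n)" by metis
    have wc: "range w \<subseteq> carrier R"
      using w(1) additive_subgroup.a_subset[OF ideal.axioms(1)[OF J[OF f(1)]]] by blast
    then obtain n where n: "w n \<in> lin_span (carrier R) (w ` {..<n})" using N unfolding noeth_def by blast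
    interpret I: ideal "J (f n)" R by (rule J[OF f(1)])
    have "x \<in> J (f n)" if "x \<in> lin_span (carrier R) (w ` {..<n})" for x
      using that
    proof (induction rule: lin_span.induct)
      case zero show ?case by (rule I.zero_closed)
    next
      case (step c x v)
      then obtain i where "i < n" "x = w i" by auto
      then have "x \<in> J (f n)" using w(1)[of i] mono[of "Suc i" n] by auto
      then show ?case using step I.I_l_closed I.a_closed by blast
    qed
    then show False using n w(2) by blast
  qed
  then show ?thesis using that by blast
qed

lemma primeideal_pow:
  assumes "primeideal q R" and "u \<in> carrier R" "u [^] (k::nat) \<in> q"
  shows "u \<in> q"
  using assms(3)
proof (induction k)
  case 0
  interpret q: primeideal q R by fact
  show ?case using 0 q.one_imp_carrier q.I_notcarr by simp
next
  case (Suc k)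
  interpret q: primeideal q R by fact
  show ?case using q.I_prime[of "u [^] k" u] Suc assms(2) by auto
qed

text \<open>Every prime \<open>P\<close> properly below \<open>q\<close> satisfies \<open>u P \<subseteq> w P\<close>, so a nonzero \<open>x \<in> P\<close> would give a sequence
  \<open>f\<close> in \<open>P\<close> with \<open>w\<^sup>n f n = u\<^sup>n x\<close>, and a linear dependence among its terms makes a power of \<open>u\<close>
  divisible by \<open>w\<close>.\<close>

lemma height_one:
  assumes N: "noeth (carrier R)" and q: "primeideal q R" and b: "b \<in> q" "b \<noteq> \<zero>"
    and w: "w \<in> q" and u: "u \<in> carrier R" "u \<notin> q"
    and uw: "\<And>x. x \<in> q \<Longrightarrow> \<exists>y\<in>carrier R. u \<otimes> x = w \<otimes> y"
  shows "height R q = 1"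
proof -
  interpret q: primeideal q R by fact
  have below: "P = {\<zero>}" if P: "primeideal P R" "P \<subset> q" for P
  proof -
    interpret P: primeideal P R by fact
    have Pc: "P \<subseteq> carrier R" by (rule P.a_subset)
    have wc: "w \<in> carrier R" using w q.a_subset by blast
    have uP: "u \<notin> P" using u P(2) by blast
    \<comment> \<open>If \<open>w\<close> were in \<open>P\<close>, then \<open>u\<close> times any
      element of \<open>q\<close> would be in \<open>P\<close>, hence all of \<open>q\<close>,
      although \<open>P\<close> is properly smaller.\<close>
    have wP: "w \<notin> P"
    proof
      assume wP: "w \<in> P"
      have "x \<in> P" if x: "x \<in> q" for x
      proof -
        obtain y where "y \<in> carrier R" "u \<otimes> x = w \<otimes> y" using uw[OF x] by blast
        then have "u \<otimes> x \<in> P" using P.I_r_closed[OF wP] by simp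
        then show ?thesis using P.I_prime u uP x q.a_subset by blast
      qed
      then show False using P(2) by blast
    qed
    have step: "\<exists>y\<in>P. u \<otimes> x = w \<otimes> y" if x: "x \<in> P" for x
    proof -
      obtain y where y: "y \<in> carrier R" "u \<otimes> x = w \<otimes> y" using uw x P(2) by blast
      have "w \<otimes> y \<in> P" using y(2) P.I_l_closed[OF x u(1)] by simp
      then show ?thesis using P.I_prime[OF wc y(1)] wP y by blast
    qed
    have "x = \<zero>" if x: "x \<in> P" for x
    proof (rule ccontr)
      assume x0: "x \<noteq> \<zero>"
      have "\<exists>f. \<forall>n::nat. f n \<in> P \<and> (n = 0 \<longrightarrow> f n = x) \<and> u \<otimes> f n = w \<otimes> f (Suc n)"
        using dependent_nat_choice[of "\<lambda>n y. y \<in> P \<and> (n = 0 \<longrightarrow> y = x)" "\<lambda>_ y z. u \<otimes> y = w \<otimes> z"] x step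
        by blast
      then obtain f where "\<forall>n::nat. f n \<in> P \<and> (n = 0 \<longrightarrow> f n = x) \<and> u \<otimes> f n = w \<otimes> f (Suc n)" by blast
      then have f: "\<And>n. f n \<in> P" "f 0 = x" "\<And>n. u \<otimes> f n = w \<otimes> f (Suc n)" by auto
      have fc: "f n \<in> carrier R" for n using f(1) Pc by blast
      have wf: "w [^] n \<otimes> f n = u [^] n \<otimes> x" for n :: nat
      proof (induction n)
        case 0 then show ?case using f(2) by simp
      next
        case (Suc n)
        have "w [^] Suc n \<otimes> f (Suc n) = w [^] n \<otimes> (w \<otimes> f (Suc n))" using wc fc by (simp add: m_assoc)
        also have "\<dots> = w [^] n \<otimes> (u \<otimes> f n)" using f(3) by simp
        also have "\<dots> = u \<otimes> (w [^] n \<otimes> f n)" using wc fc u by (simp add: m_ac)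
        finally show ?case unfolding Suc using u x Pc by (simp add: m_ac subset_iff)
      qed
      obtain n where n: "f n \<in> lin_span (carrier R) (f ` {..<n})"
        using N fc unfolding noeth_def by blast
      have xc: "x \<in> carrier R" using x Pc by blast
      \<comment> \<open>For \<open>i < n\<close> the product \<open>w [^] n \<otimes> f i\<close> is
        \<open>w [^] (n - i) \<otimes> u [^] i \<otimes> x\<close>, so a factor \<open>w\<close>
        remains beside \<open>x\<close>.\<close>
      have "\<exists>r\<in>carrier R. w [^] n \<otimes> v = w \<otimes> r \<otimes> x" if "v \<in> lin_span (carrier R) (f ` {..<n})" for v
        using that
      proof (induction rule: lin_span.induct)
        case zero
        show ?case by (rule bexI[of _ \<zero>]) (use wc xc in auto)
      next
        case (step c y v)
        then obtain r where r: "r \<in> carrier R" "w [^] n \<otimes> v = w \<otimes> r \<otimes> x" by blast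
        obtain i where i: "i < n" "y = f i" using step by auto
        have "lin_span (carrier R) (f ` {..<n}) \<subseteq> carrier R" using fc by (intro lin_span_carrier) auto
        then have vc: "v \<in> carrier R" using step by blast
        define k where "k = n - Suc i"
        have nk: "w [^] n = w \<otimes> w [^] k \<otimes> w [^] i"
        proof -
          have "n = Suc (k + i)" unfolding k_def using i by simp
          then show ?thesis using wc by (simp add: nat_pow_mult[symmetric] m_ac)
        qed
        have "w [^] n \<otimes> (c \<otimes> y \<oplus> v) = w [^] n \<otimes> (c \<otimes> y) \<oplus> w [^] n \<otimes> v"
          using step(1) fc i vc wc by (simp add: r_distr)
        also have "w [^] n \<otimes> (c \<otimes> y) = w \<otimes> (w [^] k \<otimes> c) \<otimes> (w [^] i \<otimes> f i)"
          unfolding nk i(2) using step(1) fc wc by (simp add: m_ac)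
        also have "\<dots> = w \<otimes> (w [^] k \<otimes> c \<otimes> u [^] i) \<otimes> x"
          unfolding wf using step(1) wc u xc by (simp add: m_ac)
        also have "\<dots> \<oplus> w [^] n \<otimes> v = w \<otimes> (w [^] k \<otimes> c \<otimes> u [^] i \<oplus> r) \<otimes> x"
          unfolding r(2) using step(1) wc u xc r(1) by (simp add: l_distr r_distr)
        finally show ?case
          by (rule bexI[of _ "w [^] k \<otimes> c \<otimes> u [^] i \<oplus> r"]) (use step(1) wc u r(1) in auto)
      qed
      then obtain r where r: "r \<in> carrier R" "u [^] n \<otimes> x = w \<otimes> r \<otimes> x" using n wf[of n] by metis
      then have "u [^] n = w \<otimes> r" using m_rcancel[OF x0 xc] u wc by simp
      then have "u [^] n \<in> q" using q.I_r_closed[OF w r(1)] by simp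
      then have "u \<in> q" by (rule primeideal_pow[OF q u(1)])
      then show False using u(2) by blast
    qed
    then show ?thesis using P.zero_closed by blast
  qed
  \<comment> \<open>A longer chain would contain two distinct primes properly below
    \<open>q\<close>, but \<open>below\<close> makes both zero.\<close>
  have "enat n \<le> 1" if P: "\<forall>i\<le>n. primeideal (P i) R" "\<forall>i<n. P i \<subset> P (Suc i)" "P n = q" for n P
  proof (rule ccontr)
    assume "\<not> enat n \<le> 1"
    then have "\<not> n \<le> 1" by (simp add: one_enat_def)
    then obtain m where m: "n = Suc (Suc m)" by (metis One_nat_def le_SucI not0_implies_Suc zero_le le_refl)
    have pr: "primeideal (P (Suc m)) R" "primeideal (P m) R" using P(1) m by auto
    have sub: "P m \<subset> P (Suc m)" "P (Suc m) \<subset> q" using P(2,3) m by auto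
    have "P (Suc m) = {\<zero>}" "P m = {\<zero>}" using below[OF pr(1)] below[OF pr(2)] sub by blast+
    then show False using sub by simp
  qed
  moreover have "\<exists>P. (\<forall>i\<le>1. primeideal (P i) R) \<and> (\<forall>i<1. P i \<subset> P (Suc i)) \<and> P (1::nat) = q"
  proof (intro exI[of _ "\<lambda>i. if i = 0 then {\<zero>} else q"] conjI allI impI)
    show "(if i = 0 then {\<zero>} else q) \<subset> (if Suc i = 0 then {\<zero>} else q)" if "i < 1" for i :: nat
      using that b q.zero_closed by auto
  qed (use q zeroprimeideal in auto)
  then have "1 \<in> {enat n | n. \<exists>P. (\<forall>i\<le>n. primeideal (P i) R) \<and> (\<forall>i<n. P i \<subset> P (Suc i)) \<and> P n = q}"
    unfolding one_enat_def by blast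
  ultimately show ?thesis unfolding height_def by (intro antisym Sup_least Sup_upper) auto
qed

end

context graded_domain
begin

text \<open>For \<open>x\<close> and \<open>y\<close> outside \<open>q\<close>, take the highest
  degrees \<open>i\<close> and \<open>j\<close> whose components are outside \<open>q\<close>.
  Modulo \<open>q\<close>, the component of degree \<open>i + j\<close> of the product is the
  product of these two, so primality need only be tested on homogeneous elements.\<close>

lemma homogeneous_prime:
  assumes q: "ideal q R" and ne: "\<one> \<notin> q"
    and hom: "\<And>x n. x \<in> q \<Longrightarrow> hcomp x n \<in> q"
    and pr: "\<And>x y i j. x \<in> A i \<Longrightarrow> y \<in> A j \<Longrightarrow> x \<otimes> y \<in> q \<Longrightarrow> x \<in> q \<or> y \<in> q"
  shows "primeideal q R" "homogeneous_ideal R A q"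
proof -
  interpret q: ideal q R by fact
  have in_q: "x \<in> q" if "x \<in> carrier R" "\<And>n. hcomp x n \<in> q" for x
    using that(1) by (rule hom_induct) (use that(2) q.a_closed in auto)
  show "primeideal q R"
  proof (rule primeidealI[OF q is_cring])
    show "carrier R \<noteq> q" using ne by blast
    fix x y assume x: "x \<in> carrier R" and y: "y \<in> carrier R" and xy: "x \<otimes> y \<in> q"
    show "x \<in> q \<or> y \<in> q"
    proof (rule ccontr)
      assume "\<not> (x \<in> q \<or> y \<in> q)"
      then have ne: "{n. hcomp x n \<notin> q} \<noteq> {}" "{n. hcomp y n \<notin> q} \<noteq> {}"
        using in_q x y by blast+
      have "{n. hcomp x n \<notin> q} \<subseteq> {n. hcomp x n \<noteq> \<zero>}" "{n. hcomp y n \<notin> q} \<subseteq> {n. hcomp y n \<noteq> \<zero>}"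
        using q.zero_closed by auto
      then have fin: "finite {n. hcomp x n \<notin> q}" "finite {n. hcomp y n \<notin> q}"
        using hcomp_finite x y finite_subset by blast+
      define i where "i = Max {n. hcomp x n \<notin> q}"
      define j where "j = Max {n. hcomp y n \<notin> q}"
      have i: "hcomp x i \<notin> q" "\<And>n. n > i \<Longrightarrow> hcomp x n \<in> q"
        using Max_in[OF fin(1) ne(1)] Max_ge[OF fin(1)] unfolding i_def by (auto simp: not_le[symmetric])
      have j: "hcomp y j \<notin> q" "\<And>n. n > j \<Longrightarrow> hcomp y n \<in> q"
        using Max_in[OF fin(2) ne(2)] Max_ge[OF fin(2)] unfolding j_def by (auto simp: not_le[symmetric])
      let ?S = "{n. hcomp x n \<noteq> \<zero>} - {i}"
      let ?g = "\<lambda>n. hcomp x n \<otimes> hcomp y (i + j - n)"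
      have f: "finite ?S" using hcomp_finite[OF x] by simp
      have "hcomp (x \<otimes> y) (i + j) = finsum R ?g (insert i ?S)"
        by (rule hcomp_mult_finsum) (use x y f in auto)
      also have "\<dots> = ?g i \<oplus> finsum R ?g ?S" using f x y by (intro finsum_insert) auto
      finally have eq: "hcomp (x \<otimes> y) (i + j) = hcomp x i \<otimes> hcomp y j \<oplus> finsum R ?g ?S" by simp
      have g: "?g n \<in> q" if "n \<noteq> i" for n
      proof (cases "n > i")
        case True then show ?thesis using i(2) y by (intro q.I_r_closed) auto
      next
        case False
        then have "i + j - n > j" using that by simp
        then show ?thesis using j(2) x by (intro q.I_l_closed) auto
      qed
      have "finsum R ?g U \<in> q" if "finite U" "i \<notin> U" for U
        using that
      proof (induction U)
        case (insert n U)
        then show ?case using g[of n] x y by (subst finsum_insert) (auto intro: q.a_closed)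
      qed simp
      then have r: "finsum R ?g ?S \<in> q" using f by blast
      have "hcomp (x \<otimes> y) (i + j) \<oplus> \<ominus> finsum R ?g ?S \<in> q"
        using hom[OF xy] r q.a_closed q.a_inv_closed by blast
      moreover have "hcomp (x \<otimes> y) (i + j) \<oplus> \<ominus> finsum R ?g ?S = hcomp x i \<otimes> hcomp y j"
        unfolding eq using x y r q.a_subset by (simp add: a_assoc r_neg subset_iff)
      ultimately show False using pr[OF hcomp_A[OF x] hcomp_A[OF y]] i(1) j(1) by metis
    qed
  qed
  let ?S = "q \<inter> (\<Union>n. A n)"
  have Sc: "?S \<subseteq> carrier R" using q.a_subset by blast
  interpret S: ideal "Idl ?S" R by (rule genideal_ideal[OF Sc])
  have "q = Idl ?S"
  proof
    show "Idl ?S \<subseteq> q" by (rule genideal_minimal[OF q]) simp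
    show "q \<subseteq> Idl ?S"
    proof
      fix x assume x: "x \<in> q"
      have xc: "x \<in> carrier R" using x q.a_subset by blast
      show "x \<in> Idl ?S" using xc
      proof (rule hom_induct)
        fix n
        have "hcomp x n \<in> ?S" using hom[OF x] hcomp_A[OF xc] by blast
        then show "hcomp x n \<in> Idl ?S" using genideal_self[OF Sc] by blast
      qed (use S.zero_closed S.a_closed in auto)
    qed
  qed
  then show "homogeneous_ideal R A q" unfolding homogeneous_ideal_def by blast
qed

text \<open>The prime \<open>q\<close> is a maximal conductor of the fractions \<open>c a / b\<close> with \<open>c\<close> homogeneous. If
  \<open>q\<close> were stable under multiplication by \<open>c a / b\<close>, this fraction would be integral. Hence \<open>w (c a) = b u\<close>
  for some \<open>w \<in> q\<close> and \<open>u \<notin> q\<close>, and \<open>q\<close> becomes principal, generated by \<open>w\<close>, once \<open>u\<close> is inverted.\<close>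

lemma conductor_height_one:
  assumes N: "noeth (carrier R)" and nd: "normal_domain R"
    and a: "a \<in> A i" and b: "b \<in> A j" "b \<noteq> \<zero>" and nab: "\<not> divides_in b a"
  obtains q where "q \<in> homogeneous_height_one_primes R A"
    "\<And>r. r \<in> carrier R \<Longrightarrow> divides_in b (r \<otimes> a) \<Longrightarrow> r \<in> q"
proof -
  have ac: "a \<in> carrier R" and bc: "b \<in> carrier R" using a b A_carrier by auto
  define J where "J c = {r \<in> carrier R. divides_in b (r \<otimes> (c \<otimes> a))}" for c
  \<comment> \<open>Homogeneous multipliers that leave the fraction outside the ring;
    \<open>J c\<close> is the ideal of denominators of \<open>c a / b\<close>.\<close>
  define C where "C = {c. (\<exists>t. c \<in> A t) \<and> \<not> divides_in b (c \<otimes> a)}"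
  have J_ideal: "ideal (J c) R" if "c \<in> carrier R" for c
  proof (rule idealI[OF ring_axioms])
    have cac: "c \<otimes> a \<in> carrier R" using that ac by simp
    have l: "x \<otimes> r \<in> J c" if r: "r \<in> J c" and x: "x \<in> carrier R" for r x
    proof -
      obtain w where w: "w \<in> carrier R" "r \<otimes> (c \<otimes> a) = b \<otimes> w" "r \<in> carrier R"
        using r unfolding J_def divides_in_def by blast
      then have "x \<otimes> r \<otimes> (c \<otimes> a) = b \<otimes> (x \<otimes> w)" using x bc cac by (simp add: m_assoc m_lcomm)
      then show ?thesis unfolding J_def divides_in_def using w x by blast
    qed
    show "subgroup (J c) (add_monoid R)"
    proof (rule add.subgroupI)
      show "J c \<subseteq> carrier R" unfolding J_def by blast
      have "\<zero> \<otimes> (c \<otimes> a) = b \<otimes> \<zero>" using cac bc by simp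
      then show "J c \<noteq> {}" unfolding J_def divides_in_def by blast
      show "\<ominus> r \<in> J c" if r: "r \<in> J c" for r
        using l[OF r, of "\<ominus> \<one>"] r unfolding J_def by (simp add: l_minus)
      show "r \<oplus> s \<in> J c" if rs: "r \<in> J c" "s \<in> J c" for r s
      proof -
        obtain v w where "v \<in> carrier R" "w \<in> carrier R" "r \<otimes> (c \<otimes> a) = b \<otimes> v" "s \<otimes> (c \<otimes> a) = b \<otimes> w"
          "r \<in> carrier R" "s \<in> carrier R" using rs unfolding J_def divides_in_def by blast
        moreover then have "(r \<oplus> s) \<otimes> (c \<otimes> a) = b \<otimes> (v \<oplus> w)" using bc cac by (simp add: l_distr r_distr)
        ultimately show ?thesis unfolding J_def divides_in_def by blast
      qed
    qed
    show "x \<otimes> r \<in> J c" if "r \<in> J c" "x \<in> carrier R" for r x using l that by blast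
    show "r \<otimes> x \<in> J c" if r: "r \<in> J c" "x \<in> carrier R" for r x
      using l[OF r] r unfolding J_def by (simp add: m_comm)
  qed
  have Cc: "c \<in> carrier R" if "c \<in> C" for c using that A_carrier unfolding C_def by blast
  have "\<one> \<in> C" unfolding C_def using one_A nab ac by auto
  then obtain c where c: "c \<in> C" "\<And>c'. c' \<in> C \<Longrightarrow> J c \<subseteq> J c' \<Longrightarrow> J c' = J c"
    using noeth_maximal[OF N, of \<one> C J] J_ideal Cc by metis
  define q where "q = J c"
  define a' where "a' = c \<otimes> a"
  have cc: "c \<in> carrier R" using Cc c by blast
  obtain t where t: "c \<in> A t" and nb: "\<not> divides_in b a'" using c(1) unfolding C_def a'_def by blast
  have a'A: "a' \<in> A (t + i)" unfolding a'_def using component_mult t a by blast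
  have a'c: "a' \<in> carrier R" using A_carrier a'A by blast
  have q_iff: "r \<in> q \<longleftrightarrow> r \<in> carrier R \<and> divides_in b (r \<otimes> a')" for r
    unfolding q_def J_def a'_def by blast
  interpret q: ideal q R unfolding q_def by (rule J_ideal[OF cc])
  have one: "\<one> \<notin> q" using nb a'c unfolding q_iff by simp
  have hom: "hcomp r n \<in> q" if r: "r \<in> q" for r n
  proof -
    obtain w where w: "r \<in> carrier R" "w \<in> carrier R" "r \<otimes> a' = b \<otimes> w"
      using r unfolding q_iff divides_in_def by blast
    have "a' \<otimes> hcomp r n = hcomp (a' \<otimes> r) (n + (t + i))"
      using hcomp_mult[OF a'A w(1), of "n + (t + i)"] by simp
    also have "a' \<otimes> r = b \<otimes> w" using w a'c by (simp add: m_comm)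
    also have "hcomp (b \<otimes> w) (n + (t + i)) = b \<otimes> hcomp w (n + (t + i) - j)"
      by (rule hcomp_mult[OF b(1) w(2)])
    finally have "hcomp r n \<otimes> a' = b \<otimes> hcomp w (n + (t + i) - j)" using w a'c by (simp add: m_comm)
    then show ?thesis unfolding q_iff divides_in_def using w by auto
  qed
  \<comment> \<open>If \<open>r\<close> is not in \<open>q\<close>, then
    \<open>r \<otimes> c\<close> is again in \<open>C\<close> and its conductor contains
    \<open>q\<close>. By maximality they agree, and \<open>s\<close> belongs to this
    conductor.\<close>
  have pr: "r \<in> q \<or> s \<in> q" if r: "r \<in> A k" and s: "s \<in> A l" and rs: "r \<otimes> s \<in> q" for r s k l
  proof (rule ccontr)
    assume n: "\<not> (r \<in> q \<or> s \<in> q)"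
    have rc: "r \<in> carrier R" "s \<in> carrier R" using r s A_carrier by auto
    have "r \<otimes> c \<otimes> a = r \<otimes> a'" unfolding a'_def using rc cc ac by (simp add: m_assoc)
    moreover have "\<not> divides_in b (r \<otimes> a')" using n rc unfolding q_iff by blast
    ultimately have "r \<otimes> c \<in> C" unfolding C_def using component_mult[OF r t] by auto
    moreover have "J c \<subseteq> J (r \<otimes> c)"
    proof
      fix x assume "x \<in> J c"
      then obtain w where w: "x \<in> carrier R" "w \<in> carrier R" "x \<otimes> a' = b \<otimes> w"
        unfolding J_def a'_def divides_in_def by blast
      have "x \<otimes> (r \<otimes> c \<otimes> a) = r \<otimes> (x \<otimes> a')" unfolding a'_def using w rc cc ac by (simp add: m_ac)
      also have "\<dots> = b \<otimes> (r \<otimes> w)" unfolding w(3) using rc w bc by (simp add: m_lcomm)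
      finally show "x \<in> J (r \<otimes> c)" unfolding J_def divides_in_def using w rc by blast
    qed
    ultimately have "J (r \<otimes> c) = q" using c(2) q_def by blast
    moreover have "s \<in> J (r \<otimes> c)"
    proof -
      have "s \<otimes> (r \<otimes> c \<otimes> a) = r \<otimes> s \<otimes> a'" unfolding a'_def using rc cc ac by (simp add: m_ac)
      then show ?thesis using rs rc unfolding q_iff J_def by simp
    qed
    ultimately show False using n by blast
  qed
  have qp: "primeideal q R" "homogeneous_ideal R A q"
    by (rule homogeneous_prime[OF q.ideal_axioms one]; use hom pr in blast)+
  have bq: "b \<in> q" unfolding q_iff divides_in_def using bc a'c by blast
  have "\<exists>w\<in>q. \<exists>u\<in>carrier R. w \<otimes> a' = b \<otimes> u \<and> u \<notin> q"
  proof (rule ccontr)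
    assume no: "\<not> ?thesis"
    have step: "\<exists>u. u \<in> q \<and> w \<otimes> a' = b \<otimes> u" if wq: "w \<in> q" for w
    proof -
      obtain u where u: "u \<in> carrier R" "w \<otimes> a' = b \<otimes> u"
        using q_iff[THEN iffD1, OF wq] unfolding divides_in_def by blast
      then have "u \<in> q" using no wq by blast
      then show ?thesis using u by blast
    qed
    \<comment> \<open>If the fraction \<open>a' / b\<close> maps \<open>q\<close> into itself, its
      powers times \<open>b\<close> stay in \<open>q\<close>; \<open>normal_divides\<close> applies
      to this sequence.\<close>
    have "\<exists>f. \<forall>n::nat. f n \<in> q \<and> (n = 0 \<longrightarrow> f n = b) \<and> f n \<otimes> a' = b \<otimes> f (Suc n)"
    proof -
      have "\<exists>f. \<forall>n::nat. (f n \<in> q \<and> (n = 0 \<longrightarrow> f n = b)) \<and> f n \<otimes> a' = b \<otimes> f (Suc n)"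
      proof (rule dependent_nat_choice)
        show "\<exists>y. y \<in> q \<and> ((0::nat) = 0 \<longrightarrow> y = b)" using bq by blast
        show "\<exists>z. (z \<in> q \<and> (Suc n = 0 \<longrightarrow> z = b)) \<and> y \<otimes> a' = b \<otimes> z"
          if "y \<in> q \<and> (n = 0 \<longrightarrow> y = b)" for y n using step that by simp
      qed
      then show ?thesis by (simp only: conj_assoc)
    qed
    then obtain f where "\<forall>n::nat. f n \<in> q \<and> (n = 0 \<longrightarrow> f n = b) \<and> f n \<otimes> a' = b \<otimes> f (Suc n)" by blast
    then have f: "\<And>n. f n \<in> q" "f 0 = b" "\<And>n. f n \<otimes> a' = b \<otimes> f (Suc n)" by auto
    have fc: "f n \<in> carrier R" for n using f(1) q.a_subset by blast
    obtain n where n: "f n \<in> lin_span (carrier R) (f ` {..<n})"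
      using N fc unfolding noeth_def by blast
    have "divides_in b a'" by (rule normal_divides[OF nd a'c bc b(2) fc f(2,3) n])
    then show False using nb by blast
  qed
  then obtain w u where wu: "w \<in> q" "u \<in> carrier R" "w \<otimes> a' = b \<otimes> u" "u \<notin> q" by blast
  have wc: "w \<in> carrier R" using wu q.a_subset by blast
  have "height R q = 1"
  proof (rule height_one[OF N qp(1) bq b(2) wu(1,2,4)])
    fix x assume "x \<in> q"
    then obtain y where y: "x \<in> carrier R" "y \<in> carrier R" "x \<otimes> a' = b \<otimes> y"
      unfolding q_iff divides_in_def by blast
    \<comment> \<open>With \<open>u = w a' / b\<close> and \<open>y = x a' / b\<close>, both
      \<open>u x\<close> and \<open>w y\<close> equal \<open>w x a' / b\<close>.\<close>
    have "b \<otimes> (u \<otimes> x) = (w \<otimes> a') \<otimes> x" unfolding wu(3) using bc wu(2) y by (simp add: m_assoc)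
    also have "\<dots> = w \<otimes> (x \<otimes> a')" using wc a'c y(1) by (simp add: m_assoc m_comm[of a' x])
    also have "\<dots> = b \<otimes> (w \<otimes> y)" unfolding y(3) using wc bc y by (simp add: m_lcomm)
    finally have "u \<otimes> x = w \<otimes> y" using b(2) bc wc wu(2) y m_lcancel by simp
    then show "\<exists>y\<in>carrier R. u \<otimes> x = w \<otimes> y" using y by blast
  qed
  then have "q \<in> homogeneous_height_one_primes R A"
    unfolding homogeneous_height_one_primes_def using qp by blast
  moreover have "r \<in> q" if r: "r \<in> carrier R" "divides_in b (r \<otimes> a)" for r
  proof -
    obtain w where w: "w \<in> carrier R" "r \<otimes> a = b \<otimes> w" using r unfolding divides_in_def by blast
    have "r \<otimes> a' = c \<otimes> (r \<otimes> a)" unfolding a'_def using r cc ac by (simp add: m_lcomm)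
    also have "\<dots> = b \<otimes> (c \<otimes> w)" unfolding w(2) using cc bc w by (simp add: m_lcomm)
    finally show ?thesis unfolding q_iff divides_in_def using r cc w by blast
  qed
  ultimately show ?thesis by (rule that)
qed

end

section \<open>Veronese subrings of smaller index\<close>

context graded_affine_domain
begin

text \<open>A homogeneous derivation \<open>D\<close> of \<open>V (m * p)\<close> can only extend to \<open>V m\<close> by
  \<open>E x = D (x\<^sup>p) / (p x [^] (p - 1))\<close>. The denominators avoid every homogeneous prime \<open>q\<close> of height one:
  if \<open>h \<notin> q\<close> has degree \<open>m k\<close> with \<open>k\<close> prime to \<open>p\<close>, then \<open>h [^] l \<otimes> x \<in> V (m * p)\<close> for some \<open>l\<close>, so a power
  of \<open>h\<close> clears the denominator. With \<open>u = x\<^sup>p\<close> one has \<open>p\<^sup>p u [^] (p - 1) (E x)\<^sup>p = (D u)\<^sup>p\<close>, so the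
  degree of \<open>(E x)\<^sup>p\<close> with respect to \<open>D\<close> is smaller than that of \<open>x\<^sup>p\<close> by \<open>p\<close>.\<close>

lemma extend_along_prime:
  assumes nd: "normal_domain R" and m: "m > 0" and p: "Factorial_Ring.prime p"
    and nr: "hom_nonrigid (m * p)"
    and h: "\<And>q. q \<in> homogeneous_height_one_primes R A \<Longrightarrow>
      \<exists>h k. h \<in> A (int m * k) \<and> h \<notin> q \<and> \<not> int p dvd k"
  shows "hom_nonrigid m"
proof -
  define d where "d = m * p"
  have p0: "p > 0" using p prime_gt_0_nat by blast
  have md: "int m dvd i" if "int d dvd i" for i using that unfolding d_def by (metis dvd_mult_left of_nat_mult)
  obtain \<delta> D i0 x0 where D: "hom_lnd d \<delta> D" and x0: "x0 \<in> A i0" "int d dvd i0" "D x0 \<noteq> \<zero>"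
    using nr unfolding hom_nonrigid_def d_def by blast
  interpret lnd R "V d" D using D by (simp add: hom_lnd_def)
  have d\<delta>: "int d dvd \<delta>" and D_A: "\<And>i x. x \<in> A i \<Longrightarrow> int d dvd i \<Longrightarrow> D x \<in> A (i + \<delta>)"
    using D unfolding hom_lnd_def by auto
  have dp: "int d dvd int p * j" if "int m dvd j" for j
    using that unfolding d_def by (simp add: mult.commute mult_dvd_mono)
  have powp: "x [^] p = x [^] (p - 1) \<otimes> x" if "x \<in> carrier R" for x
    using p0 that by (metis Suc_diff_1 nat_pow_Suc)
  have D_powp: "D (x [^] p) = nat_el p \<otimes> (x [^] (p - 1) \<otimes> D x)" if "x \<in> V d" for x
    using D_pow[OF that, of "p - 1"] p0 by simp
  have pV: "x [^] p \<in> V d" "x [^] p \<in> A (int p * j)" if "x \<in> A j" "int m dvd j" for x j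
    using A_pow[OF that(1), of p] A_V[OF _ dp[OF that(2)]] by auto
  obtain v where v: "v \<in> F" "v \<otimes> nat_el p = \<one>" by (rule nat_el_inverse[OF p0]) (rule that)
  have vc: "v \<in> carrier R" using v F_carrier by blast
  have np: "nat_el p \<noteq> \<zero>" by (rule char0[OF p0])
  have div: "divides_in (nat_el p \<otimes> x [^] (p - 1)) (D (x [^] p))"
    if x: "x \<in> A j" "int m dvd j" "x \<noteq> \<zero>" for x j
  proof (rule ccontr)
    let ?a = "D (x [^] p)" and ?b = "nat_el p \<otimes> x [^] (p - 1)"
    assume nab: "\<not> divides_in ?b ?a"
    have xc: "x \<in> carrier R" using A_carrier x by blast
    have aA: "?a \<in> A (int p * j + \<delta>)" using D_A[OF pV(2)[OF x(1,2)] dp[OF x(2)]] .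
    have ac: "?a \<in> carrier R" using A_carrier aA by blast
    have bA: "?b \<in> A (0 + int (p - 1) * j)"
      using component_mult[OF F_A[OF F_rules(6)] A_pow[OF x(1)]] .
    have b0: "?b \<noteq> \<zero>" using np x xc pow_eq_zero by (auto simp: integral_iff)
    have bc: "?b \<in> carrier R" using xc by simp
    obtain q where q: "q \<in> homogeneous_height_one_primes R A"
      "\<And>r. r \<in> carrier R \<Longrightarrow> divides_in ?b (r \<otimes> ?a) \<Longrightarrow> r \<in> q"
      by (rule conductor_height_one[OF noeth_carrier nd aA bA b0 nab]) (rule that)
    obtain h k where h: "h \<in> A (int m * k)" "h \<notin> q" "\<not> int p dvd k" using h[OF q(1)] by blast
    obtain j' where j': "j = int m * j'" using x(2) by blast
    \<comment> \<open>The exponent \<open>l\<close> moves the degree of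
      \<open>h [^] l \<otimes> x\<close> into the multiples of \<open>d\<close>, so that
      \<open>D\<close> is defined on this product \<open>g\<close>, as it is on
      \<open>H\<close>.\<close>
    obtain l :: nat where l: "int p dvd int l * k + j'" using prime_solve[OF p h(3)] by blast
    have hc: "h \<in> carrier R" using h A_carrier by blast
    define g where "g = h [^] l \<otimes> x"
    define H where "H = (h [^] p) [^] l"
    have gA: "g \<in> A (int l * (int m * k) + j)" unfolding g_def by (rule component_mult[OF A_pow[OF h(1)] x(1)])
    have "int l * (int m * k) + j = int m * (int l * k + j')" unfolding j' by (simp add: algebra_simps)
    then have "int d dvd int l * (int m * k) + j" unfolding d_def using l by (simp add: mult_dvd_mono)
    then have gV: "g \<in> V d" using A_V gA by blast
    have HV: "H \<in> V d" unfolding H_def by (rule V_rules(7)[OF pV(1)[OF h(1)]]) simp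
    have gc: "g \<in> carrier R" and Hc: "H \<in> carrier R" and Dgc: "D g \<in> carrier R" and DHc: "D H \<in> carrier R"
      using gV HV D_closed Vc by auto
    have gp: "g [^] p = H \<otimes> x [^] p"
      unfolding g_def H_def using hc xc by (simp add: nat_pow_distrib nat_pow_pow mult.commute)
    have gp1: "g [^] (p - 1) = (h [^] l) [^] (p - 1) \<otimes> x [^] (p - 1)"
      unfolding g_def using hc xc by (simp add: nat_pow_distrib)
    have "D (g [^] p) = D H \<otimes> x [^] p \<oplus> H \<otimes> ?a"
      unfolding gp using HV pV(1)[OF x(1,2)] by (simp add: D_mult)
    \<comment> \<open>Solving the Leibniz rule for \<open>g [^] p = H \<otimes> x [^] p\<close>: the
      first term contains \<open>p g [^] (p - 1)\<close>, the second \<open>x [^] p\<close>, and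
      \<open>v\<close> is the inverse of \<open>p\<close>, so \<open>?b\<close> divides both. Thus
      \<open>H\<close> lies in the conductor prime, although \<open>h\<close> does not.\<close>
    then have "H \<otimes> ?a = D (g [^] p) \<oplus> \<ominus> (D H \<otimes> x [^] p)"
      using DHc Hc xc ac by (simp add: a_comm[of "D H \<otimes> x [^] p"] a_assoc r_neg)
    also have "D (g [^] p) = ?b \<otimes> ((h [^] l) [^] (p - 1) \<otimes> D g)"
      unfolding D_powp[OF gV] gp1 using hc xc Dgc by (simp add: m_ac)
    also have "D H \<otimes> x [^] p = ?b \<otimes> (v \<otimes> x \<otimes> D H)"
    proof -
      have "?b \<otimes> (v \<otimes> x \<otimes> D H) = (v \<otimes> nat_el p) \<otimes> (D H \<otimes> (x [^] (p - 1) \<otimes> x))"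
        using vc xc DHc by (simp add: m_ac)
      then show ?thesis using powp[OF xc] v xc DHc by simp
    qed
    also have "?b \<otimes> ((h [^] l) [^] (p - 1) \<otimes> D g) \<oplus> \<ominus> (?b \<otimes> (v \<otimes> x \<otimes> D H))
        = ?b \<otimes> ((h [^] l) [^] (p - 1) \<otimes> D g \<oplus> \<ominus> (v \<otimes> x \<otimes> D H))"
      using bc hc Dgc DHc vc xc by (simp add: r_distr r_minus)
    finally have "divides_in ?b (H \<otimes> ?a)"
      unfolding divides_in_def by (rule bexI) (use hc Dgc DHc vc xc in auto)
    then have "H \<in> q" using q(2) Hc by blast
    moreover have "primeideal q R" using q(1) unfolding homogeneous_height_one_primes_def by blast
    ultimately show False using primeideal_pow h(2) hc unfolding H_def by (metis nat_pow_closed)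
  qed
  define E where "E x = (if x = \<zero> then \<zero> else SOME y. y \<in> carrier R \<and> D (x [^] p) = nat_el p \<otimes> x [^] (p - 1) \<otimes> y)" for x
  \<comment> \<open>The defining equation is multiplied by \<open>x\<close>, so that it reads the
    same for \<open>x = \<zero>\<close> and involves only \<open>x [^] p\<close>.\<close>
  have E: "E x \<in> A (j + \<delta>)" "E x \<in> carrier R" "nat_el p \<otimes> x [^] p \<otimes> E x = x \<otimes> D (x [^] p)"
    if x: "x \<in> A j" "int m dvd j" for x j
  proof -
    have "E x \<in> A (j + \<delta>) \<and> nat_el p \<otimes> x [^] p \<otimes> E x = x \<otimes> D (x [^] p)"
    proof (cases "x = \<zero>")
      case True
      then show ?thesis unfolding E_def using p0 by (simp add: nat_pow_zero)
    next
      case False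
      have xc: "x \<in> carrier R" using A_carrier x by blast
      have "\<exists>y. y \<in> carrier R \<and> D (x [^] p) = nat_el p \<otimes> x [^] (p - 1) \<otimes> y"
        using div[OF x False] unfolding divides_in_def by blast
      then have "E x \<in> carrier R \<and> D (x [^] p) = nat_el p \<otimes> x [^] (p - 1) \<otimes> E x"
        unfolding E_def using False someI_ex[of "\<lambda>y. y \<in> carrier R \<and> D (x [^] p) = nat_el p \<otimes> x [^] (p - 1) \<otimes> y"]
        by simp
      then have y: "E x \<in> carrier R" "D (x [^] p) = nat_el p \<otimes> x [^] (p - 1) \<otimes> E x" by auto
      have bA: "nat_el p \<otimes> x [^] (p - 1) \<in> A (0 + int (p - 1) * j)"
        using component_mult[OF F_A[OF F_rules(6)] A_pow[OF x(1)]] .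
      have b0: "nat_el p \<otimes> x [^] (p - 1) \<noteq> \<zero>" using np False xc pow_eq_zero by (auto simp: integral_iff)
      have "nat_el p \<otimes> x [^] (p - 1) \<otimes> E x \<in> A (int p * j + \<delta>)"
        using D_A[OF pV(2)[OF x] dp[OF x(2)]] y(2) by simp
      then have "E x \<in> A (int p * j + \<delta> - (0 + int (p - 1) * j))" by (rule quotient_degree[OF bA b0 y(1)])
      moreover have "int p * j + \<delta> - (0 + int (p - 1) * j) = j + \<delta>"
        using p0 by (simp add: of_nat_diff algebra_simps)
      ultimately have "E x \<in> A (j + \<delta>)" by (simp only:)
      moreover have "nat_el p \<otimes> x [^] p \<otimes> E x = x \<otimes> D (x [^] p)"
      proof -
        have "x \<otimes> D (x [^] p) = x \<otimes> (nat_el p \<otimes> x [^] (p - 1) \<otimes> E x)" using y(2) by (rule arg_cong)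
        also have "\<dots> = nat_el p \<otimes> (x [^] (p - 1) \<otimes> x) \<otimes> E x" using xc y(1) by (simp add: m_ac)
        finally show ?thesis unfolding powp[OF xc, symmetric] by (rule sym)
      qed
      ultimately show ?thesis by blast
    qed
    then show "E x \<in> A (j + \<delta>)" "nat_el p \<otimes> x [^] p \<otimes> E x = x \<otimes> D (x [^] p)" by auto
    then show "E x \<in> carrier R" using A_carrier by blast
  qed
  have E_unique: "y = E x"
    if x: "x \<in> A j" "int m dvd j" "x \<noteq> \<zero>" and y: "y \<in> carrier R" "nat_el p \<otimes> x [^] p \<otimes> y = x \<otimes> D (x [^] p)" for x y j
  proof -
    have xc: "x \<in> carrier R" using A_carrier x by blast
    have "nat_el p \<otimes> x [^] p \<noteq> \<zero>" using np x(3) xc pow_eq_zero by (auto simp: integral_iff)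
    then show ?thesis using y E[OF x(1,2)] xc m_lcancel[of "nat_el p \<otimes> x [^] p" y "E x"] by simp
  qed
  have E0: "E \<zero> = \<zero>" by (simp add: E_def)
  have ED: "E x = D x" if x: "x \<in> A j" "int d dvd j" for x j
  proof (cases "x = \<zero>")
    case False
    have xV: "x \<in> V d" using A_V x by blast
    have c: "x \<in> carrier R" "D x \<in> carrier R" using xV D_closed Vc by auto
    have "nat_el p \<otimes> x [^] p \<otimes> D x = x \<otimes> D (x [^] p)"
    proof -
      have "x \<otimes> D (x [^] p) = x \<otimes> (nat_el p \<otimes> (x [^] (p - 1) \<otimes> D x))"
        using D_powp[OF xV] by (rule arg_cong)
      also have "\<dots> = nat_el p \<otimes> (x [^] (p - 1) \<otimes> x) \<otimes> D x" using c by (simp add: m_ac)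
      finally show ?thesis unfolding powp[OF c(1), symmetric] by (rule sym)
    qed
    then show ?thesis using E_unique[OF x(1) md[OF x(2)] False c(2)] by simp
  qed (simp add: E0)
  have E_mult: "E (x \<otimes> y) = E x \<otimes> y \<oplus> x \<otimes> E y"
    if x: "x \<in> A i" "int m dvd i" and y: "y \<in> A j" "int m dvd j" for x y i j
  proof (cases "x = \<zero> \<or> y = \<zero>")
    case True
    then show ?thesis using E0 E(2)[OF x] E(2)[OF y] A_carrier[OF x(1)] A_carrier[OF y(1)] by auto
  next
    case False
    have c: "x \<in> carrier R" "y \<in> carrier R" using x y A_carrier by auto
    note Ec = E(2)[OF x] E(2)[OF y]
    have Du: "D (x [^] p) \<in> carrier R" "D (y [^] p) \<in> carrier R"
      using pV(1)[OF x] pV(1)[OF y] D_closed Vc by auto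
    have xy: "(x \<otimes> y) [^] p = x [^] p \<otimes> y [^] p" using c by (simp add: nat_pow_distrib)
    have "nat_el p \<otimes> (x \<otimes> y) [^] p \<otimes> (E x \<otimes> y \<oplus> x \<otimes> E y)
        = (nat_el p \<otimes> x [^] p \<otimes> E x) \<otimes> (y \<otimes> y [^] p) \<oplus> (nat_el p \<otimes> y [^] p \<otimes> E y) \<otimes> (x \<otimes> x [^] p)"
      unfolding xy using c Ec by (simp add: r_distr m_ac)
    also have "\<dots> = (x \<otimes> D (x [^] p)) \<otimes> (y \<otimes> y [^] p) \<oplus> (y \<otimes> D (y [^] p)) \<otimes> (x \<otimes> x [^] p)"
      unfolding E(3)[OF x] E(3)[OF y] ..
    also have "\<dots> = (x \<otimes> y) \<otimes> D ((x \<otimes> y) [^] p)"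
      unfolding xy D_mult[OF pV(1)[OF x] pV(1)[OF y]] using c Du by (simp add: r_distr m_ac)
    finally have "nat_el p \<otimes> (x \<otimes> y) [^] p \<otimes> (E x \<otimes> y \<oplus> x \<otimes> E y) = (x \<otimes> y) \<otimes> D ((x \<otimes> y) [^] p)" .
    moreover have "x \<otimes> y \<noteq> \<zero>" using False c integral by blast
    ultimately show ?thesis
      using E_unique[OF component_mult[OF x(1) y(1)] dvd_add[OF x(2) y(2)], of "E x \<otimes> y \<oplus> x \<otimes> E y"] c Ec by simp
  qed
  have E_add: "E (x \<oplus> y) = E x \<oplus> E y" if x: "x \<in> A j" and y: "y \<in> A j" and j: "int m dvd j" for x y j
  proof (cases "x = \<zero>")
    case True
    then show ?thesis using E0 E(2)[OF y j] A_carrier[OF y] by simp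
  next
    case False
    \<comment> \<open>Additivity is not visible in the formula. For \<open>z\<close> of degree
      \<open>j\<close> the product \<open>z \<otimes> t\<close> has degree \<open>p * j\<close>,
      where \<open>E\<close> agrees with the additive \<open>D\<close>; the Leibniz rule transfers
      additivity to \<open>E\<close>, and \<open>t\<close> cancels.\<close>
    define t where "t = x [^] (p - 1)"
    note xy = A_add[OF x y]
    have c: "x \<in> carrier R" "y \<in> carrier R" using x y A_carrier by auto
    have tA: "t \<in> A (int (p - 1) * j)" unfolding t_def by (rule A_pow[OF x])
    have tm: "int m dvd int (p - 1) * j" using j by simp
    have tc: "t \<in> carrier R" and t0: "t \<noteq> \<zero>" unfolding t_def using c False pow_eq_zero by auto
    note Ec = E(2)[OF x j] E(2)[OF y j] E(2)[OF xy j] E(2)[OF tA tm]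
    have deg: "j + int (p - 1) * j = int p * j" using p0 by (simp add: of_nat_diff algebra_simps)
    have zt: "E z \<otimes> t \<oplus> z \<otimes> E t = D (z \<otimes> t)" "z \<otimes> t \<in> V d" if z: "z \<in> A j" for z
    proof -
      have ztA: "z \<otimes> t \<in> A (int p * j)" using component_mult[OF z tA] deg by simp
      show "z \<otimes> t \<in> V d" by (rule A_V[OF ztA dp[OF j]])
      show "E z \<otimes> t \<oplus> z \<otimes> E t = D (z \<otimes> t)" using ED[OF ztA dp[OF j]] E_mult[OF z j tA tm] by simp
    qed
    have "E (x \<oplus> y) \<otimes> t \<oplus> (x \<oplus> y) \<otimes> E t = D (x \<otimes> t) \<oplus> D (y \<otimes> t)"
      using zt(1)[OF xy] zt(2)[OF x] zt(2)[OF y] c tc by (simp add: l_distr D_add)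
    also have "\<dots> = (E x \<oplus> E y) \<otimes> t \<oplus> (x \<oplus> y) \<otimes> E t"
      unfolding zt(1)[OF x, symmetric] zt(1)[OF y, symmetric] using c tc Ec by (simp add: l_distr a_ac)
    finally have "E (x \<oplus> y) \<otimes> t = (E x \<oplus> E y) \<otimes> t"
      by (rule add.right_cancel[THEN iffD1, rotated 3]) (use c tc Ec in simp_all)
    then show ?thesis using m_rcancel[OF t0 tc] Ec by simp
  qed
  have E_drop: "(D ^^ n) ((E x) [^] p) = \<zero>"
    if x: "x \<in> A j" "int m dvd j" and z: "(D ^^ Suc n) (x [^] p) = \<zero>" for x j n
  proof -
    let ?u = "x [^] p"
    have xc: "x \<in> carrier R" using A_carrier x by blast
    note Ec = E(2)[OF x]
    have j\<delta>: "int m dvd j + \<delta>" using x(2) md[OF d\<delta>] by simp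
    have uV: "?u \<in> V d" and EV: "E x [^] p \<in> V d" using pV(1)[OF x] pV(1)[OF E(1)[OF x] j\<delta>] by auto
    have DuV: "D ?u \<in> V d" by (rule D_closed[OF uV])
    have uc: "?u \<in> carrier R" "D ?u \<in> carrier R" using uV DuV Vc by auto
    have EpowC: "E x [^] p \<in> carrier R" using Ec by simp
    show ?thesis
    proof (cases "E x = \<zero>")
      case True
      then show ?thesis using p0 by (simp add: nat_pow_zero)
    next
      case False
      then have x0: "x \<noteq> \<zero>" using E0 by auto
      then have u0: "?u \<noteq> \<zero>" using pow_eq_zero xc by blast
      have "(nat_el p \<otimes> ?u \<otimes> E x) [^] p = (x \<otimes> D ?u) [^] p" using E(3)[OF x] by simp
      then have "nat_el p [^] p \<otimes> ?u [^] p \<otimes> E x [^] p = ?u \<otimes> D ?u [^] p"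
        using xc uc Ec by (simp add: nat_pow_distrib)
      then have "?u \<otimes> (nat_el p [^] p \<otimes> ?u [^] (p - 1) \<otimes> E x [^] p) = ?u \<otimes> D ?u [^] p"
        unfolding powp[OF uc(1)] using uc EpowC by (simp add: m_ac)
      then have eq: "nat_el p [^] p \<otimes> ?u [^] (p - 1) \<otimes> E x [^] p = D ?u [^] p"
        using m_lcancel[OF u0] uc EpowC by simp
      have np': "nat_el p [^] p \<noteq> \<zero>" using pow_eq_zero[OF nat_el_closed] np by blast
      have Ep0: "E x [^] p \<noteq> \<zero>" using False pow_eq_zero[OF Ec] by blast
      have "D ?u \<noteq> \<zero>"
      proof
        assume "D ?u = \<zero>"
        then have "nat_el p [^] p \<otimes> ?u [^] (p - 1) \<otimes> E x [^] p = \<zero>" using eq p0 by (simp add: nat_pow_zero)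
        then show False using np' Ep0 u0 pow_eq_zero uc EpowC by (auto simp: integral_iff)
      qed
      \<comment> \<open>If \<open>u\<close> and the \<open>p\<close>-th power of \<open>E x\<close>
        have degrees \<open>k\<close> and \<open>r\<close>, the equation gives
        \<open>(p - 1) * k + r = p * (k - 1)\<close>, that is \<open>r = k - p\<close>.\<close>
      obtain k where k: "has_deg k ?u" using has_deg_ex[OF uV u0] by blast
      have "k \<noteq> 0" using k \<open>D ?u \<noteq> \<zero>\<close> unfolding has_deg_def by (cases k) auto
      then obtain k' where k': "k = Suc k'" using not0_implies_Suc by blast
      have deg1: "has_deg (p * k') (D ?u [^] p)" using has_deg_pow[OF has_deg_D] k k' by blast
      obtain r where r: "has_deg r (E x [^] p)" using has_deg_ex[OF EV Ep0] by blast
      have cV: "nat_el p [^] p \<in> V d" by (rule V_rules(7)[OF V_rules(6)])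
      have "has_deg 0 (nat_el p [^] p)" unfolding has_deg_def using cV np' D_ker_pow[OF V_rules(6) D_nat_el] by simp
      then have "has_deg (0 + (p - 1) * k + r) (nat_el p [^] p \<otimes> ?u [^] (p - 1) \<otimes> E x [^] p)"
        by (intro has_deg_mult has_deg_pow k r)
      then have "p * k' = (p - 1) * k + r" using has_deg_unique[OF deg1] unfolding eq by simp
      then have "(p - 1) * k + r + p = p * k" using k' by simp
      moreover have "p * k = (p - 1) * k + k" using p0 by (metis Suc_diff_1 add.commute mult_Suc)
      ultimately have "r + p = k" by simp
      moreover have "k < Suc n" using has_deg_zero_iff[OF k] z by blast
      ultimately have "r < n" using p0 by simp
      then show ?thesis using has_deg_zero_iff[OF r] by blast
    qed
  qed
  have E_nilp: "(E ^^ n) x = \<zero>" if "x \<in> A j" "int m dvd j" "(D ^^ n) (x [^] p) = \<zero>" for n x j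
    using that
  proof (induction n arbitrary: x j)
    case 0
    then show ?case using pow_eq_zero A_carrier by (metis funpow_0)
  next
    case (Suc n)
    have "int m dvd j + \<delta>" using Suc.prems(2) md[OF d\<delta>] by simp
    then have "(E ^^ n) (E x) = \<zero>"
      using Suc.IH[OF E(1)[OF Suc.prems(1,2)]] E_drop[OF Suc.prems] by blast
    then show ?case by (simp add: funpow_swap1)
  qed
  have "\<exists>D'. hom_lnd m \<delta> D' \<and> (\<forall>i x. x \<in> A i \<longrightarrow> int m dvd i \<longrightarrow> D' x = E x)"
  proof (rule extend_hom[of m \<delta> E])
    show "int m dvd \<delta>" by (rule md[OF d\<delta>])
    show "\<exists>n. (E ^^ n) x = \<zero>" if "x \<in> A i" "int m dvd i" for i x
      using D_nilp[OF pV(1)[OF that]] E_nilp[OF that] by blast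
  qed (use E(1) E_add E_mult in blast)+
  then obtain D' where D': "hom_lnd m \<delta> D'" "\<And>i x. x \<in> A i \<Longrightarrow> int m dvd i \<Longrightarrow> D' x = E x" by blast
  have "D' x0 \<noteq> \<zero>" using D'(2)[OF x0(1) md[OF x0(2)]] ED[OF x0(1,2)] x0(3) by simp
  then show ?thesis unfolding hom_nonrigid_def using D'(1) x0 md by blast
qed

end

section \<open>Maximal elements\<close>

lemma multiples_subset_iff: "d > 0 \<Longrightarrow> multiples d \<subseteq> multiples d' \<longleftrightarrow> d' dvd d"
proof
  assume "d > 0" "multiples d \<subseteq> multiples d'"
  moreover have "d \<in> multiples d" unfolding multiples_def by (auto intro: exI[of _ 1])
  ultimately show "d' dvd d" unfolding multiples_def by auto
next
  assume d: "d > 0" "d' dvd d"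
  then obtain j where "d = d' * j" by blast
  then have "j > 0" "\<And>k. k * d = (k * j) * d'" using d(1) by auto
  then show "multiples d \<subseteq> multiples d'" unfolding multiples_def by fastforce
qed

lemma prime_part_decompose:
  fixes m p :: nat
  assumes "m * p > 0" "Factorial_Ring.prime p"
  obtains c k where "multiplicity p (m * p) = Suc k" "m * p = p ^ Suc k * c" "m = p ^ k * c" "\<not> p dvd c"
proof -
  have m: "m \<noteq> 0" and p: "p \<noteq> 0" and np: "\<not> is_unit p"
    using assms not_prime_unit by (auto intro!: notI)
  define k where "k = multiplicity p m"
  obtain c where c: "m = p ^ k * c" "\<not> p dvd c"
    using multiplicity_decompose'[OF m np] unfolding k_def by blast
  have "multiplicity p (m * p) = Suc k"
    unfolding k_def using m assms(2) by (simp add: prime_elem_multiplicity_mult_distrib p)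
  moreover have "m * p = p ^ Suc k * c" using c(1) by simp
  ultimately show ?thesis using that c by blast
qed

context graded_affine_domain
begin

lemma NR_iff: "d \<in> NR R A \<longleftrightarrow> d > 0 \<and> hom_nonrigid d"
  unfolding NR_def using nonrigid_iff_hom by blast

lemma NR_multiple: "d \<in> NR R A \<Longrightarrow> k > 0 \<Longrightarrow> k * d \<in> NR R A"
  using nonrigid_multiple[of d k] unfolding NR_def by (simp add: mult.commute)

lemma maximal_NR_iff:
  "d \<in> maximal_NR R A \<longleftrightarrow> d \<in> NR R A \<and> (\<forall>d'\<in>NR R A. d' dvd d \<longrightarrow> d' = d)"
  unfolding maximal_NR_def using multiples_subset_iff[of d] by (auto simp: NR_iff)

lemma NR_eq: "NR R A = (\<Union>d \<in> maximal_NR R A. multiples d)"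
proof
  show "(\<Union>d \<in> maximal_NR R A. multiples d) \<subseteq> NR R A"
    unfolding multiples_def using NR_multiple by (auto simp: maximal_NR_iff)
  show "NR R A \<subseteq> (\<Union>d \<in> maximal_NR R A. multiples d)"
  proof
    fix n assume n: "n \<in> NR R A"
    define d where "d = (LEAST d. d dvd n \<and> d \<in> NR R A)"
    have d: "d dvd n" "d \<in> NR R A"
      unfolding d_def using LeastI[of "\<lambda>d. d dvd n \<and> d \<in> NR R A" n] n by auto
    have "d' = d" if "d' \<in> NR R A" "d' dvd d" for d'
    proof -
      have "d \<le> d'" unfolding d_def using that d(1) by (intro Least_le) (auto intro: dvd_trans)
      moreover have "d' \<le> d" using that(2) d(2) by (auto simp: NR_iff intro: dvd_imp_le)
      ultimately show ?thesis by simp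
    qed
    then have "d \<in> maximal_NR R A" using d(2) maximal_NR_iff by blast
    moreover obtain k where "n = k * d" using d(1) by (metis dvdE mult.commute)
    moreover then have "k > 0" using n by (cases k) (auto simp: NR_iff)
    ultimately show "n \<in> (\<Union>d \<in> maximal_NR R A. multiples d)" unfolding multiples_def by blast
  qed
qed

lemma maximal_no_divisor:
  assumes "d \<in> maximal_NR R A" "d = m * p" "p > 1" shows "\<not> hom_nonrigid m"
proof
  assume "hom_nonrigid m"
  moreover have "m > 0" using assms by (cases m) (auto simp: maximal_NR_iff NR_iff)
  ultimately have "m \<in> NR R A" by (simp add: NR_iff)
  then have "m = d" using assms unfolding maximal_NR_iff by auto
  then show False using assms \<open>m > 0\<close> by simp
qed

lemma int_grading_e: "int (grading_e R A) = Gcd {n. A n \<noteq> {\<zero>}}"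
  unfolding grading_e_def by simp

text \<open>Otherwise the full \<open>p\<close>-part of \<open>d\<close> divides every degree in the
  support of the grading, so there divisibility by \<open>d / p\<close> already implies divisibility
  by \<open>d\<close>. The case \<open>e = 0\<close>, with infinite valuation, behaves
  alike.\<close>

lemma maximal_val:
  assumes d: "d \<in> maximal_NR R A" and p: "Factorial_Ring.prime p" "p dvd d"
  shows "val p d > val p (grading_e R A)"
proof (rule ccontr)
  let ?e = "grading_e R A" and ?k = "multiplicity p d"
  have d0: "d > 0" using d by (simp add: maximal_NR_iff NR_iff)
  assume "\<not> val p d > val p ?e"
  then have "?e = 0 \<or> ?k \<le> multiplicity p ?e"
    unfolding val_def using d0 by (auto simp: not_less split: if_splits)
  then have pe: "p ^ ?k dvd ?e" using multiplicity_dvd' by fastforce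
  obtain m where m: "d = m * p" using p by (metis dvdE mult.commute)
  have "int d dvd n" if n: "A n \<noteq> {\<zero>}" "int m dvd n" for n
  proof -
    have "Gcd {n. A n \<noteq> {\<zero>}} dvd n" by (rule Gcd_dvd) (use n in simp)
    then have "int (p ^ ?k) dvd n" using pe int_grading_e by (metis dvd_trans of_nat_dvd_iff)
    then have pk: "p ^ ?k dvd nat \<bar>n\<bar>" by (simp only: dvd_nat_abs_iff)
    have mn: "m dvd nat \<bar>n\<bar>" using n(2) by (simp only: dvd_nat_abs_iff)
    obtain c k where c: "?k = Suc k" "d = p ^ Suc k * c" "m = p ^ k * c" "\<not> p dvd c"
      unfolding m by (rule prime_part_decompose[of m p]) (use d0 m p in auto)
    have "c dvd nat \<bar>n\<bar>" using mn unfolding c(3) by (rule dvd_mult_right)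
    moreover have "coprime (p ^ Suc k) c" using c(4) p(1) by (simp add: prime_imp_coprime)
    moreover have "p ^ Suc k dvd nat \<bar>n\<bar>" using pk c(1) by simp
    ultimately have "d dvd nat \<bar>n\<bar>" unfolding c(2) by (intro semiring_gcd_class.divides_mult)
    then show ?thesis by (simp only: dvd_nat_abs_iff)
  qed
  then have "A n \<subseteq> {\<zero>}" if "int m dvd n" "\<not> int d dvd n" for n using that by blast
  then have "V m \<subseteq> V d"
    unfolding V_def by (auto dest: hcomp_A)
  moreover have "V d \<subseteq> V m" by (rule V_mono) (simp add: m)
  ultimately have "V m = V d" by blast
  then have "veronese R A m = veronese R A d" unfolding veronese_V by simp
  then have "hom_nonrigid m"
    using d nonrigid_iff_hom[of m] m d0 unfolding maximal_NR_iff NR_def by (cases m) auto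
  then show False using maximal_no_divisor[OF d m] prime_gt_1_nat[OF p(1)] by blast
qed

text \<open>By \<open>maximal_val\<close> the product defining \<open>\<oslash>\<close> runs over
  all prime factors of \<open>d\<close>, so it is the prime factorization of
  \<open>d\<close>.\<close>

lemma maximal_oslash:
  assumes d: "d \<in> maximal_NR R A" shows "d \<oslash> grading_e R A = d"
proof -
  have d0: "d > 0" using d by (simp add: maximal_NR_iff NR_iff)
  have "{p. Factorial_Ring.prime p \<and> val p d > val p (grading_e R A)} = prime_factors d"
  proof (intro equalityI subsetI)
    fix p assume "p \<in> {p. Factorial_Ring.prime p \<and> val p d > val p (grading_e R A)}"
    then have "Factorial_Ring.prime p" "val p d > 0" by (auto intro: le_less_trans)
    then show "p \<in> prime_factors d"
      using d0 by (auto simp: val_def prime_factors_multiplicity zero_enat_def)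
  qed (use maximal_val[OF d] in \<open>auto simp: in_prime_factors_iff\<close>)
  then show ?thesis unfolding oslash_def using prime_factorization_nat[of d] d0 by simp
qed

lemma maximal_dvd_ebar:
  assumes nd: "normal_domain R" and d: "d \<in> maximal_NR R A"
  shows "d dvd grading_ebar R A"
proof (rule ccontr)
  let ?Z = "homogeneous_height_one_primes R A" and ?E = "grading_ebar R A"
  assume nE: "\<not> d dvd ?E"
  have d0: "d > 0" and nr: "hom_nonrigid d" using d by (auto simp: maximal_NR_iff NR_iff)
  \<comment> \<open>A homogeneous \<open>x\<close> outside the kernel is not a unit, so the fraction
    \<open>1 / x\<close> has a conductor prime. Hence \<open>grading_ebar\<close> is given by its
    lcm branch.\<close>
  have Z: "?Z \<noteq> {}"
  proof -
    obtain \<delta> D i x where D: "hom_lnd d \<delta> D" and x: "x \<in> A i" "int d dvd i" "D x \<noteq> \<zero>"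
      using nr unfolding hom_nonrigid_def by blast
    interpret lnd R "V d" D using D by (simp add: hom_lnd_def)
    have "\<not> divides_in x \<one>"
    proof
      assume "divides_in x \<one>"
      then obtain w where w: "w \<in> carrier R" "\<one> = x \<otimes> w" unfolding divides_in_def by blast
      have "x \<noteq> \<zero>" using x(3) by auto
      then have "w \<in> A (0 - i)" using quotient_degree[OF x(1) _ w(1)] w(2) one_A by metis
      then have "w \<in> V d" using A_V x(2) by fastforce
      then show False using unit_ker[OF A_V[OF x(1,2)]] w(2) x(3) by metis
    qed
    moreover have "x \<noteq> \<zero>" using x(3) by auto
    ultimately show ?thesis using conductor_height_one[OF noeth_carrier nd one_A x(1)] by blast
  qed
  have E0: "?E \<noteq> 0" using nE by (cases "?E = 0") auto
  obtain p where p: "Factorial_Ring.prime p" "multiplicity p d > multiplicity p ?E"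
    using multiplicity_le_imp_dvd[of d ?E] d0 nE by (metis not_gr0 not_le)
  have pd: "p dvd d" using p(2) not_dvd_imp_multiplicity_0[of p d] by fastforce
  obtain m where m: "d = m * p" using pd by (metis dvdE mult.commute)
  obtain c l where c: "multiplicity p d = Suc l" "d = p ^ Suc l * c" "m = p ^ l * c" "\<not> p dvd c"
    unfolding m by (rule prime_part_decompose[of m p]) (use d0 m p in auto)
  define k where "k = Suc l"
  have pE: "\<not> p ^ k dvd ?E"
    using p(2) E0 p(1) not_prime_unit[of p] unfolding k_def c(1)[symmetric]
    by (subst power_dvd_iff_le_multiplicity) auto
  have "\<exists>h j. h \<in> A (int m * j) \<and> h \<notin> q \<and> \<not> int p dvd j" if q: "q \<in> ?Z" for q
  proof -
    let ?e = "grading_e (R Quot q) (quotient_grading R A q)"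
    have pq: "primeideal q R" using q unfolding homogeneous_height_one_primes_def by blast
    interpret q: primeideal q R by fact
    have "?e dvd ?E" unfolding grading_ebar_def using Z q by (simp add: dvd_Lcm)
    then have "\<not> p ^ k dvd ?e" using pE dvd_trans by blast
    then have "\<not> int (p ^ k) dvd int ?e" unfolding of_nat_dvd_iff .
    moreover have "int ?e = Gcd {n. quotient_grading R A q n \<noteq> {\<zero>\<^bsub>R Quot q\<^esub>}}"
      unfolding grading_e_def by simp
    ultimately have "\<not> int (p ^ k) dvd Gcd {n. quotient_grading R A q n \<noteq> {\<zero>\<^bsub>R Quot q\<^esub>}}"
      by metis
    \<comment> \<open>A gcd that is not a multiple of \<open>p ^ k\<close> comes from a single
      degree \<open>n\<close> of the quotient with this property; \<open>q\<close> itself is the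
      zero of the quotient.\<close>
    then obtain n where n: "quotient_grading R A q n \<noteq> {q}" "\<not> int (p ^ k) dvd n"
      by (auto simp: dvd_Gcd_iff FactRing_def)
    have "\<exists>h\<in>A n. q +> h \<noteq> q"
    proof (rule ccontr)
      assume "\<not> ?thesis"
      then have "quotient_grading R A q n = {q}"
        unfolding quotient_grading_def using A_zero[of n] by (auto intro!: image_eqI[of _ _ \<zero>])
      then show False using n by blast
    qed
    then obtain h where h: "h \<in> A n" "q +> h \<noteq> q" by blast
    have hc: "h \<in> carrier R" using A_carrier h by blast
    have hq: "h \<notin> q" using h(2) q.a_rcos_const by blast
    have n0: "n \<noteq> 0" using n(2) by auto
    define v where "v = multiplicity (int p) n"
    have pp: "Factorial_Ring.prime (int p)" using p(1) by simp
    obtain n' where n': "n = int p ^ v * n'" "\<not> int p dvd n'"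
      using multiplicity_decompose'[of n "int p"] n0 pp unfolding v_def by (metis not_prime_unit)
    have "v < k"
    proof (rule ccontr)
      assume "\<not> v < k"
      then have "int p ^ k dvd int p ^ v" by (intro le_imp_power_dvd) simp
      then show False using n(2) n'(1) by simp
    qed
    \<comment> \<open>With \<open>n = p ^ v * n'\<close> and \<open>v \<le> l\<close>, this exponent
      gives \<open>r * n = m * n'\<close> with \<open>n'\<close> prime to \<open>p\<close>, the
      degree that \<open>extend_along_prime\<close> asks for.\<close>
    define r where "r = c * p ^ (l - v)"
    have "p ^ l = p ^ (l - v) * p ^ v" using \<open>v < k\<close> by (simp add: k_def power_add[symmetric])
    then have "int r * n = int m * n'" unfolding r_def c(3) n'(1) by simp
    then have "h [^] r \<in> A (int m * n')" using A_pow[OF h(1), of r] by simp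
    moreover have "h [^] r \<notin> q" using primeideal_pow[OF pq hc] hq by blast
    ultimately show ?thesis using n'(2) by blast
  qed
  moreover have "m > 0" using d0 m by (cases m) auto
  ultimately have "hom_nonrigid m" using extend_along_prime[OF nd _ p(1)] nr m by blast
  then show False using maximal_no_divisor[OF d m] prime_gt_1_nat[OF p(1)] by blast
qed

end

text \<open>The map sending a scalar to its multiple of \<open>\<one>\<close> is a ring
  homomorphism, and its image serves as \<open>F\<close>. Positive integers are units of
  \<open>K\<close>, so their images are units of \<open>B\<close> and nonzero.\<close>

lemma affine_graded:
  fixes K :: "('k, 'm) ring_scheme" and B :: "('k, 'a, 'n) module_scheme"
  assumes "field K" "char_zero K" "affine_domain K B" "int_graded_ring B A"
  shows "\<exists>F S. graded_affine_domain B A F S"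
proof -
  interpret K: field K by fact
  interpret B: domain B using assms(3) by (simp add: affine_domain_def)
  interpret algebra K B using assms(3) by (simp add: affine_domain_def)
  interpret G: int_graded_ring B A by fact
  let ?i = "\<lambda>c. c \<odot>\<^bsub>B\<^esub> \<one>\<^bsub>B\<^esub>"
  let ?F = "?i ` carrier K"
  obtain S where S: "finite S" "S \<subseteq> carrier B" "carrier B = generate_ring B (?F \<union> S)"
    using assms(3) unfolding affine_domain_def fin_gen_algebra_def by blast
  have ic: "?i c \<in> carrier B" if "c \<in> carrier K" for c using that by simp
  have iadd: "?i (a \<oplus>\<^bsub>K\<^esub> b) = ?i a \<oplus>\<^bsub>B\<^esub> ?i b" if "a \<in> carrier K" "b \<in> carrier K" for a b
    using that by (simp add: smult_l_distr)
  have imult: "?i (a \<otimes>\<^bsub>K\<^esub> b) = ?i a \<otimes>\<^bsub>B\<^esub> ?i b" if "a \<in> carrier K" "b \<in> carrier K" for a b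
    using that by (simp add: smult_assoc1 smult_assoc2)
  have ione: "?i \<one>\<^bsub>K\<^esub> = \<one>\<^bsub>B\<^esub>" by simp
  have hom: "?i \<in> ring_hom K B"
    by (rule ring_hom_memI) (use ic iadd imult ione in auto)
  interpret i: ring_hom_ring K B ?i
    by (rule ring_hom_ringI2[OF K.ring_axioms B.ring_axioms hom])
  have F: "subfield ?F B"
    by (rule i.img_is_subfield(2)[OF K.carrier_is_subfield]) simp
  have nat: "B.nat_el n = ?i ([n] \<cdot>\<^bsub>K\<^esub> \<one>\<^bsub>K\<^esub>)" for n :: nat
  proof (induction n)
    case 0 then show ?case using i.hom_zero by simp
  next
    case (Suc n)
    have "[Suc n] \<cdot>\<^bsub>K\<^esub> \<one>\<^bsub>K\<^esub> = [n] \<cdot>\<^bsub>K\<^esub> \<one>\<^bsub>K\<^esub> \<oplus>\<^bsub>K\<^esub> \<one>\<^bsub>K\<^esub>" by simp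
    then show ?case using Suc iadd ione by (simp add: B.nat_el_Suc)
  qed
  have char0: "B.nat_el n \<noteq> \<zero>\<^bsub>B\<^esub>" if "n > 0" for n
  proof
    assume z: "B.nat_el n = \<zero>\<^bsub>B\<^esub>"
    let ?c = "[n] \<cdot>\<^bsub>K\<^esub> \<one>\<^bsub>K\<^esub>"
    have "?c \<in> Units K" using assms(2) that K.field_Units unfolding char_zero_def by simp
    then have u: "?c \<in> carrier K" "inv\<^bsub>K\<^esub> ?c \<in> carrier K" "?c \<otimes>\<^bsub>K\<^esub> inv\<^bsub>K\<^esub> ?c = \<one>\<^bsub>K\<^esub>" by simp_all
    then have "?i ?c \<otimes>\<^bsub>B\<^esub> ?i (inv\<^bsub>K\<^esub> ?c) = \<one>\<^bsub>B\<^esub>" using imult[OF u(1,2)] ione by simp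
    then show False using z nat[of n] ic[OF u(2)] by simp
  qed
  have "graded_affine_domain B A ?F S"
    by (intro graded_affine_domain.intro graded_domain.intro graded_affine_domain_axioms.intro
        B.domain_axioms G.int_graded_ring_axioms F S char0)
  then show ?thesis by blast
qed

theorem corollary7p16:
  fixes K :: "('k, 'm) ring_scheme"
    and B :: "('k, 'a, 'n) module_scheme"
    and A :: "int \<Rightarrow> 'a set"
  assumes "field K" and "char_zero K"
    and "affine_domain K B" and "int_graded_ring B A"
  shows "NR B A = (\<Union>d \<in> maximal_NR B A. multiples d) \<and>
    (normal_domain B \<longrightarrow>
      (\<forall>d \<in> maximal_NR B A. d dvd grading_ebar B A \<and> d \<oslash> grading_e B A = d))"
proof -
  obtain F S where "graded_affine_domain B A F S" using affine_graded[OF assms] by blast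
  then interpret graded_affine_domain B A F S .
  show ?thesis using NR_eq maximal_dvd_ebar maximal_oslash by blast
qed

end
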